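(* There is a constant $C$ such that, for every $n\ge 3$, every convex drawing $D$ of $K_n$ in the sphere has at least $\frac{n^2}{3}-C\,n$ empty triangles. (That is, $D$ has at least $n^2/3-O(n)$ empty triangles.)
   Context: Drawings: vertices are represented by distinct points, and each edge by a simple arc joining its end vertices and containing no other vertex; two edges meet only at common end vertices or at (finitely many) crossings. All drawings are good: no two edges incident with a common vertex cross; no three edges cross at a common point; no two edges cross each other more than once. For a subgraph $H$ of $K_n$, $D[H]$ is the subdrawing of $D$ induced by $H$ (also viewed as a point set). For a drawing $D$ of $K_n$ in the sphere and a 3-cycle (triangle) $T$ of $K_n$, $D[T]$ is a simple closed curve and bounds two closed discs. A closed disc $\Delta$ bounded by $D[T]$ is convex if, for any distinct vertices $u,v$ of $K_n$ with $D[u],D[v]\in\Delta$, we have $D[uv]\subseteq\Delta$. The drawing $D$ is convex if, for every 3-cycle $T$ in $K_n$, at least one of the two closed discs bounded by $D[T]$ is convex. An empty triangle of $D$ is an open disc $\Delta$ bounded by $D[xyz]$, for some 3-cycle $xyz$ of $K_n$, such that $\Delta$ contains no point $D[v]$ with $v\in V(K_n)$. *)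

theory Defs
  imports "HOL-Analysis.Analysis" "HOL-Library.Ramsey"
begin

abbreviation S2 :: "(real^3) set" where
  "S2 \<equiv> sphere 0 1"

text \<open>The complete graph on n vertices has vertex set \<open>{..<n}\<close> and edge set \<open>nsets {..<n} 2\<close>.
  A drawing is recorded by its vertex points and the point sets of its edges; values outside
  these two index sets are irrelevant.\<close>

record drawing =
  vpoint :: "nat \<Rightarrow> real^3"
  edge_set :: "nat set \<Rightarrow> (real^3) set"

text \<open>A crossing is transversal: near the point, the two curves look like the two
  coordinate axes of the plane near the origin. In particular, a point where the curves merely
  touch, or an end point of one of them, is not a crossing.\<close>

definition crosses_at :: "(real^3) set \<Rightarrow> (real^3) set \<Rightarrow> real^3 \<Rightarrow> bool" where
  "crosses_at A B x \<longleftrightarrow>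
     (\<exists>U h k. openin (top_of_set S2) U \<and> x \<in> U \<and>
        homeomorphism U (UNIV :: complex set) h k \<and> h x = 0 \<and>
        h ` (A \<inter> U) = {z. Im z = 0} \<and> h ` (B \<inter> U) = {z. Re z = 0})"

definition is_drawing :: "nat \<Rightarrow> drawing \<Rightarrow> bool" where
  "is_drawing n D \<longleftrightarrow>
     inj_on (vpoint D) {..<n} \<and> vpoint D ` {..<n} \<subseteq> S2 \<and>
     (\<forall>u<n. \<forall>v<n. u \<noteq> v \<longrightarrow>
        (\<exists>g. arc g \<and> path_image g = edge_set D {u, v} \<and>
             pathstart g = vpoint D u \<and> pathfinish g = vpoint D v) \<and>
        edge_set D {u, v} \<subseteq> S2 \<and>
        (\<forall>w<n. vpoint D w \<in> edge_set D {u, v} \<longrightarrow> w \<in> {u, v})) \<and>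
     (\<forall>e \<in> nsets {..<n} 2. \<forall>f \<in> nsets {..<n} 2. e \<noteq> f \<longrightarrow>
        (\<forall>x \<in> edge_set D e \<inter> edge_set D f.
           x \<in> vpoint D ` (e \<inter> f) \<or> crosses_at (edge_set D e) (edge_set D f) x) \<and>
        finite {x. crosses_at (edge_set D e) (edge_set D f) x})"

definition good_drawing :: "nat \<Rightarrow> drawing \<Rightarrow> bool" where
  "good_drawing n D \<longleftrightarrow>
     is_drawing n D \<and>
     (\<forall>e \<in> nsets {..<n} 2. \<forall>f \<in> nsets {..<n} 2. e \<noteq> f \<and> e \<inter> f \<noteq> {} \<longrightarrow>
        \<not> (\<exists>x. crosses_at (edge_set D e) (edge_set D f) x)) \<and>
     (\<forall>e \<in> nsets {..<n} 2. \<forall>f \<in> nsets {..<n} 2. \<forall>g \<in> nsets {..<n} 2.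
        e \<noteq> f \<and> f \<noteq> g \<and> e \<noteq> g \<longrightarrow>
        \<not> (\<exists>x. crosses_at (edge_set D e) (edge_set D f) x \<and>
               crosses_at (edge_set D f) (edge_set D g) x \<and>
               crosses_at (edge_set D e) (edge_set D g) x)) \<and>
     (\<forall>e \<in> nsets {..<n} 2. \<forall>f \<in> nsets {..<n} 2. e \<noteq> f \<longrightarrow>
        (\<forall>x y. crosses_at (edge_set D e) (edge_set D f) x \<and>
               crosses_at (edge_set D e) (edge_set D f) y \<longrightarrow> x = y))"

text \<open>The point set of the subdrawing induced by the complete graph on W. A 3-cycle is the complete
  graph on its three vertices, so it is given by a 3-element vertex set.\<close>

definition subdrawing :: "drawing \<Rightarrow> nat set \<Rightarrow> (real^3) set" where
  "subdrawing D W = vpoint D ` W \<union> \<Union> (edge_set D ` nsets W 2)"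

text \<open>Boundaries are taken relative to the sphere, not in the ambient space.\<close>

definition closed_disc_bounded_by :: "(real^3) set \<Rightarrow> (real^3) set \<Rightarrow> bool" where
  "closed_disc_bounded_by \<Delta> C \<longleftrightarrow>
     \<Delta> \<subseteq> S2 \<and> \<Delta> homeomorphic cball (0 :: real^2) 1 \<and> top_of_set S2 frontier_of \<Delta> = C"

definition open_disc_bounded_by :: "(real^3) set \<Rightarrow> (real^3) set \<Rightarrow> bool" where
  "open_disc_bounded_by \<Delta> C \<longleftrightarrow>
     openin (top_of_set S2) \<Delta> \<and> \<Delta> homeomorphic ball (0 :: real^2) 1 \<and>
     top_of_set S2 frontier_of \<Delta> = C"

definition convex_disc :: "nat \<Rightarrow> drawing \<Rightarrow> (real^3) set \<Rightarrow> bool" where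
  "convex_disc n D \<Delta> \<longleftrightarrow>
     (\<forall>u<n. \<forall>v<n. u \<noteq> v \<and> vpoint D u \<in> \<Delta> \<and> vpoint D v \<in> \<Delta> \<longrightarrow> edge_set D {u, v} \<subseteq> \<Delta>)"

definition convex_drawing :: "nat \<Rightarrow> drawing \<Rightarrow> bool" where
  "convex_drawing n D \<longleftrightarrow>
     good_drawing n D \<and>
     (\<forall>T \<in> nsets {..<n} 3. \<exists>\<Delta>. closed_disc_bounded_by \<Delta> (subdrawing D T) \<and> convex_disc n D \<Delta>)"

definition empty_triangles :: "nat \<Rightarrow> drawing \<Rightarrow> (real^3) set set" where
  "empty_triangles n D =
     {\<Delta>. (\<exists>T \<in> nsets {..<n} 3. open_disc_bounded_by \<Delta> (subdrawing D T)) \<and>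
         vpoint D ` {..<n} \<inter> \<Delta> = {}}"

end

theory Submission
  imports Defs "HOL-Complex_Analysis.Riemann_Mapping"
begin

text \<open>Every vertex \<open>v\<close> lies in at least \<open>n - 1\<close> empty triangles (for \<open>n \<ge> 6\<close>), so there are at least
  \<open>n(n - 1)/3\<close> of them. Fix \<open>v\<close> and list the edges (spokes) at \<open>v\<close> in their rotation. Two consecutive
  spokes \<open>va\<close>, \<open>vb\<close> such that \<open>ab\<close> is crossed by no spoke bound an empty triangle. If \<open>ab\<close> is crossed
  by a spoke, then, by convexity, there is such a spoke \<open>vu\<close> that also crosses the edge \<open>u'u''\<close> between
  its two neighbours in the rotation; no other spoke crosses \<open>u'u''\<close>, so the triangle \<open>vu'u''\<close> is empty.
  A spoke crosses \<open>ab\<close> for at most one consecutive pair, hence different pairs yield different triangles.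

  Convexity enters only through drawings of \<open>K\<^sub>5\<close>: if the spoke \<open>vk\<close> crosses \<open>ij\<close>, then the side
  of the triangle \<open>vij\<close> in which \<open>vk\<close> starts is the convex one.\<close>

section \<open>Jordan curves on the sphere\<close>

text \<open>A drawing is given only by point sets, so the rotation at \<open>v\<close> has to be
  recovered from sides of Jordan curves: \<open>S v a b c d\<close> says that the spokes
  \<open>vc\<close> and \<open>vd\<close> leave \<open>v\<close> on different sides of the triangle
  \<open>vab\<close>. That such a relation behaves like alternation in a cyclic order comes from the
  three faces of a theta curve through three spokes. The obstacle is that edges may cross, so the
  three triangles spanned by three spokes need not be the cycles of one theta curve. Winding numbers
  bridge this gap: two closed curves that share an arc through \<open>v\<close> sort the spokes near
  \<open>v\<close> in the same way. On which side of the triangle \<open>vpq\<close> a vertex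
  \<open>k\<close> lies depends on two bits only: the side on which \<open>vk\<close> starts, and
  whether \<open>vk\<close> crosses \<open>pq\<close>. This turns emptiness into a condition on
  \<open>S\<close> and \<open>X\<close>, and the count at \<open>v\<close> becomes pure
  combinatorics. The factor 1/3 arises because a triangle is counted at each of its three vertices.
  The bound \<open>n \<ge> 6\<close> provides five spokes at every vertex; with only four, two
  different spokes could be charged with the same pair of neighbours.\<close>

definition jordan :: "(real^3) set \<Rightarrow> bool" where
  "jordan J \<longleftrightarrow> J \<subseteq> S2 \<and> (\<exists>g. simple_path g \<and> pathfinish g = pathstart g \<and> path_image g = J)"

abbreviation same_side :: "(real^3) set \<Rightarrow> real^3 \<Rightarrow> real^3 \<Rightarrow> bool" where
  "same_side J \<equiv> connected_component (S2 - J)"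

lemmas side_sym = connected_component_sym
lemmas side_trans = connected_component_trans
lemmas side_in = connected_component_in

lemma punctured_S2_homeomorphism:
  assumes "N \<in> S2"
  obtains P Q where "homeomorphism (S2 - {N}) (UNIV :: complex set) P Q"
proof -
  let ?T = "{x :: real^3. axis 1 1 \<bullet> x = 0}"
  have ne: "axis 1 1 \<noteq> (0 :: real^3)" by (simp add: axis_eq_0_iff)
  have "S2 - {N} homeomorphic ?T"
    by (rule homeomorphic_punctured_sphere_hyperplane) (use assms ne in auto)
  also have "?T homeomorphic (UNIV :: complex set)"
    by (rule homeomorphic_affine_sets)
       (use ne in \<open>auto simp: affine_hyperplane of_nat_diff\<close>)
  finally show ?thesis
    using that by (auto simp: homeomorphic_def)
qed

text \<open>Provides a point off the curve from which the sphere can be projected to the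
  plane.\<close>

lemma jordan_neq_S2:
  assumes "jordan J" shows "J \<noteq> S2"
proof
  assume "J = S2"
  with assms obtain g where g: "simple_path g" "pathfinish g = pathstart g" "path_image g = S2"
    by (auto simp: jordan_def)
  then have "S2 homeomorphic sphere (0::complex) 1"
    using homeomorphic_simple_path_image_circle[of g 1 0] by auto
  then have "simply_connected (sphere (0::complex) 1)"
    using homeomorphic_simply_connected_eq simply_connected_sphere_eq[of "0::real^3" 1] by fastforce
  then show False
    using simply_connected_sphere_eq[of "0::complex" 1] by simp
qed

lemma homeomorphism_image_jordan:
  fixes P :: "real^3 \<Rightarrow> complex"
  assumes J: "jordan J" and N: "N \<in> S2 - J" and h: "homeomorphism (S2 - {N}) (UNIV :: complex set) P Q"
  obtains c where "simple_path c" "pathfinish c = pathstart c" "path_image c = P ` J"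
proof -
  obtain g where g: "simple_path g" "pathfinish g = pathstart g" "path_image g = J"
    using J by (auto simp: jordan_def)
  have sub: "path_image g \<subseteq> S2 - {N}" using J N g by (auto simp: jordan_def)
  have "simple_path (P \<circ> g)"
  proof (rule simple_path_continuous_image)
    show "continuous_on (path_image g) P"
      using h sub continuous_on_subset homeomorphism_cont1 by blast
    show "inj_on P (path_image g)"
      by (rule inj_on_inverseI[of _ Q]) (use h sub in \<open>auto simp: homeomorphism_def\<close>)
  qed (use g in auto)
  moreover have "pathfinish (P \<circ> g) = pathstart (P \<circ> g)"
    using g by (simp add: pathfinish_def pathstart_def)
  ultimately show ?thesis
    using that g by (metis path_image_compose)
qed

text \<open>Carries the planar Jordan curve theorem over to the sphere by a chart of the sphere
  punctured at \<open>N\<close>. The unbounded component regains the point at infinity, which is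
  \<open>N\<close>; the work lies in showing that \<open>B\<close> stays open and connected
  there.\<close>

lemma jordan_sides_proj:
  fixes P :: "real^3 \<Rightarrow> complex"
  assumes J: "jordan J" and N: "N \<in> S2 - J" and h: "homeomorphism (S2 - {N}) (UNIV :: complex set) P Q"
  defines "A \<equiv> Q ` inside (P ` J)" and "B \<equiv> insert N (Q ` outside (P ` J))"
  shows "connected A" "connected B" "openin (top_of_set S2) A" "openin (top_of_set S2) B"
    "A \<inter> B = {}" "A \<union> B = S2 - J" "A \<noteq> {}" "J \<subseteq> closure A" "J \<subseteq> closure B"
proof -
  obtain c where c: "simple_path c" "pathfinish c = pathstart c" "path_image c = P ` J"
    using homeomorphism_image_jordan[OF J N h] .
  note JIO = Jordan_inside_outside[OF c(1,2), unfolded c(3)]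
  have JS: "J \<subseteq> S2 - {N}" using J N by (auto simp: jordan_def)
  have QP: "Q (P x) = x" if "x \<in> S2 - {N}" for x using h that by (simp add: homeomorphism_def)
  have PQ: "P (Q z) = z" for z using h by (simp add: homeomorphism_def)
  have Qim: "range Q = S2 - {N}" using h by (simp add: homeomorphism_def)
  have injQ: "inj Q" using PQ by (metis injI)
  have contQ: "continuous_on UNIV Q" using h by (simp add: homeomorphism_def)
  have QJ: "Q ` P ` J = J" using QP JS by (force simp: image_iff)
  have cmp: "compact (P ` J)" using c(1,3) compact_simple_path_image by metis
  have un: "inside (P ` J) \<union> outside (P ` J) = - (P ` J)"
    using JIO by blast
  show conA: "connected A" unfolding A_def
    using JIO by (intro connected_continuous_image continuous_on_subset[OF contQ]) auto
  have h': "homeomorphism UNIV (S2 - {N}) Q P" using h homeomorphism_symD by blast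
  have opS: "openin (top_of_set S2) (S2 - {N})"
    by (simp add: openin_delete)
  show "openin (top_of_set S2) A" unfolding A_def
    by (rule openin_trans[OF homeomorphism_imp_open_map[OF h'] opS]) (simp add: JIO)
  have AB: "Q ` inside (P ` J) \<union> Q ` outside (P ` J) = S2 - {N} - J"
  proof -
    have "Q ` (inside (P ` J) \<union> outside (P ` J)) = range Q - Q ` P ` J"
      unfolding un using injQ by (simp add: Compl_eq_Diff_UNIV image_set_diff)
    then show ?thesis by (simp only: Qim QJ image_Un)
  qed
  have disj: "Q ` inside (P ` J) \<inter> Q ` outside (P ` J) = {}"
    using JIO injQ by (metis image_Int image_is_empty)
  show ABd: "A \<inter> B = {}"
    using disj Qim unfolding A_def B_def by auto
  show ABu: "A \<union> B = S2 - J"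
    using AB N unfolding A_def B_def by auto
  \<comment> \<open>This makes \<open>B\<close> open also at \<open>N\<close>: the complement of
    \<open>B\<close> is \<open>A \<union> J\<close>, the image of a compact planar set and hence
    closed.\<close>
  have "compact (inside (P ` J) \<union> P ` J)"
  proof -
    have "closed (inside (P ` J) \<union> P ` J)"
      using JIO union_with_inside[of "P ` J"] by (metis Un_commute closed_Compl) 
    moreover have "bounded (inside (P ` J) \<union> P ` J)"
      using JIO cmp by (simp add: compact_imp_bounded)
    ultimately show ?thesis by (simp add: compact_eq_bounded_closed)
  qed
  then have "compact (Q ` (inside (P ` J) \<union> P ` J))"
    using contQ compact_continuous_image continuous_on_subset by blast
  then have "closed (A \<union> J)" unfolding A_def image_Un QJ by (rule compact_imp_closed)
  moreover have "B = S2 - (A \<union> J)" using ABd ABu N J by (auto simp: jordan_def)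
  ultimately show opB: "openin (top_of_set S2) B"
    by (metis Diff_Int_distrib2 openin_open_Int Compl_eq_Diff_UNIV Diff_eq closed_def)
  have Qcl: "Q ` closure X \<subseteq> closure (Q ` X)" for X
    by (rule image_closure_subset) (auto intro: continuous_on_subset[OF contQ] closure_subset[THEN subsetD])
  have fin: "frontier (inside (P ` J)) = P ` J" and fout: "frontier (outside (P ` J)) = P ` J"
    using Jordan_inside_outside[OF c(1,2)] c(3) by auto
  show "J \<subseteq> closure A"
    using Qcl[of "inside (P ` J)"] fin QJ unfolding A_def frontier_def by blast
  show "J \<subseteq> closure B"
  proof -
    have "P ` J \<subseteq> closure (outside (P ` J))" using fout by (auto simp: frontier_def)
    then have "J \<subseteq> Q ` closure (outside (P ` J))" using QJ by blast
    also have "\<dots> \<subseteq> closure (Q ` outside (P ` J))" by (rule Qcl)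
    also have "\<dots> \<subseteq> closure B" by (rule closure_mono) (auto simp: B_def)
    finally show ?thesis .
  qed
  show "A \<noteq> {}" using JIO by (simp add: A_def)
  \<comment> \<open>Otherwise the open set \<open>B\<close> would show \<open>N\<close> to be an
    isolated point of the sphere. With \<open>N\<close> in the closure, adding it keeps the image of
    the outside connected.\<close>
  have Ncl: "N \<in> closure (Q ` outside (P ` J))"
  proof (rule ccontr)
    assume n: "N \<notin> closure (Q ` outside (P ` J))"
    obtain U where U: "open U" "B = S2 \<inter> U" using opB by (auto simp: openin_open)
    let ?V = "U - closure (Q ` outside (P ` J))"
    have "N \<in> ?V" using n U by (auto simp: B_def)
    moreover have "open ?V" using U by auto
    moreover have "N islimpt S2"
    proof (rule connected_imp_perfect)
      show "connected S2" by (rule connected_sphere) simp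
      show "S2 \<noteq> {x}" for x
      proof
        assume *: "S2 = {x}"
        have "N \<in> S2" "- N \<in> S2" using N by auto
        then have "N = x" "- N = x" unfolding * by auto
        then have "N + N = 0" by (metis add.right_inverse)
        then have "N = 0" by (metis scaleR_2 scaleR_eq_0_iff zero_neq_numeral)
        then show False using N by auto
      qed
    qed (use N in auto)
    ultimately obtain y where "y \<in> S2" "y \<in> ?V" "y \<noteq> N" by (meson islimptE)
    then have "y \<in> B" using U by blast
    then have "y \<in> Q ` outside (P ` J)" using \<open>y \<noteq> N\<close> unfolding B_def by blast
    then show False using \<open>y \<in> ?V\<close> closure_subset[of "Q ` outside (P ` J)"] by auto
  qed
  have "connected (Q ` outside (P ` J))"
    using JIO by (intro connected_continuous_image continuous_on_subset[OF contQ]) auto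
  then show "connected B" unfolding B_def
    by (rule connected_intermediate_closure)
       (use Ncl closure_subset[of "Q ` outside (P ` J)"] in auto)
qed

lemma same_side_iff:
  assumes "connected A" "openin (top_of_set S2) A" "openin (top_of_set S2) B"
    "A \<inter> B = {}" "A \<union> B = S2 - J" "x \<in> A"
  shows "same_side J x y \<longleftrightarrow> y \<in> A"
proof
  assume "same_side J x y"
  then obtain T where T: "connected T" "T \<subseteq> S2 - J" "x \<in> T" "y \<in> T"
    by (auto simp: connected_component_def)
  obtain U V where UV: "open U" "A = S2 \<inter> U" "open V" "B = S2 \<inter> V"
    using assms(2,3) by (auto simp: openin_open)
  have "U \<inter> T = {} \<or> V \<inter> T = {}"
    by (rule connectedD[OF T(1) UV(1,3)]) (use UV T assms in blast)+
  then show "y \<in> A" using T assms UV by blast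
next
  assume "y \<in> A"
  then show "same_side J x y"
    using assms unfolding connected_component_def by blast
qed

lemma jordan_sides:
  assumes "jordan J"
  obtains A B where "connected A" "connected B" "openin (top_of_set S2) A" "openin (top_of_set S2) B"
    "A \<inter> B = {}" "A \<union> B = S2 - J" "A \<noteq> {}" "B \<noteq> {}" "J \<subseteq> closure A" "J \<subseteq> closure B"
proof -
  obtain N where N: "N \<in> S2 - J" using jordan_neq_S2[OF assms] assms unfolding jordan_def by blast
  then obtain P Q where "homeomorphism (S2 - {N}) (UNIV :: complex set) P Q"
    using punctured_S2_homeomorphism by blast
  note * = jordan_sides_proj[OF assms N this]
  show thesis by (rule that[OF *(1-7) _ *(8-9)]) auto
qed

text \<open>The complement of a Jordan curve has only two components.\<close>

lemma same_side_trichotomy: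
  assumes "jordan J" "x \<in> S2 - J" "y \<in> S2 - J" "z \<in> S2 - J"
    and "\<not> same_side J x y" "\<not> same_side J y z"
  shows "same_side J x z"
proof -
  obtain A B where AB: "connected A" "connected B" "openin (top_of_set S2) A" "openin (top_of_set S2) B"
    "A \<inter> B = {}" "A \<union> B = S2 - J" using jordan_sides[OF assms(1)] by metis
  have BA: "B \<inter> A = {}" "B \<union> A = S2 - J" using AB by auto
  show ?thesis
    using assms same_side_iff[OF AB(1,3,4,5,6)] same_side_iff[OF AB(2,4,3) BA] AB(6) by blast
qed

lemma closure_meets_open:
  assumes "z \<in> closure A" "open W" "z \<in> W"
  obtains a where "a \<in> A" "a \<in> W"
  using open_Int_closure_eq_empty[OF assms(2), of A] assms by blast

text \<open>Both sides accumulate at every point of the curve. With \<open>W = UNIV\<close> this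
  simply supplies a point on the other side.\<close>

lemma same_side_near:
  assumes J: "jordan J" and x: "x \<in> S2 - J" and z: "z \<in> J" and W: "open W" "z \<in> W"
  obtains y y' where "y \<in> W" "same_side J x y" "y' \<in> W" "y' \<in> S2 - J" "\<not> same_side J x y'"
proof -
  obtain A B where AB: "connected A" "connected B" "openin (top_of_set S2) A" "openin (top_of_set S2) B"
    "A \<inter> B = {}" "A \<union> B = S2 - J" "J \<subseteq> closure A" "J \<subseteq> closure B" using jordan_sides[OF J] by metis
  have BA: "B \<inter> A = {}" "B \<union> A = S2 - J" using AB by auto
  note sA = same_side_iff[OF AB(1,3,4,5,6)] and sB = same_side_iff[OF AB(2,4,3) BA]
  obtain a where a: "a \<in> A" "a \<in> W" using AB(7) z W closure_meets_open by blast
  obtain b where b: "b \<in> B" "b \<in> W" using AB(8) z W closure_meets_open by blast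
  show ?thesis
  proof (cases "x \<in> A")
    case True
    then show ?thesis using that[of a b] a b sA[of x a] sA[of x b] AB(5,6) by blast
  next
    case False
    then have "x \<in> B" using x AB(6) by blast
    then show ?thesis using that[of b a] a b sB[of x a] sB[of x b] AB(5,6) by blast
  qed
qed

lemma openin_same_side:
  assumes "jordan J" "x \<in> S2 - J"
  shows "openin (top_of_set S2) {y. same_side J x y}"
proof -
  obtain A B where AB: "connected A" "connected B" "openin (top_of_set S2) A" "openin (top_of_set S2) B"
    "A \<inter> B = {}" "A \<union> B = S2 - J" using jordan_sides[OF assms(1)] by metis
  have BA: "B \<inter> A = {}" "B \<union> A = S2 - J" using AB by auto
  have "{y. same_side J x y} = (if x \<in> A then A else B)"
    using same_side_iff[OF AB(1,3,4,5,6)] same_side_iff[OF AB(2,4,3) BA] AB(6) assms(2) by auto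
  then show ?thesis using AB by simp
qed

lemma same_side_closure:
  assumes J: "jordan J" "x \<in> S2 - J" and z: "z \<in> closure {y. same_side J x y}" "z \<in> S2 - J"
  shows "same_side J x z"
proof (rule ccontr)
  assume n: "\<not> same_side J x z"
  obtain W where W: "open W" "{y. same_side J z y} = S2 \<inter> W"
    using openin_same_side[OF J(1) z(2)] by (auto simp: openin_open)
  have "same_side J z z" using z(2) by (simp add: connected_component_refl_eq)
  then have "z \<in> W" using W by blast
  then obtain y where y: "y \<in> W" "same_side J x y"
    using closure_meets_open[OF z(1) W(1)] by blast
  then have "y \<in> S2" using side_in by blast
  then have "same_side J z y" using W y by blast
  then show False using n y side_sym side_trans by metis
qed

text \<open>When \<open>N\<close> is itself one of the two points compared, lying on different sides
  means that the other point is inside the planar curve. This is how theta curves are handled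
  below.\<close>

lemma same_side_proj:
  fixes P :: "real^3 \<Rightarrow> complex"
  assumes J: "jordan J" and N: "N \<in> S2 - J" and h: "homeomorphism (S2 - {N}) (UNIV :: complex set) P Q"
    and y: "y \<in> S2 - J" "y \<noteq> N"
  shows "same_side J N y \<longleftrightarrow> P y \<in> outside (P ` J)"
    and "x \<in> S2 - J \<Longrightarrow> x \<noteq> N \<Longrightarrow> same_side J x y \<longleftrightarrow> (P x \<in> inside (P ` J) \<longleftrightarrow> P y \<in> inside (P ` J))"
proof -
  define A where "A = Q ` inside (P ` J)"
  define B where "B = insert N (Q ` outside (P ` J))"
  note AB = jordan_sides_proj[OF J N h, folded A_def B_def]
  have BA: "B \<inter> A = {}" "B \<union> A = S2 - J" using AB by auto
  have QP: "Q (P u) = u" if "u \<in> S2 - {N}" for u using h that by (simp add: homeomorphism_def)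
  have PQ: "P (Q z) = z" for z using h by (simp add: homeomorphism_def)
  have img: "u \<in> Q ` X \<longleftrightarrow> P u \<in> X" if "u \<in> S2 - {N}" for u X
    using QP[OF that] PQ by (metis imageE image_eqI)
  have inA: "u \<in> A \<longleftrightarrow> P u \<in> inside (P ` J)" if "u \<in> S2 - {N}" for u
    unfolding A_def by (rule img[OF that])
  have inB: "u \<in> B \<longleftrightarrow> P u \<in> outside (P ` J)" if "u \<in> S2 - {N}" for u
    using img[OF that] that unfolding B_def by simp
  have "N \<in> B" by (simp add: B_def)
  note sA = same_side_iff[OF AB(1,3,4,5,6)] and sB = same_side_iff[OF AB(2,4,3) BA]
  show "same_side J N y \<longleftrightarrow> P y \<in> outside (P ` J)"
    using sB[OF \<open>N \<in> B\<close>] inB y by auto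
  show "same_side J x y \<longleftrightarrow> (P x \<in> inside (P ` J) \<longleftrightarrow> P y \<in> inside (P ` J))"
    if "x \<in> S2 - J" "x \<noteq> N"
  proof (cases "x \<in> A")
    case True
    then show ?thesis using sA inA that y by auto
  next
    case False
    then have "x \<in> B" using that AB(6) by auto
    have "y \<in> S2 - {N}" "x \<in> S2 - {N}" "y \<in> A \<or> y \<in> B" "\<not> (y \<in> A \<and> y \<in> B)"
      using y that AB(5,6) by blast+
    then show ?thesis using sB[OF \<open>x \<in> B\<close>, of y] inA[of x] inA[of y] False by blast
  qed
qed

section \<open>Theta curves and locality\<close>

lemma jordan_two_arcs:
  assumes "arc c1" "arc c2" "pathstart c1 = a" "pathfinish c1 = b" "pathstart c2 = a" "pathfinish c2 = b"
    and "path_image c1 \<inter> path_image c2 \<subseteq> {a, b}" and "path_image c1 \<subseteq> S2" "path_image c2 \<subseteq> S2"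
  shows "jordan (path_image c1 \<union> path_image c2)"
proof -
  have "simple_path (c1 +++ reversepath c2)"
    by (rule simple_path_join_loop) (use assms in \<open>auto simp: arc_reversepath\<close>)
  moreover have "path_image (c1 +++ reversepath c2) = path_image c1 \<union> path_image c2"
    by (subst path_image_join) (use assms in auto)
  ultimately show ?thesis
    using assms unfolding jordan_def
    by (intro conjI exI[of _ "c1 +++ reversepath c2"]) auto
qed

lemma arc_continuous_image:
  assumes "arc g" "continuous_on (path_image g) f" "inj_on f (path_image g)"
  shows "arc (f \<circ> g)"
  using assms unfolding arc_def
  by (auto intro: path_continuous_image comp_inj_on simp: path_image_def)

text \<open>Projecting from \<open>y\<close> sends \<open>y\<close> to infinity. The assumption
  \<open>far\<close> puts the third arc inside the planar closed curve formed by the first two, so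
  it splits that inside into two regions. The second arc is on the boundary of the whole inside and
  hence outside the region bounded by the first and third arcs. A point \<open>z\<close> inside the
  big curve but not in that region must be in the other one, whereas the first arc is not.\<close>

lemma theta_faces_aux:
  assumes arcs: "arc c1" "arc c2" "arc c3"
    and ends: "pathstart c1 = a" "pathfinish c1 = b" "pathstart c2 = a" "pathfinish c2 = b"
      "pathstart c3 = a" "pathfinish c3 = b"
    and int: "path_image c1 \<inter> path_image c2 = {a, b}" "path_image c1 \<inter> path_image c3 = {a, b}"
      "path_image c2 \<inter> path_image c3 = {a, b}"
    and S: "path_image c1 \<subseteq> S2" "path_image c2 \<subseteq> S2" "path_image c3 \<subseteq> S2"
    and y: "y \<in> S2" "y \<notin> path_image c1" "y \<notin> path_image c2" "y \<notin> path_image c3"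
    and w: "w2 \<in> path_image c2 - {a, b}" "w3 \<in> path_image c3 - {a, b}"
    and far: "\<not> same_side (path_image c1 \<union> path_image c2) y w3"
  shows "same_side (path_image c1 \<union> path_image c3) y w2"
    and "z \<in> S2 - (path_image c1 \<union> path_image c2 \<union> path_image c3) \<Longrightarrow>
      w1 \<in> path_image c1 - {a, b} \<Longrightarrow>
      \<not> same_side (path_image c1 \<union> path_image c2) y z \<Longrightarrow>
      same_side (path_image c1 \<union> path_image c3) z w2 \<Longrightarrow>
      \<not> same_side (path_image c2 \<union> path_image c3) z w1"
proof -
  obtain P :: "real^3 \<Rightarrow> complex" and Q where h: "homeomorphism (S2 - {y}) UNIV P Q"
    using punctured_S2_homeomorphism[OF y(1)] .
  have injP: "inj_on P (S2 - {y})"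
    by (rule inj_on_inverseI[of _ Q]) (use h in \<open>auto simp: homeomorphism_def\<close>)
  have contP: "continuous_on (S2 - {y}) P" using h by (simp add: homeomorphism_def)
  let ?C1 = "path_image c1" and ?C2 = "path_image c2" and ?C3 = "path_image c3"
  have sub: "?C1 \<subseteq> S2 - {y}" "?C2 \<subseteq> S2 - {y}" "?C3 \<subseteq> S2 - {y}" using S y by auto
  have arc': "arc (P \<circ> c)" if "arc c" "path_image c \<subseteq> S2 - {y}" for c
    by (rule arc_continuous_image)
       (use that in \<open>auto intro: continuous_on_subset[OF contP] inj_on_subset[OF injP]\<close>)
  have iff: "P u \<in> P ` X \<longleftrightarrow> u \<in> X" if "u \<in> S2 - {y}" "X \<subseteq> S2 - {y}" for u X
    using that injP by (meson inj_on_image_mem_iff)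
  have Pint: "P ` X \<inter> P ` Y = P ` (X \<inter> Y)" if "X \<subseteq> S2 - {y}" "Y \<subseteq> S2 - {y}" for X Y
    using inj_on_image_Int[OF injP that] by simp
  have pim: "path_image (P \<circ> c) = P ` path_image c" for c by (rule path_image_compose)
  have ab: "a \<noteq> b" using arcs(1) ends by (metis arc_distinct_ends)
  have abin: "a \<in> ?C1" "b \<in> ?C1" using ends by auto
  have Pab: "P a \<noteq> P b" using ab injP sub abin by (meson inj_on_contraD subsetD)
  have J12: "jordan (?C1 \<union> ?C2)" and J13: "jordan (?C1 \<union> ?C3)" and J23: "jordan (?C2 \<union> ?C3)"
    using arcs ends int S by (auto intro!: jordan_two_arcs)
  have w2S: "w2 \<in> S2 - {y}" and w3S: "w3 \<in> S2 - {y}" using w sub by auto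
  have w3': "w3 \<notin> ?C1" "w3 \<notin> ?C2" and w2': "w2 \<notin> ?C1" "w2 \<notin> ?C3"
    using w int by auto
  have in12: "P w3 \<in> inside (P ` (?C1 \<union> ?C2))"
  proof -
    have "P w3 \<notin> outside (P ` (?C1 \<union> ?C2))"
      using same_side_proj(1)[OF J12 _ h, of w3] far y w3S w3' by auto
    moreover have "P w3 \<notin> P ` (?C1 \<union> ?C2)" using iff[OF w3S] w3' sub by (metis Un_iff Un_least)
    ultimately show ?thesis using union_with_inside[of "P ` (?C1 \<union> ?C2)"] by blast
  qed
  obtain split: "inside (P ` ?C1 \<union> P ` ?C3) \<inter> inside (P ` ?C2 \<union> P ` ?C3) = {}"
     "inside (P ` ?C1 \<union> P ` ?C3) \<union> inside (P ` ?C2 \<union> P ` ?C3) \<union> (P ` ?C3 - {P a, P b})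
        = inside (P ` ?C1 \<union> P ` ?C2)"
  proof (rule split_inside_simple_closed_curve[of "P \<circ> c1" "P a" "P b" "P \<circ> c2" "P \<circ> c3", unfolded pim])
    show "simple_path (P \<circ> c1)" "simple_path (P \<circ> c2)" "simple_path (P \<circ> c3)"
      using arc' arcs sub by (auto intro: arc_imp_simple_path)
    show "P ` ?C1 \<inter> P ` ?C2 = {P a, P b}" "P ` ?C1 \<inter> P ` ?C3 = {P a, P b}" "P ` ?C2 \<inter> P ` ?C3 = {P a, P b}"
      using Pint sub int by simp_all
    show "P ` ?C3 \<inter> inside (P ` ?C1 \<union> P ` ?C2) \<noteq> {}"
      using in12 w(2) by (auto simp: image_Un)
  qed (use ends Pab in \<open>auto simp: pathstart_compose pathfinish_compose\<close>)
  have ino: "inside X \<inter> X = {}" for X :: "complex set" by (rule inside_no_overlap)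
  have Pw2: "P w2 \<in> P ` ?C2" using w by auto
  have Pw2': "P w2 \<notin> inside (P ` (?C1 \<union> ?C3))"
    using split(2) ino[of "P ` ?C1 \<union> P ` ?C2"] Pw2 unfolding image_Un by blast
  have Pw2'': "P w2 \<notin> P ` (?C1 \<union> ?C3)" using iff[OF w2S] w2' sub by (metis Un_iff Un_least)
  show "same_side (?C1 \<union> ?C3) y w2"
    using same_side_proj(1)[OF J13 _ h, of w2] w2S w2' y Pw2' Pw2'' union_with_inside[of "P ` (?C1 \<union> ?C3)"]
    by auto
  show "\<not> same_side (?C2 \<union> ?C3) z w1"
    if z: "z \<in> S2 - (?C1 \<union> ?C2 \<union> ?C3)" and w1: "w1 \<in> ?C1 - {a, b}" and
      nz: "\<not> same_side (?C1 \<union> ?C2) y z" and s: "same_side (?C1 \<union> ?C3) z w2"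
  proof -
    have "z \<noteq> y"
      using nz y by (auto simp: connected_component_refl_eq)
    then have zS: "z \<in> S2 - {y}" using z by auto
    have w1S: "w1 \<in> S2 - {y}" "w1 \<notin> ?C2" "w1 \<notin> ?C3" using w1 sub int by auto
    have "P z \<notin> outside (P ` (?C1 \<union> ?C2))"
      using same_side_proj(1)[OF J12 _ h, of z] nz y zS z by auto
    moreover have "P z \<notin> P ` (?C1 \<union> ?C2)" using iff[OF zS] z sub by (metis Diff_iff Un_iff Un_least)
    ultimately have "P z \<in> inside (P ` ?C1 \<union> P ` ?C2)"
      using union_with_inside[of "P ` (?C1 \<union> ?C2)"] unfolding image_Un by blast
    moreover have "P z \<notin> P ` ?C3" using iff[OF zS] z sub by auto
    moreover have "P z \<notin> inside (P ` (?C1 \<union> ?C3))"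
      using same_side_proj(2)[OF J13 _ h, of w2 z] s y w2S w2' zS z Pw2' by auto
    ultimately have "P z \<in> inside (P ` (?C2 \<union> ?C3))" using split unfolding image_Un by blast
    moreover have "P w1 \<notin> inside (P ` (?C2 \<union> ?C3))"
      using split(2) ino[of "P ` ?C1 \<union> P ` ?C2"] w1 unfolding image_Un by blast
    ultimately show ?thesis
      using same_side_proj(2)[OF J23 _ h, of w1 z] y w1S zS z by auto
  qed
qed

text \<open>A theta curve has three faces, each bounded by two of the arcs. \<open>s1\<close>,
  \<open>s2\<close>, \<open>s3\<close> say that \<open>y\<close> lies in the face whose boundary
  omits the arc with that number, so exactly one of them holds.\<close>

lemma theta_faces:
  assumes arcs: "arc c1" "arc c2" "arc c3"
    and ends: "pathstart c1 = a" "pathfinish c1 = b" "pathstart c2 = a" "pathfinish c2 = b"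
      "pathstart c3 = a" "pathfinish c3 = b"
    and int: "path_image c1 \<inter> path_image c2 = {a, b}" "path_image c1 \<inter> path_image c3 = {a, b}"
      "path_image c2 \<inter> path_image c3 = {a, b}"
    and S: "path_image c1 \<subseteq> S2" "path_image c2 \<subseteq> S2" "path_image c3 \<subseteq> S2"
    and y: "y \<in> S2" "y \<notin> path_image c1" "y \<notin> path_image c2" "y \<notin> path_image c3"
    and w: "w1 \<in> path_image c1 - {a, b}" "w2 \<in> path_image c2 - {a, b}" "w3 \<in> path_image c3 - {a, b}"
  defines "s1 \<equiv> \<not> same_side (path_image c2 \<union> path_image c3) y w1"
    and "s2 \<equiv> \<not> same_side (path_image c1 \<union> path_image c3) y w2"
    and "s3 \<equiv> \<not> same_side (path_image c1 \<union> path_image c2) y w3"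
  shows "s1 \<or> s2 \<or> s3" "\<not> (s1 \<and> s2)" "\<not> (s1 \<and> s3)" "\<not> (s2 \<and> s3)"
proof -
  let ?C1 = "path_image c1" and ?C2 = "path_image c2" and ?C3 = "path_image c3"
  have int': "?C2 \<inter> ?C1 = {a,b}" "?C3 \<inter> ?C1 = {a,b}" "?C3 \<inter> ?C2 = {a,b}" using int by auto
  have J12: "jordan (?C1 \<union> ?C2)"
    using arcs ends int S by (auto intro!: jordan_two_arcs)
  show "\<not> (s2 \<and> s3)"
    using theta_faces_aux(1)[OF arcs ends int S y w(2,3)] unfolding s2_def s3_def by blast
  show "\<not> (s1 \<and> s3)"
    using theta_faces_aux(1)[OF arcs(2,1,3) ends(3,4,1,2,5,6) int'(1) int(3,2) S(2,1,3) y(1,3,2,4) w(1,3)]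
    unfolding s1_def s3_def by (metis Un_commute)
  show "\<not> (s1 \<and> s2)"
    using theta_faces_aux(1)[OF arcs(3,1,2) ends(5,6,1,2,3,4) int'(2,3) int(1) S(3,1,2) y(1,4,2,3) w(1,2)]
    unfolding s1_def s2_def by (metis Un_commute)
  have w3': "w3 \<in> S2 - (?C1 \<union> ?C2)" using w int S by auto
  have "a \<in> ?C1 \<union> ?C2" using ends by auto
  \<comment> \<open>\<open>y0\<close> lies in the face not bounded by the third arc. If
    \<open>y\<close> is on the same side of the first two arcs, \<open>s3\<close> holds; otherwise
    the second part of \<open>theta_faces_aux\<close>, projected from \<open>y0\<close>, yields
    \<open>s1\<close> or \<open>s2\<close>.\<close>
  then obtain y0 where y0: "y0 \<in> S2 - (?C1 \<union> ?C2)" "\<not> same_side (?C1 \<union> ?C2) w3 y0"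
    using same_side_near[OF J12 w3', of a UNIV] by auto
  have "same_side (?C1 \<union> ?C2) w3 u" if "u \<in> ?C3 - {a, b}" for u
    using connected_simple_path_endless[OF arc_imp_simple_path[OF arcs(3)]] ends int S w that
    unfolding connected_component_def by (intro exI[of _ "?C3 - {a, b}"]) auto
  moreover have "a \<in> ?C1" "b \<in> ?C1" using ends by auto
  ultimately have y03: "y0 \<notin> ?C3" using y0 by blast
  have y0w: "\<not> same_side (?C1 \<union> ?C2) y0 w3" using y0 side_sym by metis
  show "s1 \<or> s2 \<or> s3"
  proof (cases "same_side (?C1 \<union> ?C2) y0 y")
    case True
    then have "\<not> same_side (?C1 \<union> ?C2) y w3" using y0w side_trans[OF True, of w3] by blast
    then show ?thesis unfolding s3_def by simp
  next
    case False
    have "y0 \<in> S2" "y0 \<notin> ?C1" "y0 \<notin> ?C2" "y \<in> S2 - (?C1 \<union> ?C2 \<union> ?C3)" using y0 y by auto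
    with False show ?thesis
      using theta_faces_aux(2)[OF arcs ends int S _ _ _ y03 w(2,3) y0w, of y w1] w(1)
      unfolding s1_def s2_def by blast
  qed
qed

section \<open>Sides expressed by winding numbers, and their dependence on the curve near a
  point\<close>

lemma inside_iff_winding_number:
  assumes "simple_path c" "pathfinish c = pathstart c" "z \<notin> path_image c" "z' \<notin> path_image c"
  shows "(z \<in> inside (path_image c) \<longleftrightarrow> z' \<in> inside (path_image c)) \<longleftrightarrow> winding_number c z = winding_number c z'"
proof -
  have out: "winding_number c u = 0" if "u \<notin> path_image c" "u \<notin> inside (path_image c)" for u
    using that winding_number_zero_in_outside[OF simple_path_imp_path[OF assms(1)] assms(2), of u]
      union_with_inside[of "path_image c"] by blast
  obtain k where "k \<noteq> 0" "\<And>u. u \<in> inside (path_image c) \<Longrightarrow> winding_number c u = k"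
    by (rule simple_closed_path_winding_number_inside[OF assms(1)]) (metis zero_neq_one zero_neq_neg_one)+
  then show ?thesis using out assms(3,4) by metis
qed

lemma same_side_iff_winding_number:
  fixes P :: "real^3 \<Rightarrow> complex"
  assumes c: "simple_path c" "pathfinish c = pathstart c" "path_image c \<subseteq> S2"
    and N: "N \<in> S2 - path_image c" and h: "homeomorphism (S2 - {N}) (UNIV :: complex set) P Q"
    and y: "x \<in> S2 - path_image c" "x \<noteq> N" "y \<in> S2 - path_image c" "y \<noteq> N"
  shows "same_side (path_image c) x y \<longleftrightarrow> winding_number (P \<circ> c) (P x) = winding_number (P \<circ> c) (P y)"
    and "P x \<notin> path_image (P \<circ> c)" "simple_path (P \<circ> c)"
proof -
  have J: "jordan (path_image c)" using c by (auto simp: jordan_def)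
  have injP: "inj_on P (S2 - {N})"
    by (rule inj_on_inverseI[of _ Q]) (use h in \<open>auto simp: homeomorphism_def\<close>)
  have contP: "continuous_on (S2 - {N}) P" using h by (simp add: homeomorphism_def)
  have sub: "path_image c \<subseteq> S2 - {N}" using c N by auto
  have notin: "P u \<notin> path_image (P \<circ> c)" if "u \<in> S2 - path_image c" "u \<noteq> N" for u
    unfolding path_image_compose using inj_on_image_mem_iff[OF injP _ sub, of u] that by auto
  then show "P x \<notin> path_image (P \<circ> c)" using y by blast
  show sp: "simple_path (P \<circ> c)"
    by (rule simple_path_continuous_image)
       (use c sub in \<open>auto intro: continuous_on_subset[OF contP] inj_on_subset[OF injP]\<close>)
  have lp: "pathfinish (P \<circ> c) = pathstart (P \<circ> c)"
    using c by (simp add: pathfinish_compose pathstart_compose)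
  show "same_side (path_image c) x y \<longleftrightarrow> winding_number (P \<circ> c) (P x) = winding_number (P \<circ> c) (P y)"
    using same_side_proj(2)[OF J N h y(3,4,1,2)]
      inside_iff_winding_number[OF sp lp notin[OF y(1,2)] notin[OF y(3,4)]]
    by (simp add: path_image_compose)
qed

lemma Ints_close_eq:
  assumes "a \<in> \<int>" "b \<in> \<int>" "norm (a - b :: complex) < 1" shows "a = b"
proof -
  obtain m n :: int where "a = of_int m" "b = of_int n" using assms by (auto elim!: Ints_cases)
  then have "norm (of_int (m - n) :: complex) < 1" using assms by simp
  then show ?thesis using \<open>a = _\<close> \<open>b = _\<close> by (simp only: norm_of_int) (simp flip: of_int_abs)
qed

text \<open>The variation of the winding number of a Jordan curve near a point \<open>v\<close> of it is that of the
  part of the curve through \<open>v\<close>, because the rest contributes a function continuous at \<open>v\<close>.\<close>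

lemma same_side_local:
  assumes c: "simple_path (A +++ \<beta>)" "simple_path (A +++ \<beta>')"
    and ends: "pathfinish A = pathstart \<beta>" "pathfinish \<beta> = pathstart A"
      "pathfinish A = pathstart \<beta>'" "pathfinish \<beta>' = pathstart A"
    and S: "path_image A \<subseteq> S2" "path_image \<beta> \<subseteq> S2" "path_image \<beta>' \<subseteq> S2"
    and v: "v \<in> path_image A" "v \<notin> path_image \<beta>" "v \<notin> path_image \<beta>'"
  obtains W where "open W" "v \<in> W"
    "\<And>q q'. q \<in> W \<inter> S2 - path_image A \<Longrightarrow> q' \<in> W \<inter> S2 - path_image A \<Longrightarrow>
      same_side (path_image A \<union> path_image \<beta>) q q' \<longleftrightarrow> same_side (path_image A \<union> path_image \<beta>') q q'"
proof -
  let ?J = "path_image A \<union> path_image \<beta>" and ?J' = "path_image A \<union> path_image \<beta>'"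
  have im: "path_image (A +++ \<beta>) = ?J" "path_image (A +++ \<beta>') = ?J'"
    using ends by (auto simp: path_image_join)
  have lp: "pathfinish (A +++ \<beta>) = pathstart (A +++ \<beta>)" "pathfinish (A +++ \<beta>') = pathstart (A +++ \<beta>')"
    using ends by auto
  have J: "jordan ?J" "jordan ?J'" using c lp im S unfolding jordan_def by blast+
  have paths: "path A" "path \<beta>" "path \<beta>'"
    using c ends by (metis path_join simple_path_imp_path)+
  \<comment> \<open>The centre of projection has to avoid both curves: a point off
    \<open>?J'\<close> that lies on \<open>?J\<close> is moved off \<open>?J\<close> within the open
    complement of \<open>?J'\<close>.\<close>
  obtain N where N: "N \<in> S2 - ?J" "N \<in> S2 - ?J'"
  proof -
    obtain x where x: "x \<in> S2 - ?J'" using jordan_neq_S2[OF J(2)] J(2) unfolding jordan_def by blast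
    show ?thesis
    proof (cases "x \<in> ?J")
      case True
      have "closed ?J'" using paths by (auto simp: closed_path_image)
      then have op: "open (- ?J')" by (rule open_Compl)
      obtain x0 where x0: "x0 \<in> S2 - ?J" using jordan_neq_S2[OF J(1)] J(1) unfolding jordan_def by blast
      have xin: "x \<in> - ?J'" using x by blast
      show ?thesis
        by (rule same_side_near[OF J(1) x0 True op xin]) (use that in blast)
    qed (use that x in auto)
  qed
  obtain P :: "real^3 \<Rightarrow> complex" and Q where h: "homeomorphism (S2 - {N}) UNIV P Q"
    using punctured_S2_homeomorphism[of N] N by auto
  have injP: "inj_on P (S2 - {N})"
    by (rule inj_on_inverseI[of _ Q]) (use h in \<open>auto simp: homeomorphism_def\<close>)
  have contP: "continuous_on (S2 - {N}) P" using h by (simp add: homeomorphism_def)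
  have sub: "path_image A \<subseteq> S2 - {N}" "path_image \<beta> \<subseteq> S2 - {N}" "path_image \<beta>' \<subseteq> S2 - {N}"
    using S N by auto
  have path': "path (P \<circ> g)" if "path g" "path_image g \<subseteq> S2 - {N}" for g
    using that by (auto intro!: path_continuous_image continuous_on_subset[OF contP])
  have pA: "path (P \<circ> A)" and p\<beta>: "path (P \<circ> \<beta>)" and p\<beta>': "path (P \<circ> \<beta>')"
    using path' paths sub by auto
  have notin: "P u \<notin> path_image (P \<circ> g)" if "u \<in> S2 - {N}" "u \<notin> path_image g" "path_image g \<subseteq> S2 - {N}" for u g
    unfolding path_image_compose using inj_on_image_mem_iff[OF injP that(1,3)] that(2) by auto
  have vS: "v \<in> S2 - {N}" using v sub by auto
  \<comment> \<open>With 1/4, the contribution of \<open>\<beta>\<close> changes by less than 1/2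
    between two points near \<open>v\<close>, and so does that of \<open>\<beta>'\<close>. The
    difference of the two changes is an integer of norm below 1, hence 0.\<close>
  have near: "\<exists>d>0. \<forall>z. dist z (P v) < d \<longrightarrow> dist (winding_number g z) (winding_number g (P v)) < 1/4"
    if "path g" "P v \<notin> path_image g" for g
    using continuous_at_winding_number[OF that] unfolding continuous_at_eps_delta
    by (elim allE[of _ "1/4"] impE) auto
  obtain d where d: "d > 0" "\<And>z. dist z (P v) < d \<Longrightarrow> dist (winding_number (P \<circ> \<beta>) z) (winding_number (P \<circ> \<beta>) (P v)) < 1/4"
    using near[OF p\<beta> notin[OF vS v(2) sub(2)]] by blast
  obtain d' where d': "d' > 0" "\<And>z. dist z (P v) < d' \<Longrightarrow> dist (winding_number (P \<circ> \<beta>') z) (winding_number (P \<circ> \<beta>') (P v)) < 1/4"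
    using near[OF p\<beta>' notin[OF vS v(3) sub(3)]] by blast
  obtain e where e: "e > 0" "\<And>u. u \<in> S2 - {N} \<Longrightarrow> dist u v < e \<Longrightarrow> dist (P u) (P v) < min d d'"
    using contP vS d(1) d'(1) unfolding continuous_on_iff by (metis min_less_iff_conj)
  define W where "W = ball v e - {N} - path_image \<beta> - path_image \<beta>'"
  show thesis
  proof (rule that[of W])
    show "open W" unfolding W_def
      using paths closed_path_image by (intro open_Diff) auto
    show "v \<in> W" unfolding W_def using e v vS by auto
    fix q q' assume q: "q \<in> W \<inter> S2 - path_image A" "q' \<in> W \<inter> S2 - path_image A"
    have wsum: "winding_number (P \<circ> (A +++ g)) (P u) = winding_number (P \<circ> A) (P u) + winding_number (P \<circ> g) (P u)"
      if "u \<in> S2 - {N}" "u \<notin> path_image A" "u \<notin> path_image g" "path g" "path_image g \<subseteq> S2 - {N}"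
        "pathfinish A = pathstart g" for u g
      using that notin sub(1) pA path'
      by (simp add: path_compose_join winding_number_join pathfinish_compose pathstart_compose)
    have qW: "u \<in> S2 - {N}" "u \<notin> path_image A" "u \<notin> path_image \<beta>" "u \<notin> path_image \<beta>'"
      "dist (P u) (P v) < d" "dist (P u) (P v) < d'" if "u = q \<or> u = q'" for u
      using that q e(2)[of u] unfolding W_def by (auto simp: dist_commute)
    let ?w = "\<lambda>g u. winding_number (P \<circ> g) (P u)"
    have dq: "dist (?w \<beta> q) (?w \<beta> q') < 1/2" "dist (?w \<beta>' q) (?w \<beta>' q') < 1/2"
      using d(2)[OF qW(5), of q] d(2)[OF qW(5), of q'] d'(2)[OF qW(6), of q] d'(2)[OF qW(6), of q']
      using dist_triangle3[of "?w \<beta> q" "?w \<beta> q'" "?w \<beta> v"] dist_triangle3[of "?w \<beta>' q" "?w \<beta>' q'" "?w \<beta>' v"]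
      by (auto simp: dist_commute)
    have Z: "?w (A +++ g) u \<in> \<int>" if "g = \<beta> \<or> g = \<beta>'" "u = q \<or> u = q'" for g u
    proof -
      have g: "simple_path (A +++ g)" "pathfinish (A +++ g) = pathstart (A +++ g)"
        "path_image (A +++ g) = path_image A \<union> path_image g"
        using that c lp im by auto
      have "P u \<notin> path_image (P \<circ> (A +++ g))"
        by (rule notin) (use qW[OF that(2)] g that sub in auto)
      moreover have "path (P \<circ> (A +++ g))"
        by (rule path') (use g that sub in \<open>auto simp: simple_path_imp_path\<close>)
      ultimately show ?thesis
        using g by (intro integer_winding_number) (auto simp: pathfinish_compose pathstart_compose)
    qed
    have sumq: "?w (A +++ \<beta>) q - ?w (A +++ \<beta>) q' - (?w (A +++ \<beta>') q - ?w (A +++ \<beta>') q')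
        = (?w \<beta> q - ?w \<beta> q') - (?w \<beta>' q - ?w \<beta>' q')"
      using wsum qW paths sub ends by simp
    have "norm ((?w \<beta> q - ?w \<beta> q') - (?w \<beta>' q - ?w \<beta>' q')) < 1"
      using dq norm_triangle_ineq4[of "?w \<beta> q - ?w \<beta> q'" "?w \<beta>' q - ?w \<beta>' q'"] unfolding dist_norm by linarith
    then have eq: "?w (A +++ \<beta>) q - ?w (A +++ \<beta>) q' = ?w (A +++ \<beta>') q - ?w (A +++ \<beta>') q'"
      by (intro Ints_close_eq) (use Z sumq in \<open>auto simp: Ints_diff\<close>)
    have qJ: "u \<in> S2 - path_image (A +++ g)" "u \<noteq> N" if "u = q \<or> u = q'" "g = \<beta> \<or> g = \<beta>'" for u g
      using qW[OF that(1)] im that(2) by auto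
    have "same_side ?J q q' \<longleftrightarrow> ?w (A +++ \<beta>) q = ?w (A +++ \<beta>) q'"
      using same_side_iff_winding_number(1)[OF c(1) lp(1) _ _ h qJ[of q \<beta>] qJ[of q' \<beta>]] im N S by simp
    moreover have "same_side ?J' q q' \<longleftrightarrow> ?w (A +++ \<beta>') q = ?w (A +++ \<beta>') q'"
      using same_side_iff_winding_number(1)[OF c(2) lp(2) _ _ h qJ[of q \<beta>'] qJ[of q' \<beta>']] im N S by simp
    ultimately show "same_side ?J q q' \<longleftrightarrow> same_side ?J' q q'" using eq by auto
  qed
qed

section \<open>Discs and crossings\<close>

lemma complex_ball_homeomorphic_real2:
  "ball (0 :: complex) 1 homeomorphic ball (0 :: real^2) 1"
proof -
  have "ball (0 :: complex) 1 homeomorphic (UNIV :: complex set)" by (rule homeomorphic_ball01_UNIV)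
  also have "(UNIV :: complex set) homeomorphic (UNIV :: (real^2) set)"
    by (rule homeomorphic_affine_sets) auto
  also have "(UNIV :: (real^2) set) homeomorphic ball (0 :: real^2) 1"
    using homeomorphic_ball01_UNIV homeomorphic_sym by blast
  finally show ?thesis .
qed

text \<open>Projecting from a point of the other side makes this side the inside of a planar Jordan
  curve. That inside is simply connected, so the Riemann mapping theorem makes it a disc.\<close>

lemma jordan_side_open_disc:
  assumes J: "jordan J" and x: "x \<in> S2 - J"
  shows "open_disc_bounded_by {y. same_side J x y} J"
proof -
  let ?K = "{y. same_side J x y}"
  obtain c where c: "simple_path c" "pathfinish c = pathstart c" "path_image c = J"
    using J by (auto simp: jordan_def)
  have "pathstart c \<in> J" using c by auto
  then obtain N where N: "N \<in> S2 - J" "\<not> same_side J x N"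
    using same_side_near[OF J x, of "pathstart c" UNIV] by auto
  obtain P :: "real^3 \<Rightarrow> complex" and Q where h: "homeomorphism (S2 - {N}) UNIV P Q"
    using punctured_S2_homeomorphism[of N] N by auto
  obtain c' where c': "simple_path c'" "pathfinish c' = pathstart c'" "path_image c' = P ` J"
    using homeomorphism_image_jordan[OF J N(1) h] .
  note AB = jordan_sides_proj[OF J N(1) h]
  let ?A = "Q ` inside (P ` J)" and ?B = "insert N (Q ` outside (P ` J))"
  have BA: "?B \<inter> ?A = {}" "?B \<union> ?A = S2 - J" using AB by auto
  have "x \<notin> ?B"
    using same_side_iff[OF AB(2,4,3) BA, of x N] N by blast
  then have "x \<in> ?A" using AB(6) x by blast
  then have KA: "?K = ?A"
    using same_side_iff[OF AB(1,3,4,5,6), of x] by blast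
  have op: "openin (top_of_set S2) ?K" unfolding KA by (rule AB(3))
  have "?K homeomorphic inside (P ` J)"
  proof -
    have "homeomorphism (inside (P ` J)) ?A Q P"
      by (rule homeomorphism_of_subsets[OF homeomorphism_symD[OF h], where T'' = "{}"]) auto
    then show ?thesis unfolding KA using homeomorphic_def homeomorphic_sym by blast
  qed
  also have "inside (P ` J) homeomorphic ball (0::complex) 1"
    using simply_connected_inside_simple_path[OF c'(1)] Jordan_inside_outside[OF c'(1,2)]
      simply_connected_eq_homeomorphic_to_disc[of "inside (P ` J)"] c'(3) by simp
  also note complex_ball_homeomorphic_real2
  finally have ball: "?K homeomorphic ball (0 :: real^2) 1" .
  have KS: "?K \<subseteq> S2 - J" using side_in by blast
  have "top_of_set S2 frontier_of ?K = top_of_set S2 closure_of ?K - ?K"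
    using op by (rule frontier_of_openin)
  also have "top_of_set S2 closure_of ?K = S2 \<inter> closure ?K"
    using KS by (simp add: closure_of_subtopology Int_absorb1 subset_iff)
  also have "S2 \<inter> closure ?K - ?K = J"
  proof
    show "S2 \<inter> closure ?K - ?K \<subseteq> J"
    proof
      fix z assume z: "z \<in> S2 \<inter> closure ?K - ?K"
      show "z \<in> J"
      proof (rule ccontr)
        assume "z \<notin> J"
        then have "same_side J x z" using same_side_closure[OF J x, of z] z by blast
        then show False using z by blast
      qed
    qed
    have "J \<subseteq> closure ?K" unfolding KA by (rule AB(8))
    then show "J \<subseteq> S2 \<inter> closure ?K - ?K" using KS J unfolding jordan_def by blast
  qed
  finally show ?thesis unfolding open_disc_bounded_by_def using op ball by blast
qed

text \<open>Excludes a closed disc bounded by \<open>J\<close> that consists of \<open>J\<close>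
  alone, so its interior relative to the sphere is nonempty.\<close>

lemma jordan_neq_closed_disc:
  assumes "jordan J" shows "\<not> J homeomorphic cball (0 :: real^2) 1"
proof
  assume h: "J homeomorphic cball (0 :: real^2) 1"
  obtain g where g: "simple_path g" "pathfinish g = pathstart g" "path_image g = J"
    using assms by (auto simp: jordan_def)
  have "J homeomorphic sphere (0::complex) 1"
    using homeomorphic_simple_path_image_circle[OF g(1,2), of 1 0] g(3) by simp
  then have "sphere (0::complex) 1 homeomorphic cball (0 :: real^2) 1"
    using h homeomorphic_sym homeomorphic_trans by blast
  then have "simply_connected (sphere (0::complex) 1)"
    using homeomorphic_simply_connected_eq convex_imp_simply_connected[OF convex_cball] by blast
  then show False
    using simply_connected_sphere_eq[of "0::complex" 1] by simp
qed

text \<open>A closed disc is specified only up to homeomorphism and by its frontier. Its relative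
  interior is open and closed in the complement of \<open>J\<close>, so it is a union of sides: at
  least one because it is nonempty, and not both because the whole sphere has empty
  frontier.\<close>

lemma closed_disc_is_side:
  assumes J: "jordan J" and D: "closed_disc_bounded_by \<Delta> J"
  obtains x where "x \<in> S2 - J" "\<Delta> = J \<union> {y. same_side J x y}"
proof -
  have DS: "\<Delta> \<subseteq> S2" and Dh: "\<Delta> homeomorphic cball (0 :: real^2) 1"
    and Df: "top_of_set S2 frontier_of \<Delta> = J" using D by (auto simp: closed_disc_bounded_by_def)
  have "compact \<Delta>" using homeomorphic_compactness[OF Dh] by simp
  then have clD: "closed \<Delta>" by (rule compact_imp_closed)
  then have "closedin (top_of_set S2) \<Delta>" using DS by (simp add: closed_subset)
  then have Dfr: "J = \<Delta> - top_of_set S2 interior_of \<Delta>"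
    using Df by (simp add: frontier_of_def closure_of_closedin)
  define I where "I = top_of_set S2 interior_of \<Delta>"
  have I: "openin (top_of_set S2) I" "I \<subseteq> \<Delta>" by (auto simp: I_def interior_of_subset)
  have IJ: "\<Delta> = J \<union> I" "J \<inter> I = {}" using Dfr I by (auto simp: I_def)
  obtain U where U: "open U" "I = S2 \<inter> U" using I by (auto simp: openin_open)
  have stable: "x \<in> I \<longleftrightarrow> y \<in> I" if xy: "same_side J x y" for x y
  proof -
    obtain T where T: "connected T" "T \<subseteq> S2 - J" "x \<in> T" "y \<in> T"
      using xy by (auto simp: connected_component_def)
    have "U \<inter> T = {} \<or> - \<Delta> \<inter> T = {}"
      by (rule connectedD[OF T(1) U(1) open_Compl[OF clD]]) (use U T IJ DS in blast)+
    then show ?thesis using T U IJ by blast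
  qed
  have "I \<noteq> {}" using jordan_neq_closed_disc[OF J] Dh IJ by auto
  then obtain x where x: "x \<in> I" by blast
  have xJ: "x \<in> S2 - J" using x IJ DS by blast
  have "\<Delta> \<noteq> S2"
  proof
    assume "\<Delta> = S2"
    then have "J = {}" using Df frontier_of_topspace[of "top_of_set S2"] by simp
    then show False using J by (auto simp: jordan_def)
  qed
  then obtain z where z: "z \<in> S2" "z \<notin> \<Delta>" using DS by blast
  have zJ: "z \<in> S2 - J" using z IJ by blast
  have "same_side J x y" if y: "y \<in> I" for y
  proof (rule ccontr)
    assume n: "\<not> same_side J x y"
    have yJ: "y \<in> S2 - J" using y IJ DS by blast
    have "\<not> same_side J y x" using n side_sym by blast
    moreover have "\<not> same_side J x z" using stable[of x z] x z IJ by blast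
    ultimately have "same_side J y z" using same_side_trichotomy[OF J yJ xJ zJ] by blast
    then show False using stable[of y z] y z IJ by blast
  qed
  then have "I = {y. same_side J x y}" using stable[of x] x by blast
  then show ?thesis using that xJ IJ by blast
qed

text \<open>In the chart at the crossing, \<open>J\<close> is the real axis and \<open>g\<close>
  runs in the imaginary axis. The closed set \<open>R\<close> covers the rest of \<open>J\<close>;
  it misses \<open>z\<close>, so it disappears from a small ball, whose two open half-discs lie on
  different sides. The curve \<open>g\<close> passes from one half-disc to the other and meets
  \<open>J\<close> at no other interior parameter.\<close>

lemma crossing_switches_sides:
  assumes J: "jordan J" and f: "f \<subseteq> J" "J \<subseteq> f \<union> R" "closed R" "z \<notin> R"
    and cr: "crosses_at f (path_image g) z"
    and g: "arc g" "path_image g \<subseteq> S2" "z = g s" "0 < s" "s < 1"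
    and only: "\<And>t. 0 < t \<Longrightarrow> t < 1 \<Longrightarrow> g t \<in> J \<Longrightarrow> t = s"
    and t: "0 < t1" "t1 < s" "s < t2" "t2 < 1"
  shows "\<not> same_side J (g t1) (g t2)"
proof
  assume same: "same_side J (g t1) (g t2)"
  obtain U h k where U: "openin (top_of_set S2) U" "z \<in> U" and hk: "homeomorphism U (UNIV :: complex set) h k"
    and hz: "h z = 0" and hf: "h ` (f \<inter> U) = {z. Im z = 0}" and he: "h ` (path_image g \<inter> U) = {z. Re z = 0}"
    using cr by (auto simp: crosses_at_def)
  have kh: "k (h u) = u" if "u \<in> U" for u using hk that by (simp add: homeomorphism_def)
  have hkw: "h (k w) = w" for w using hk by (simp add: homeomorphism_def)
  have kU: "k w \<in> U" for w using hk by (auto simp: homeomorphism_def)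
  have contk: "continuous_on UNIV k" and conth: "continuous_on U h" using hk by (auto simp: homeomorphism_def)
  have US: "U \<subseteq> S2" using U openin_subset by fastforce
  have "k 0 = z" using kh[OF U(2)] hz by simp
  have "open (k -` (- R))" using contk f(3) by (simp add: open_vimage open_Compl)
  then obtain r where r: "r > 0" "ball 0 r \<subseteq> k -` (- R)"
    using open_contains_ball \<open>k 0 = z\<close> f(4) by (metis ComplI vimageI)
  have kf: "k w \<in> f \<longleftrightarrow> Im w = 0" for w
  proof
    assume "k w \<in> f"
    then have "h (k w) \<in> h ` (f \<inter> U)" using kU by blast
    then show "Im w = 0" using hf hkw by simp
  next
    assume "Im w = 0"
    then have "w \<in> h ` (f \<inter> U)" using hf by simp
    then obtain u where "w = h u" "u \<in> f" "u \<in> U" by auto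
    then show "k w \<in> f" using kh by simp
  qed
  have kJ: "k w \<in> J \<longleftrightarrow> Im w = 0" if "w \<in> ball 0 r" for w
    using that r f kf[of w] by auto
  define Hp where "Hp = ball 0 r \<inter> {w :: complex. Im w > 0}"
  define Hn where "Hn = ball 0 r \<inter> {w :: complex. Im w < 0}"
  have conH: "connected (k ` H)" if "H = Hp \<or> H = Hn" for H
  proof (rule connected_continuous_image)
    show "continuous_on H k" using contk continuous_on_subset by blast
    show "connected H" using that unfolding Hp_def Hn_def
      by (auto intro!: convex_connected convex_Int simp: convex_halfspace_Im_gt convex_halfspace_Im_lt)
  qed
  have subH: "k ` H \<subseteq> S2 - J" if "H = Hp \<or> H = Hn" for H
  proof
    fix u assume "u \<in> k ` H"
    then obtain v where v: "u = k v" "v \<in> H" by blast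
    then have "v \<in> ball 0 r" "Im v \<noteq> 0" using that by (auto simp: Hp_def Hn_def)
    then show "u \<in> S2 - J" using v kJ[of v] kU[of v] US by blast
  qed
  have sameH: "same_side J (k w) (k w')" if "w \<in> H" "w' \<in> H" "H = Hp \<or> H = Hn" for w w' H
    by (rule connected_componentI[OF conH[OF that(3)] subH[OF that(3)]]) (use that in auto)
  have zJ: "z \<in> J" using kf[of 0] \<open>k 0 = z\<close> f by auto
  define V where "V = k ` ball 0 r"
  have "openin (top_of_set U) V" unfolding V_def
    by (rule homeomorphism_imp_open_map[OF homeomorphism_symD[OF hk]]) auto
  then have "openin (top_of_set S2) V" using U openin_trans by blast
  then obtain W where W: "open W" "V = S2 \<inter> W" by (auto simp: openin_open)
  have "z \<in> V" unfolding V_def using r(1) \<open>k 0 = z\<close> by (metis centre_in_ball imageI)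
  then have zW: "z \<in> W" using W by blast
  have g01: "g ` {0..1} \<subseteq> S2" "inj_on g {0..1}" "continuous_on {0..1} g"
    using g by (auto simp: path_image_def arc_def path_def)
  have gJ: "g u \<in> S2 - J" if "0 < u" "u < 1" "u \<noteq> s" for u
  proof -
    have "g u \<in> g ` {0..1}" using that by simp
    then show ?thesis using only[of u] that g01(1) by blast
  qed
  have x0: "g t1 \<in> S2 - J" using gJ t by auto
  obtain y y' where y: "y \<in> W" "same_side J (g t1) y" "y' \<in> W" "y' \<in> S2 - J" "\<not> same_side J (g t1) y'"
    using same_side_near[OF J x0 zJ W(1) zW] .
  have "y \<in> S2 - J" using y(2) side_in by blast
  then have "y \<in> V" "y' \<in> V" using y W by auto
  then obtain w w' where w: "y = k w" "w \<in> ball 0 r" "y' = k w'" "w' \<in> ball 0 r" unfolding V_def by blast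
  have wH: "w \<in> Hp \<or> w \<in> Hn" "w' \<in> Hp \<or> w' \<in> Hn"
    using w kJ[of w] kJ[of w'] y(4) \<open>y \<in> S2 - J\<close> unfolding Hp_def Hn_def by auto
  have nyy: "\<not> same_side J y y'" using y(2,5) side_trans by metis
  \<comment> \<open>If the half-discs were on one side, all points near \<open>z\<close> off
    \<open>J\<close> would be, although both sides accumulate at \<open>z\<close>.\<close>
  have opp: "\<not> same_side J (k p) (k q)" if "p \<in> Hp" "q \<in> Hn" for p q
  proof
    assume pq: "same_side J (k p) (k q)"
    have "same_side J (k p) (k v)" if "v \<in> Hp \<or> v \<in> Hn" for v
      using that sameH[OF \<open>p \<in> Hp\<close>, of v] sameH[OF \<open>q \<in> Hn\<close>, of v] pq side_trans by metis
    then have "same_side J (k p) y" "same_side J (k p) y'" using wH w by auto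
    then show False using nyy side_sym side_trans by metis
  qed
  have "continuous_on {0<..<1} g" by (rule continuous_on_subset[OF g01(3)]) auto
  then have "open ({0<..<1} \<inter> g -` W)"
    by (rule continuous_open_preimage[OF _ open_greaterThanLessThan W(1)])
  moreover have "s \<in> {0<..<1} \<inter> g -` W" using zW g by auto
  ultimately obtain d where d: "d > 0" "ball s d \<subseteq> {0<..<1} \<inter> g -` W"
    using open_contains_ball by metis
  define a where "a = max t1 (s - d/2)"
  define b where "b = min t2 (s + d/2)"
  have ab: "a < s" "s < b" "t1 \<le> a" "b \<le> t2" using d t by (auto simp: a_def b_def)
  have inb: "{a..b} \<subseteq> ball s d"
    using d(1) by (auto simp: a_def b_def dist_real_def)
  have gV: "g u \<in> V" if "u \<in> {a..b}" for u
    using that inb d(2) W g01(1) by (auto simp: subset_iff)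
  have VU: "V \<subseteq> U" unfolding V_def using kU by blast
  have Re0: "Re (h (g u)) = 0" if "u \<in> {a..b}" for u
  proof -
    have "u \<in> {0..1}" using that ab t by auto
    then have "g u \<in> path_image g \<inter> U" using gV[OF that] VU by (auto simp: path_image_def)
    then show ?thesis using he by blast
  qed
  let ?\<phi> = "\<lambda>u. Im (h (g u))"
  \<comment> \<open>An injective continuous function on an interval is strictly monotone; since
    \<open>?\<phi>\<close> vanishes at \<open>s\<close>, it has opposite signs at \<open>a\<close>
    and \<open>b\<close>.\<close>
  have inj\<phi>: "inj_on ?\<phi> {a..b}"
  proof (rule inj_onI)
    fix u u' assume u: "u \<in> {a..b}" "u' \<in> {a..b}" "?\<phi> u = ?\<phi> u'"
    then have "h (g u) = h (g u')" using Re0 by (simp add: complex_eq_iff)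
    then have "g u = g u'" using kh gV VU u by (metis subsetD)
    moreover have "u \<in> {0..1}" "u' \<in> {0..1}" using u ab t by auto
    ultimately show "u = u'" using g01(2) by (auto dest: inj_onD)
  qed
  have "continuous_on {a..b} g" using g01(3) ab t by (auto intro: continuous_on_subset)
  then have cont\<phi>: "continuous_on {a..b} ?\<phi>"
    by (intro continuous_intros continuous_on_compose2[OF conth]) (use gV VU in auto)
  have "?\<phi> s = 0" using hz g(3) by simp
  then have alt: "?\<phi> a < 0 \<and> 0 < ?\<phi> b \<or> ?\<phi> b < 0 \<and> 0 < ?\<phi> a"
    using continuous_inj_imp_mono[OF ab(1,2) cont\<phi> inj\<phi>] by simp
  have gH: "\<exists>p. g u = k p \<and> p \<in> ball 0 r \<and> Im p = ?\<phi> u" if "u \<in> {a..b}" for u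
    using gV[OF that] hkw unfolding V_def by force
  obtain p q where pq: "g a = k p" "p \<in> ball 0 r" "Im p = ?\<phi> a" "g b = k q" "q \<in> ball 0 r" "Im q = ?\<phi> b"
    using gH[of a] gH[of b] ab by auto
  have nab: "\<not> same_side J (g a) (g b)"
    using alt opp[of p q] opp[of q p] pq side_sym unfolding Hp_def Hn_def by fastforce
  have seg: "same_side J (g u) (g u')" if "u \<le> u'" "0 < u" "u' < 1" "s \<notin> {u..u'}" for u u'
  proof -
    have "connected (g ` {u..u'})"
      by (rule connected_continuous_image) (use that g01(3) in \<open>auto intro: continuous_on_subset\<close>)
    moreover have "g ` {u..u'} \<subseteq> S2 - J" using gJ that by (auto simp: image_subset_iff)
    ultimately show ?thesis
      by (rule connected_componentI) (use that in auto)
  qed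
  have "same_side J (g t1) (g a)" "same_side J (g b) (g t2)"
    using seg[of t1 a] seg[of b t2] ab t by auto
  then have "same_side J (g a) (g t1)" "same_side J (g t2) (g b)"
    by (simp_all add: side_sym)
  then have "same_side J (g a) (g b)"
    using same by (blast intro: side_trans)
  then show False using nab by blast
qed

section \<open>Germs of edges in a convex drawing\<close>

lemma Int_eq_singleton_mono:
  assumes "X \<inter> Y = {p}" "Z \<subseteq> Y"
  shows "p \<in> Z \<Longrightarrow> X \<inter> Z = {p}" "p \<notin> Z \<Longrightarrow> X \<inter> Z = {}"
proof -
  have "x = p" if "x \<in> X" "x \<in> Z" for x using that assms by blast
  moreover have "p \<in> X" using assms(1) by blast
  ultimately show "p \<in> Z \<Longrightarrow> X \<inter> Z = {p}" "p \<notin> Z \<Longrightarrow> X \<inter> Z = {}" by blast+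
qed

definition exactly_one :: "bool \<Rightarrow> bool \<Rightarrow> bool \<Rightarrow> bool" where
  "exactly_one p q r \<longleftrightarrow> (p \<or> q \<or> r) \<and> \<not> (p \<and> q) \<and> \<not> (p \<and> r) \<and> \<not> (q \<and> r)"

lemma distinct5_neq:
  assumes "distinct [v, a, b, c, d]"
  shows "v \<noteq> a" "v \<noteq> b" "v \<noteq> c" "v \<noteq> d" "a \<noteq> b" "a \<noteq> c" "a \<noteq> d" "b \<noteq> c" "b \<noteq> d" "c \<noteq> d"
  using assms by auto

text \<open>A two-colouring of the complement replaces chains of symmetry and transitivity by
  propositional reasoning about equalities of Booleans.\<close>

lemma same_side_bool:
  assumes "jordan J"
  obtains f :: "real^3 \<Rightarrow> bool" where "\<And>x y. x \<in> S2 - J \<Longrightarrow> y \<in> S2 - J \<Longrightarrow> same_side J x y \<longleftrightarrow> f x = f y"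
proof -
  obtain z where z: "z \<in> S2 - J" using jordan_neq_S2[OF assms] assms unfolding jordan_def by blast
  show ?thesis
  proof (rule that[of "same_side J z"])
    fix x y assume xy: "x \<in> S2 - J" "y \<in> S2 - J"
    show "same_side J x y \<longleftrightarrow> same_side J z x = same_side J z y"
    proof
      assume s: "same_side J x y"
      show "same_side J z x = same_side J z y"
        using side_trans[OF _ s, of z]
          side_trans[OF _ side_sym[OF s], of z] by blast
    next
      assume e: "same_side J z x = same_side J z y"
      show "same_side J x y"
      proof (cases "same_side J z x")
        case True
        then show ?thesis
          using e side_trans[OF side_sym[OF True], of y] by blast
      next
        case False
        then have "\<not> same_side J x z" using side_sym by blast
        then show ?thesis using same_side_trichotomy[OF assms xy(1) z xy(2)] e False by blast
      qed
    qed
  qed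
qed

lemma Int_eq_singletonD: "X \<inter> Y = {p} \<Longrightarrow> x \<in> X \<Longrightarrow> x \<noteq> p \<Longrightarrow> x \<notin> Y"
  by (metis IntI singletonD)

lemma arc_split:
  assumes "arc g" "0 < s" "s < 1"
  shows "arc (subpath 0 s g)" "arc (subpath s 1 g)"
    "path_image (subpath 0 s g) = g ` {0..s}" "path_image (subpath s 1 g) = g ` {s..1}"
    "g ` {0..s} \<union> g ` {s..1} = path_image g" "g ` {0..s} \<inter> g ` {s..1} = {g s}"
proof -
  show "arc (subpath 0 s g)" "arc (subpath s 1 g)"
    using assms by (auto intro!: arc_subpath_arc)
  show "path_image (subpath 0 s g) = g ` {0..s}" "path_image (subpath s 1 g) = g ` {s..1}"
    using assms by (auto simp: path_image_subpath)
  have "{0..s} \<union> {s..1} = {0..1}" using assms by auto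
  then show "g ` {0..s} \<union> g ` {s..1} = path_image g"
    unfolding path_image_def by (metis image_Un)
  have "{0..s} \<inter> {s..1} = {s}" using assms by auto
  moreover have "inj_on g {0..1}" using assms by (simp add: arc_def)
  ultimately show "g ` {0..s} \<inter> g ` {s..1} = {g s}"
    using assms inj_on_image_Int[of g "{0..1}" "{0..s}" "{s..1}"] by (simp add: atLeastatMost_subset_iff)
qed

section \<open>Edges as arcs, triangles as Jordan curves\<close>

locale convex_complete_drawing =
  fixes n :: nat and D :: drawing
  assumes convex: "convex_drawing n D"
begin

abbreviation pt :: "nat \<Rightarrow> real^3" where "pt \<equiv> vpoint D"

abbreviation E :: "nat \<Rightarrow> nat \<Rightarrow> (real^3) set" where "E u w \<equiv> edge_set D {u, w}"

abbreviation tri :: "nat \<Rightarrow> nat \<Rightarrow> nat \<Rightarrow> (real^3) set" where "tri a b c \<equiv> subdrawing D {a, b, c}"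

text \<open>Meant for four distinct vertices, where every common point of the two edges is a
  crossing; for edges with a common end it holds trivially.\<close>

definition X :: "nat \<Rightarrow> nat \<Rightarrow> nat \<Rightarrow> nat \<Rightarrow> bool" where
  "X a b c d \<longleftrightarrow> E a b \<inter> E c d \<noteq> {}"

lemma X_commute: "X a b c d \<longleftrightarrow> X c d a b" "X a b c d \<longleftrightarrow> X b a c d" "X a b c d \<longleftrightarrow> X a b d c"
  by (auto simp: X_def insert_commute)

lemma good: "good_drawing n D" and drawing: "is_drawing n D"
  using convex by (auto simp: convex_drawing_def good_drawing_def)

lemmas drawing_parts =
  drawing[unfolded is_drawing_def, THEN conjunct1]
  drawing[unfolded is_drawing_def, THEN conjunct2, THEN conjunct1]
  drawing[unfolded is_drawing_def, THEN conjunct2, THEN conjunct2, THEN conjunct1]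
  drawing[unfolded is_drawing_def, THEN conjunct2, THEN conjunct2, THEN conjunct2]

lemmas edges_meet = drawing_parts(4)[THEN bspec, THEN bspec, THEN mp, THEN conjunct1, THEN bspec]

lemmas adjacent_not_crossing =
  good[unfolded good_drawing_def, THEN conjunct2, THEN conjunct1, THEN bspec, THEN bspec, THEN mp]

lemmas edges_cross_once =
  good[unfolded good_drawing_def, THEN conjunct2, THEN conjunct2, THEN conjunct2, THEN bspec, THEN bspec, THEN mp]

lemma pt_S2: "u < n \<Longrightarrow> pt u \<in> S2"
  using drawing_parts(2) by blast

lemma pt_eq_iff: "u < n \<Longrightarrow> w < n \<Longrightarrow> pt u = pt w \<longleftrightarrow> u = w"
  using drawing_parts(1) by (metis inj_on_contraD lessThan_iff)

lemma edge:
  assumes "u < n" "w < n" "u \<noteq> w"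
  shows "\<exists>g. arc g \<and> path_image g = E u w \<and> pathstart g = pt u \<and> pathfinish g = pt w"
    and "E u w \<subseteq> S2" and "k < n \<Longrightarrow> pt k \<in> E u w \<longleftrightarrow> k \<in> {u, w}"
proof -
  have *: "(\<exists>g. arc g \<and> path_image g = E u w \<and> pathstart g = pt u \<and> pathfinish g = pt w) \<and>
      E u w \<subseteq> S2 \<and> (\<forall>k<n. pt k \<in> E u w \<longrightarrow> k \<in> {u, w})"
    using drawing_parts(3) assms by blast
  then show "\<exists>g. arc g \<and> path_image g = E u w \<and> pathstart g = pt u \<and> pathfinish g = pt w" "E u w \<subseteq> S2"
    by blast+
  from * obtain g where g: "path_image g = E u w" "pathstart g = pt u" "pathfinish g = pt w" by blast
  have "pt u \<in> E u w" "pt w \<in> E u w"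
    using pathstart_in_path_image[of g] pathfinish_in_path_image[of g] g by auto
  then show "pt k \<in> E u w \<longleftrightarrow> k \<in> {u, w}" if "k < n" using * that by blast
qed

text \<open>Chosen for ordered pairs: \<open>epath u w\<close> and \<open>epath w u\<close> have the
  same image, but their parametrisations are unrelated.\<close>

definition epath :: "nat \<Rightarrow> nat \<Rightarrow> real \<Rightarrow> real^3" where
  "epath u w = (SOME g. arc g \<and> path_image g = E u w \<and> pathstart g = pt u \<and> pathfinish g = pt w)"

lemma epath:
  assumes "u < n" "w < n" "u \<noteq> w"
  shows "arc (epath u w)" "path_image (epath u w) = E u w" "pathstart (epath u w) = pt u" "pathfinish (epath u w) = pt w"
  using someI_ex[OF edge(1)[OF assms]] unfolding epath_def by blast+

lemma epath_simps:
  assumes "u < n" "w < n" "u \<noteq> w"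
  shows "E u w = epath u w ` {0..1}" "epath u w 0 = pt u" "epath u w 1 = pt w" "inj_on (epath u w) {0..1}"
    "continuous_on {0..1} (epath u w)" "closed (E u w)"
  using epath[OF assms] closed_arc_image[OF epath(1)[OF assms]]
  by (auto simp: path_image_def pathstart_def pathfinish_def arc_def path_def)

lemma epath_eq_iff:
  assumes "u < n" "w < n" "u \<noteq> w" "0 \<le> t" "t \<le> 1" "0 \<le> t'" "t' \<le> 1"
  shows "epath u w t = epath u w t' \<longleftrightarrow> t = t'"
  using epath_simps(4)[OF assms(1-3)] assms(4-) by (auto dest: inj_onD)

lemma epath_in: "u < n \<Longrightarrow> w < n \<Longrightarrow> u \<noteq> w \<Longrightarrow> 0 \<le> t \<Longrightarrow> t \<le> 1 \<Longrightarrow> epath u w t \<in> E u w"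
  by (subst epath_simps) auto

lemma nsets_edge: "u < n \<Longrightarrow> w < n \<Longrightarrow> u \<noteq> w \<Longrightarrow> {u, w} \<in> nsets {..<n} 2"
  by (simp add: doubleton_in_nsets_2)

lemma edge_adjacent:
  assumes "u < n" "w < n" "x < n" "u \<noteq> w" "u \<noteq> x" "w \<noteq> x"
  shows "E u w \<inter> E u x = {pt u}"
proof -
  have ne: "{u, w} \<noteq> {u, x}" "{u, w} \<inter> {u, x} = {u}" using assms by auto
  have e: "{u, w} \<in> nsets {..<n} 2" "{u, x} \<in> nsets {..<n} 2" using nsets_edge assms by auto
  have "{u, w} \<inter> {u, x} \<noteq> {}" using ne by simp
  then have "\<not> (\<exists>z. crosses_at (E u w) (E u x) z)"
    by (intro adjacent_not_crossing[OF e] conjI ne(1))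
  then have "z \<in> pt ` ({u, w} \<inter> {u, x})" if "z \<in> E u w \<inter> E u x" for z
    using edges_meet[OF e ne(1) that] by blast
  then have "z = pt u" if "z \<in> E u w \<inter> E u x" for z
    using that unfolding ne(2) by blast
  moreover have "pt u \<in> E u w" "pt u \<in> E u x" using edge(3) assms by auto
  ultimately show ?thesis by blast
qed

lemma edge_disjoint:
  assumes "a < n" "b < n" "c < n" "d < n" "distinct [a, b, c, d]" "z \<in> E a b" "z \<in> E c d"
  shows "crosses_at (E a b) (E c d) z" and "z' \<in> E a b \<Longrightarrow> z' \<in> E c d \<Longrightarrow> z' = z"
    and "k < n \<Longrightarrow> z \<noteq> pt k"
proof -
  have e: "{a, b} \<in> nsets {..<n} 2" "{c, d} \<in> nsets {..<n} 2" using nsets_edge assms by auto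
  have ne: "{a, b} \<noteq> {c, d}" "{a, b} \<inter> {c, d} = {}" using assms by auto
  have *: "crosses_at (E a b) (E c d) x" if "x \<in> E a b \<inter> E c d" for x
    using edges_meet[OF e ne(1) that] unfolding ne(2) by simp
  show "crosses_at (E a b) (E c d) z" using * assms by blast
  have "\<forall>x y. crosses_at (E a b) (E c d) x \<and> crosses_at (E a b) (E c d) y \<longrightarrow> x = y"
    by (rule edges_cross_once[OF e ne(1)])
  then show "z' = z" if "z' \<in> E a b" "z' \<in> E c d" using * assms that by blast
  show "z \<noteq> pt k" if "k < n" using assms edge(3)[of a b k] edge(3)[of c d k] that by auto
qed

lemma tri_eq:
  assumes "a < n" "b < n" "c < n" "distinct [a, b, c]"
  shows "tri a b c = E a b \<union> E b c \<union> E a c"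
proof -
  have "nsets {a, b, c} 2 = {{a, b}, {b, c}, {a, c}}"
    using assms by (auto simp: nsets_2_eq)
  moreover have "pt a \<in> E a b" "pt b \<in> E a b" "pt c \<in> E b c" using edge(3) assms by auto
  ultimately show ?thesis unfolding subdrawing_def by auto
qed

lemma tri_jordan:
  assumes "a < n" "b < n" "c < n" "distinct [a, b, c]"
  shows "jordan (tri a b c)"
proof -
  have d: "a \<noteq> b" "b \<noteq> c" "a \<noteq> c" using assms by auto
  have i: "E a c \<inter> E c b = {pt c}" "E a b \<inter> E a c = {pt a}" "E a b \<inter> E c b = {pt b}"
    using edge_adjacent[of c a b] edge_adjacent[of a b c] edge_adjacent[of b a c] assms
    by (auto simp: insert_commute)
  have "arc (epath a c +++ epath c b)"
    by (rule arc_join) (use epath assms d i in auto)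
  moreover have im: "path_image (epath a c +++ epath c b) = E a c \<union> E c b"
    by (subst path_image_join) (use epath assms d in auto)
  moreover have "jordan (path_image (epath a b) \<union> path_image (epath a c +++ epath c b))"
    by (rule jordan_two_arcs[of _ _ "pt a" "pt b"])
       (use epath assms d im i edge(2) \<open>arc (epath a c +++ epath c b)\<close> in auto)
  ultimately have "jordan (E a b \<union> (E a c \<union> E c b))" using epath assms d by simp
  then show ?thesis using tri_eq[OF assms] by (simp add: insert_commute Un_ac)
qed

lemma pt_notin_tri:
  assumes "a < n" "b < n" "c < n" "distinct [a, b, c]" "k < n" "k \<notin> {a, b, c}"
  shows "pt k \<in> S2 - tri a b c"
  using tri_eq[OF assms(1-4)] edge(3)[of _ _ k] assms pt_S2 by auto

section \<open>Germs: initial pieces of spokes, and the sides on which edges run\<close>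

text \<open>The finitely many edges that avoid \<open>v\<close> form a closed set missing
  \<open>pt v\<close>, so an initial piece of the spoke stays clear of it.\<close>

lemma germ_radius_exists:
  assumes "v < n" "k < n" "v \<noteq> k"
  shows "\<exists>r. 0 < r \<and> r < 1 \<and> (\<forall>t. 0 < t \<and> t \<le> r \<longrightarrow>
    (\<forall>i<n. \<forall>j<n. i \<noteq> j \<and> i \<noteq> v \<and> j \<noteq> v \<longrightarrow> epath v k t \<notin> E i j))"
proof -
  let ?F = "{p \<in> {..<n} \<times> {..<n}. fst p \<noteq> snd p \<and> fst p \<noteq> v \<and> snd p \<noteq> v}"
  define R where "R = (\<Union>p\<in>?F. E (fst p) (snd p))"
  have "closed R" unfolding R_def
    by (rule closed_UN) (auto intro: epath_simps(6))
  moreover have "pt v \<notin> R" using edge(3)[of _ _ v] assms by (auto simp: R_def)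
  ultimately obtain e where e: "e > 0" "ball (pt v) e \<subseteq> - R"
    using open_contains_ball[of "- R"] by (auto simp: open_Compl)
  obtain d where d: "d > 0" "\<And>t. t \<in> {0..1} \<Longrightarrow> dist t 0 < d \<Longrightarrow> dist (epath v k t) (epath v k 0) < e"
    using epath_simps(5)[OF assms] e(1) unfolding continuous_on_iff by (metis atLeastAtMost_iff order_refl zero_le_one)
  let ?r = "min (d/2) (1/2)"
  have "epath v k t \<notin> E i j" if t: "0 < t" "t \<le> ?r" and ij: "i < n" "j < n" "i \<noteq> j" "i \<noteq> v" "j \<noteq> v" for t i j
  proof
    assume m: "epath v k t \<in> E i j"
    have "epath v k t \<in> ball (pt v) e"
      using d(2)[of t] t d(1) epath_simps(2)[OF assms] by (auto simp: dist_commute)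
    moreover have "epath v k t \<in> R" using m ij unfolding R_def by (intro UN_I[of "(i, j)"]) auto
    ultimately show False using e by auto
  qed
  then show ?thesis using d(1) by (intro exI[of _ ?r]) auto
qed

definition rad :: "nat \<Rightarrow> nat \<Rightarrow> real" where
  "rad v k = (SOME r. 0 < r \<and> r < 1 \<and> (\<forall>t. 0 < t \<and> t \<le> r \<longrightarrow>
    (\<forall>i<n. \<forall>j<n. i \<noteq> j \<and> i \<noteq> v \<and> j \<noteq> v \<longrightarrow> epath v k t \<notin> E i j)))"

text \<open>A point that stands for the direction in which the spoke \<open>vk\<close> leaves
  \<open>v\<close>. Up to this point the spoke, apart from \<open>v\<close>, meets no other edge, so
  its side relative to curves made of other edges would be the same for any smaller radius.\<close>

definition germ :: "nat \<Rightarrow> nat \<Rightarrow> real^3" where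
  "germ v k = epath v k (rad v k)"

lemma rad:
  assumes "v < n" "k < n" "v \<noteq> k"
  shows "0 < rad v k" "rad v k < 1"
    "\<And>t i j. 0 < t \<Longrightarrow> t \<le> rad v k \<Longrightarrow> i < n \<Longrightarrow> j < n \<Longrightarrow> i \<noteq> j \<Longrightarrow> i \<noteq> v \<Longrightarrow> j \<noteq> v \<Longrightarrow> epath v k t \<notin> E i j"
  using someI_ex[OF germ_radius_exists[OF assms]] unfolding rad_def[symmetric] by blast+

lemma germ_notin_edge:
  assumes "v < n" "k < n" "v \<noteq> k" "0 < t" "t \<le> rad v k" "i < n" "j < n" "i \<noteq> j" "k \<notin> {i, j} \<or> v \<notin> {i, j}"
  shows "epath v k t \<notin> E i j"
proof (cases "v \<in> {i, j}")
  case False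
  then show ?thesis using rad(3)[OF assms(1-5)] assms by auto
next
  case True
  then obtain l where l: "{i, j} = {v, l}" "l < n" "l \<noteq> v" "l \<noteq> k" using assms by auto
  have t: "t \<le> 1" using rad(2)[OF assms(1-3)] assms by simp
  have "epath v k t \<noteq> pt v" using epath_eq_iff[OF assms(1-3), of t 0] t assms(4) epath_simps(2)[OF assms(1-3)] by simp
  moreover have "epath v k t \<in> E v k" using epath_in[OF assms(1-3)] t assms(4) by simp
  moreover have "E v k \<inter> E v l = {pt v}" using edge_adjacent assms l by auto
  ultimately show ?thesis using l(1) by auto
qed

lemma germ_notin_tri:
  assumes "v < n" "k < n" "i < n" "j < n" "distinct [v, k, i, j]" "0 < t" "t \<le> rad v k"
  shows "epath v k t \<in> S2 - tri v i j"
proof -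
  have "t \<le> 1" using rad(2)[of v k] assms by auto
  then have "epath v k t \<in> S2" using epath_in[of v k t] edge(2)[of v k] assms by auto
  moreover have "v \<noteq> k" using assms by simp
  then have "epath v k t \<notin> E v i" "epath v k t \<notin> E i j" "epath v k t \<notin> E v j"
    by (rule germ_notin_edge[OF assms(1,2) _ assms(6,7)]; use assms in simp)+
  ultimately show ?thesis using tri_eq[of v i j] assms by auto
qed

lemma germ_in:
  assumes "v < n" "k < n" "i < n" "j < n" "distinct [v, k, i, j]"
  shows "germ v k \<in> S2 - tri v i j"
  using germ_notin_tri[OF assms, of "rad v k"] rad[of v k] assms unfolding germ_def by auto

lemma arc_part_same_side:
  assumes "u < n" "w < n" "u \<noteq> w" "0 \<le> t" "t \<le> t'" "t' \<le> 1" "\<And>r. t \<le> r \<Longrightarrow> r \<le> t' \<Longrightarrow> epath u w r \<notin> J"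
  shows "same_side J (epath u w t) (epath u w t')"
proof (rule connected_componentI)
  show "connected (epath u w ` {t..t'})"
    using epath_simps(5)[OF assms(1-3)] assms by (intro connected_continuous_image) (auto intro: continuous_on_subset)
  have "epath u w ` {t..t'} \<subseteq> E u w" using epath_in[OF assms(1-3)] assms by auto
  then show "epath u w ` {t..t'} \<subseteq> S2 - J" using edge(2)[OF assms(1-3)] assms(7) by fastforce
qed (use assms in auto)

lemma arc_part_same_side':
  assumes "u < n" "w < n" "u \<noteq> w" "0 \<le> l" "h \<le> 1" "\<And>r. l < r \<Longrightarrow> r < h \<Longrightarrow> epath u w r \<notin> J"
    "l < t" "t < h" "l < t'" "t' < h"
  shows "same_side J (epath u w t) (epath u w t')"
proof (cases "t \<le> t'")
  case True
  then show ?thesis using assms by (intro arc_part_same_side) auto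
next
  case False
  then have "same_side J (epath u w t') (epath u w t)" using assms by (intro arc_part_same_side) auto
  then show ?thesis by (rule side_sym)
qed

lemma edge_side_uncrossed:
  assumes "x < n" "y < n" "p < n" "q < n" "distinct [x, y, p, q]" "\<not> X x y p q"
  shows "z \<in> E x y \<Longrightarrow> z \<noteq> pt x \<Longrightarrow> same_side (tri x p q) (germ x y) z"
    and "same_side (tri x p q) (germ x y) (pt y)"
proof -
  have d: "x \<noteq> y" using assms by auto
  have "E x y \<inter> E x p = {pt x}" "E x y \<inter> E x q = {pt x}" "E x y \<inter> E p q = {}"
    using edge_adjacent assms by (auto simp: X_def)
  then have sub: "E x y \<inter> tri x p q \<subseteq> {pt x}"
    using tri_eq[of x p q] assms by auto
  have av: "epath x y t \<notin> tri x p q" if "0 < t" "t \<le> 1" for t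
    using sub epath_in[OF assms(1,2) d, of t] epath_eq_iff[OF assms(1,2) d, of t 0] epath_simps(2)[OF assms(1,2) d] that by force
  have r: "0 < rad x y" "rad x y < 1" using rad assms d by auto
  have *: "same_side (tri x p q) (germ x y) (epath x y t)" if t: "0 < t" "t \<le> 1" for t
  proof (cases "t \<le> rad x y")
    case True
    then have "same_side (tri x p q) (epath x y t) (germ x y)"
      unfolding germ_def using r t av by (intro arc_part_same_side assms d) auto
    then show ?thesis by (rule side_sym)
  next
    case False
    then show ?thesis
      unfolding germ_def using r t av by (intro arc_part_same_side assms d) auto
  qed
  show "same_side (tri x p q) (germ x y) z" if z: "z \<in> E x y" "z \<noteq> pt x" for z
  proof -
    obtain t where "z = epath x y t" "0 \<le> t" "t \<le> 1" using z epath_simps(1)[OF assms(1,2) d] by auto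
    moreover have "t \<noteq> 0" using calculation z epath_simps(2)[OF assms(1,2) d] by auto
    ultimately show ?thesis using *[of t] by auto
  qed
  show "same_side (tri x p q) (germ x y) (pt y)"
    using *[of 1] epath_simps(3)[OF assms(1,2) d] by simp
qed

lemma edge_switches:
  assumes "x < n" "y < n" "p < n" "q < n" "r < n" "distinct [x, y, p, q]" "distinct [p, q, r]"
    and s: "0 < s" "s < 1" "epath x y s \<in> E p q"
    and only: "\<And>t. 0 < t \<Longrightarrow> t < 1 \<Longrightarrow> epath x y t \<in> tri p q r \<Longrightarrow> t = s"
    and t: "0 < t1" "t1 < s" "s < t2" "t2 < 1"
  shows "\<not> same_side (tri p q r) (epath x y t1) (epath x y t2)"
proof (rule crossing_switches_sides)
  have d: "x \<noteq> y" "p \<noteq> q" "q \<noteq> r" "p \<noteq> r" using assms by auto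
  note T = tri_eq[OF assms(3,4,5,7)]
  show "jordan (tri p q r)" using tri_jordan assms by auto
  show "E p q \<subseteq> tri p q r" "tri p q r \<subseteq> E p q \<union> (E q r \<union> E p r)" using T by auto
  show "closed (E q r \<union> E p r)" using epath_simps(6) assms d by (intro closed_Un) auto
  have zE: "epath x y s \<in> E x y" using epath_in[OF assms(1,2) d(1)] s by auto
  have np: "epath x y s \<noteq> pt k" if "k < n" for k
    using edge_disjoint(3)[OF assms(1-4,6) zE s(3)] that by auto
  have "E p q \<inter> E q r = {pt q}" "E p q \<inter> E p r = {pt p}"
    using edge_adjacent[of q p r] edge_adjacent[of p q r] assms d by (auto simp: insert_commute)
  then show "epath x y s \<notin> E q r \<union> E p r" using np assms s(3) by blast
  show "crosses_at (E p q) (path_image (epath x y)) (epath x y s)"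
    unfolding epath(2)[OF assms(1,2) d(1)]
    by (rule edge_disjoint(1)[OF assms(3,4,1,2) _ s(3) zE]) (use assms in auto)
  show "arc (epath x y)" "path_image (epath x y) \<subseteq> S2"
    unfolding epath(2)[OF assms(1,2) d(1)] by (rule epath(1) edge(2); fact assms d)+
qed (use s only t in auto)

text \<open>In a good drawing \<open>xy\<close> meets \<open>xp\<close> and \<open>xq\<close> only
  in \<open>x\<close>, and \<open>pq\<close> only once. Hence the triangle is met just once beyond
  \<open>x\<close>, and transversally. The range after \<open>s\<close> includes
  \<open>t = 1\<close>, so the end vertex \<open>y\<close> is covered.\<close>

lemma edge_side_crossed:
  assumes "x < n" "y < n" "p < n" "q < n" "distinct [x, y, p, q]" "X x y p q"
  obtains s where "0 < s" "s < 1" "rad x y < s" "epath x y s \<in> E p q"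
    "\<And>t. 0 < t \<Longrightarrow> t < s \<Longrightarrow> same_side (tri x p q) (germ x y) (epath x y t)"
    "\<And>t. s < t \<Longrightarrow> t \<le> 1 \<Longrightarrow> epath x y t \<in> S2 - tri x p q \<and> \<not> same_side (tri x p q) (germ x y) (epath x y t)"
proof -
  have d: "x \<noteq> y" using assms by auto
  note g = epath_simps[OF assms(1,2) d]
  obtain z where z: "z \<in> E x y" "z \<in> E p q" using assms(6) by (auto simp: X_def)
  then obtain s where s: "z = epath x y s" "0 \<le> s" "s \<le> 1" using g(1) by auto
  have "z \<noteq> pt x" "z \<noteq> pt y" using edge_disjoint(3)[OF assms(1-5) z] assms by auto
  then have "s \<noteq> 0" "s \<noteq> 1" using s g by auto
  then have s01: "0 < s" "s < 1" using s by auto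
  have adj: "E x y \<inter> E x p = {pt x}" "E x y \<inter> E x q = {pt x}"
    using edge_adjacent assms by auto
  have av: "t = s" if t: "0 < t" "t \<le> 1" "epath x y t \<in> tri x p q" for t
  proof -
    have "epath x y t \<noteq> pt x" using epath_eq_iff[OF assms(1,2) d, of t 0] g t by simp
    moreover have "epath x y t \<in> E x y" using epath_in[OF assms(1,2) d] t by simp
    ultimately have "epath x y t \<in> E p q" using t(3) tri_eq[of x p q] adj assms by auto
    then have "epath x y t = epath x y s"
      using edge_disjoint(2)[OF assms(1-5) z] s(1) \<open>epath x y t \<in> E x y\<close> by auto
    then show ?thesis using epath_eq_iff[OF assms(1,2) d] t s by auto
  qed
  have r: "0 < rad x y" "rad x y < 1" using rad assms d by auto
  have rs: "rad x y < s"
  proof (rule ccontr)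
    assume "\<not> rad x y < s"
    then have "epath x y s \<notin> E p q" using rad(3)[OF assms(1,2) d, of s p q] s01 assms by auto
    then show False using z s by simp
  qed
  have avs: "epath x y r \<notin> tri x p q" if "0 < r" "r < s" for r
    using av[of r] that s01 by auto
  have before: "same_side (tri x p q) (germ x y) (epath x y t)" if "0 < t" "t < s" for t
    unfolding germ_def
    by (rule arc_part_same_side'[OF assms(1,2) d _ _ avs]) (use s01 that r rs in simp_all)
  have sw: "\<not> same_side (tri x p q) (germ x y) (epath x y t)" if "s < t" "t < 1" for t
  proof -
    have "\<not> same_side (tri p q x) (epath x y (rad x y)) (epath x y t)"
      by (rule edge_switches[OF assms(1-4) assms(1) assms(5), of s])
         (use assms z s s01 r rs that in \<open>simp_all add: insert_commute[of q x] insert_commute[of p x] av\<close>)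
    then show ?thesis by (simp add: germ_def insert_commute)
  qed
  have inS: "epath x y t \<in> S2 - tri x p q" if "s < t" "t \<le> 1" for t
    using av[of t] that s01 epath_in[OF assms(1,2) d, of t] edge(2)[OF assms(1,2) d] by auto
  have after: "\<not> same_side (tri x p q) (germ x y) (epath x y t)" if t: "s < t" "t \<le> 1" for t
  proof
    assume *: "same_side (tri x p q) (germ x y) (epath x y t)"
    define u where "u = (s + t) / 2"
    have u: "s < u" "u < t" "u < 1" using t by (auto simp: u_def)
    have "same_side (tri x p q) (epath x y u) (epath x y t)"
      by (rule arc_part_same_side) (use assms d s01 t u inS in auto)
    then have "same_side (tri x p q) (epath x y t) (epath x y u)" by (rule side_sym)
    then show False using sw[of u] * u side_trans[OF *] by blast
  qed
  show thesis
    using that[of s] s01 rs z s before after inS by auto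
qed

section \<open>Convex sides of triangles\<close>

text \<open>Convexity of the closed disc formed by the triangle \<open>abc\<close> and its side at
  \<open>z\<close>. A vertex belongs to that disc if it is a corner or lies on the side of
  \<open>z\<close>.\<close>

definition convex_side :: "nat \<Rightarrow> nat \<Rightarrow> nat \<Rightarrow> real^3 \<Rightarrow> bool" where
  "convex_side a b c z \<longleftrightarrow> (\<forall>u<n. \<forall>w<n. u \<noteq> w \<longrightarrow>
     (u \<in> {a, b, c} \<or> same_side (tri a b c) z (pt u)) \<longrightarrow>
     (w \<in> {a, b, c} \<or> same_side (tri a b c) z (pt w)) \<longrightarrow>
     E u w \<subseteq> tri a b c \<union> {y. same_side (tri a b c) z y})"

text \<open>The convex disc granted by the drawing is the closure of a side, and there are only two
  sides.\<close>

lemma convex_side_cases: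
  assumes "a < n" "b < n" "c < n" "distinct [a, b, c]"
    and z: "z \<in> S2 - tri a b c" "z' \<in> S2 - tri a b c" "\<not> same_side (tri a b c) z z'"
  shows "convex_side a b c z \<or> convex_side a b c z'"
proof -
  have "{a, b, c} \<in> nsets {..<n} 3" using assms by (auto simp: nsets_def)
  then obtain \<Delta> where \<Delta>: "closed_disc_bounded_by \<Delta> (tri a b c)" "convex_disc n D \<Delta>"
    using convex unfolding convex_drawing_def by blast
  note J = tri_jordan[OF assms(1-4)]
  obtain x where x: "x \<in> S2 - tri a b c" "\<Delta> = tri a b c \<union> {y. same_side (tri a b c) x y}"
    using closed_disc_is_side[OF J \<Delta>(1)] .
  have *: "convex_side a b c y" if y: "same_side (tri a b c) x y" for y
  proof -
    have eq: "{u. same_side (tri a b c) x u} = {u. same_side (tri a b c) y u}"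
      using connected_component_eq y by (metis mem_Collect_eq)
    have "pt u \<in> \<Delta>" if "u < n" "u \<in> {a, b, c} \<or> same_side (tri a b c) y (pt u)" for u
    proof (cases "u \<in> {a, b, c}")
      case True
      then have "pt u \<in> tri a b c" unfolding subdrawing_def by blast
      then show ?thesis using x by blast
    next
      case False
      then show ?thesis using that x eq by blast
    qed
    then show ?thesis using \<Delta>(2) unfolding convex_side_def convex_disc_def x(2) eq by blast
  qed
  show ?thesis
  proof (cases "same_side (tri a b c) x z")
    case False
    then have "\<not> same_side (tri a b c) z x" using side_sym by blast
    then show ?thesis
      using same_side_trichotomy[OF J x(1) z(1,2) False z(3)] * by blast
  qed (use * in blast)
qed

text \<open>The edge \<open>vk\<close> itself refutes convexity of the far side: both of its ends
  are in that closed disc, but the edge starts outside it. One of the two sides is convex, so it is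
  the one where \<open>vk\<close> starts. All later uses of convexity pass through this
  lemma.\<close>

lemma convex_side_germ:
  assumes "v < n" "k < n" "i < n" "j < n" "distinct [v, k, i, j]" "X v k i j"
  shows "convex_side v i j (germ v k)" and "\<not> same_side (tri v i j) (germ v k) (pt k)"
proof -
  obtain s where s: "0 < s" "s < 1"
    "\<And>t. s < t \<Longrightarrow> t \<le> 1 \<Longrightarrow> epath v k t \<in> S2 - tri v i j \<and> \<not> same_side (tri v i j) (germ v k) (epath v k t)"
    by (rule edge_side_crossed[OF assms]) blast
  have d: "v \<noteq> k" using assms by auto
  show ns: "\<not> same_side (tri v i j) (germ v k) (pt k)"
    using s(3)[of 1] s(2) epath_simps(3)[of v k] assms d by auto
  have k: "pt k \<in> S2 - tri v i j" by (rule pt_notin_tri) (use assms in auto)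
  have g: "germ v k \<in> S2 - tri v i j" by (rule germ_in) (use assms in auto)
  have "\<not> convex_side v i j (pt k)"
  proof
    assume "convex_side v i j (pt k)"
    moreover have "same_side (tri v i j) (pt k) (pt k)" using k connected_component_refl_eq by blast
    ultimately have "E v k \<subseteq> tri v i j \<union> {y. same_side (tri v i j) (pt k) y}"
      unfolding convex_side_def using assms d by blast
    moreover have "germ v k \<in> E v k" using epath_in[of v k] rad[of v k] assms d by (simp add: germ_def)
    ultimately have "same_side (tri v i j) (pt k) (germ v k)" using g by blast
    then show False using ns side_sym by blast
  qed
  then show "convex_side v i j (germ v k)"
    using convex_side_cases[of v i j "germ v k" "pt k"] assms g k ns by auto
qed

section \<open>The rotation at a vertex\<close>

text \<open>Germs need not lie in the neighbourhood in which the two curves agree. Each is slid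
  along its spoke towards \<open>v\<close> into that neighbourhood; by \<open>avoid\<close> this
  meets neither curve.\<close>

lemma same_side_germs_local:
  assumes c: "simple_path (A +++ \<beta>)" "simple_path (A +++ \<beta>')"
    and ends: "pathfinish A = pathstart \<beta>" "pathfinish \<beta> = pathstart A"
      "pathfinish A = pathstart \<beta>'" "pathfinish \<beta>' = pathstart A"
    and S: "path_image A \<subseteq> S2" "path_image \<beta> \<subseteq> S2" "path_image \<beta>' \<subseteq> S2"
    and v: "pt v \<in> path_image A" "pt v \<notin> path_image \<beta>" "pt v \<notin> path_image \<beta>'"
    and vdf: "v < n" "d < n" "f < n" "v \<noteq> d" "v \<noteq> f"
    and avoid: "\<And>k t. k = d \<or> k = f \<Longrightarrow> 0 < t \<Longrightarrow> t \<le> rad v k \<Longrightarrow>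
      epath v k t \<notin> path_image A \<union> path_image \<beta> \<union> path_image \<beta>'"
  shows "same_side (path_image A \<union> path_image \<beta>) (germ v d) (germ v f) \<longleftrightarrow>
    same_side (path_image A \<union> path_image \<beta>') (germ v d) (germ v f)"
proof -
  obtain W where W: "open W" "pt v \<in> W"
    "\<And>q q'. q \<in> W \<inter> S2 - path_image A \<Longrightarrow> q' \<in> W \<inter> S2 - path_image A \<Longrightarrow>
      same_side (path_image A \<union> path_image \<beta>) q q' \<longleftrightarrow> same_side (path_image A \<union> path_image \<beta>') q q'"
    using same_side_local[OF c ends S v] by blast
  have near: "\<exists>q. q \<in> W \<inter> S2 - path_image A \<and> same_side (path_image A \<union> path_image \<beta>) (germ v k) q \<and>
      same_side (path_image A \<union> path_image \<beta>') (germ v k) q" if k: "k = d \<or> k = f" for k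
  proof -
    have kn: "k < n" "v \<noteq> k" using k vdf by auto
    obtain e where e: "e > 0" "ball (pt v) e \<subseteq> W" using W open_contains_ball by metis
    obtain \<delta> where \<delta>: "\<delta> > 0" "\<And>t. t \<in> {0..1} \<Longrightarrow> dist t 0 < \<delta> \<Longrightarrow> dist (epath v k t) (epath v k 0) < e"
      using epath_simps(5)[OF vdf(1) kn] e(1) unfolding continuous_on_iff
      by (metis atLeastAtMost_iff order_refl zero_le_one)
    note r = rad(1,2)[OF vdf(1) kn]
    define t where "t = min (\<delta> / 2) (rad v k)"
    have t: "0 < t" "t \<le> rad v k" "t \<le> 1" "t < \<delta>" using \<delta>(1) r by (auto simp: t_def)
    have "epath v k t \<in> ball (pt v) e"
      using \<delta>(2)[of t] t epath_simps(2)[OF vdf(1) kn] by (simp add: dist_commute)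
    moreover have "epath v k t \<in> S2" using epath_in[OF vdf(1) kn, of t] edge(2)[OF vdf(1) kn] t by auto
    ultimately have "epath v k t \<in> W \<inter> S2 - path_image A" using e(2) avoid[OF k t(1,2)] by blast
    moreover have "same_side J (germ v k) (epath v k t)"
      if "J = path_image A \<union> path_image \<beta> \<or> J = path_image A \<union> path_image \<beta>'" for J
    proof -
      have "same_side J (epath v k t) (epath v k (rad v k))"
      proof (rule arc_part_same_side[OF vdf(1) kn])
        show "epath v k u \<notin> J" if "t \<le> u" "u \<le> rad v k" for u
          using avoid[OF k, of u] that t(1) \<open>J = _ \<or> J = _\<close> by auto
      qed (use t r in auto)
      then show ?thesis unfolding germ_def by (rule side_sym)
    qed
    ultimately show ?thesis by blast
  qed
  obtain q where q: "q \<in> W \<inter> S2 - path_image A" "same_side (path_image A \<union> path_image \<beta>) (germ v d) q"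
    "same_side (path_image A \<union> path_image \<beta>') (germ v d) q" using near by blast
  obtain q' where q': "q' \<in> W \<inter> S2 - path_image A" "same_side (path_image A \<union> path_image \<beta>) (germ v f) q'"
    "same_side (path_image A \<union> path_image \<beta>') (germ v f) q'" using near by blast
  have *: "same_side J (germ v d) (germ v f) \<longleftrightarrow> same_side J q q'"
    if "same_side J (germ v d) q" "same_side J (germ v f) q'" for J
  proof
    assume "same_side J (germ v d) (germ v f)"
    then show "same_side J q q'"
      using side_trans[OF side_trans[OF side_sym[OF that(1)]] that(2)]
      by blast
  next
    assume "same_side J q q'"
    then show "same_side J (germ v d) (germ v f)"
      using side_trans[OF side_trans[OF that(1)] side_sym[OF that(2)]]
      by blast
  qed
  show ?thesis using *[OF q(2) q'(2)] *[OF q(3) q'(3)] W(3)[OF q(1) q'(1)] by blast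
qed

text \<open>If the edges \<open>vc\<close> and \<open>ab\<close> cross at \<open>z\<close>, the three spokes \<open>va\<close>, \<open>vb\<close>, \<open>vc\<close> are completed to a
  theta curve with branch points \<open>v\<close> and \<open>z\<close>.\<close>

lemma crossing_theta:
  assumes vn: "v < n" "a < n" "b < n" "c < n" and dist: "distinct [v, a, b, c]" and X: "X v c a b"
  obtains z s A1 A2 where "0 < s" "s < 1" "rad v c < s" "z = epath v c s" "z \<in> E a b" "\<forall>k<n. z \<noteq> pt k"
    "A1 \<union> A2 = E a b" "pt b \<notin> A1" "pt a \<notin> A2"
    "\<forall>y w1 w2 w3. y \<in> S2 - (E v a \<union> E v b \<union> E a b \<union> epath v c ` {0..s}) \<longrightarrow>
      w1 \<in> E v a \<union> A1 - {pt v, z} \<longrightarrow> w2 \<in> E v b \<union> A2 - {pt v, z} \<longrightarrow> w3 \<in> epath v c ` {0..s} - {pt v, z} \<longrightarrow>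
      exactly_one (\<not> same_side (E v b \<union> A2 \<union> epath v c ` {0..s}) y w1)
        (\<not> same_side (E v a \<union> A1 \<union> epath v c ` {0..s}) y w2) (\<not> same_side (tri v a b) y w3)"
    "\<forall>d f. d < n \<longrightarrow> f < n \<longrightarrow> d \<notin> {v, a, c} \<longrightarrow> f \<notin> {v, a, c} \<longrightarrow>
      same_side (E v a \<union> A1 \<union> epath v c ` {0..s}) (germ v d) (germ v f) = same_side (tri v a c) (germ v d) (germ v f)"
    "\<forall>d f. d < n \<longrightarrow> f < n \<longrightarrow> d \<notin> {v, b, c} \<longrightarrow> f \<notin> {v, b, c} \<longrightarrow>
      same_side (E v b \<union> A2 \<union> epath v c ` {0..s}) (germ v d) (germ v f) = same_side (tri v b c) (germ v d) (germ v f)"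
proof -
  have d: "v \<noteq> a" "v \<noteq> b" "v \<noteq> c" "a \<noteq> b" "a \<noteq> c" "b \<noteq> c" using dist by auto
  have dvc: "distinct [v, c, a, b]" using dist by auto
  obtain s where s: "0 < s" "s < 1" "rad v c < s" "epath v c s \<in> E a b"
    by (rule edge_side_crossed[OF vn(1,4,2,3) dvc X]) blast
  define z where "z = epath v c s"
  have zab: "z \<in> E a b" using s z_def by simp
  have zvc: "z \<in> E v c" using epath_in[OF vn(1,4) d(3), of s] s z_def by simp
  have znp: "z \<noteq> pt k" if "k < n" for k
    using edge_disjoint(3)[OF vn(1,4,2,3) dvc zvc zab that] .
  have uniq: "E v c \<inter> E a b = {z}"
    using edge_disjoint(2)[OF vn(1,4,2,3) dvc zvc zab] zvc zab by blast
  obtain \<sigma> where "z = epath a b \<sigma>" "\<sigma> \<in> {0..1}" using zab unfolding epath_simps(1)[OF vn(2,3) d(4)] by blast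
  then have \<sigma>: "z = epath a b \<sigma>" "0 \<le> \<sigma>" "\<sigma> \<le> 1" by auto
  have "\<sigma> \<noteq> 0" "\<sigma> \<noteq> 1" using \<sigma>(1) znp[OF vn(2)] znp[OF vn(3)] epath_simps(2,3)[OF vn(2,3) d(4)] by auto
  then have \<sigma>01: "0 < \<sigma>" "\<sigma> < 1" using \<sigma> by auto
  note sp = arc_split[OF epath(1)[OF vn(2,3) d(4)] \<sigma>01]
  note sq = arc_split[OF epath(1)[OF vn(1,4) d(3)] s(1,2)]
  define \<alpha>1 where "\<alpha>1 = subpath 0 \<sigma> (epath a b)"
  define \<alpha>2 where "\<alpha>2 = reversepath (subpath \<sigma> 1 (epath a b))"
  define \<gamma> where "\<gamma> = subpath 0 s (epath v c)"
  define \<delta> where "\<delta> = subpath s 1 (epath v c)"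
  define A1 where "A1 = epath a b ` {0..\<sigma>}"
  define A2 where "A2 = epath a b ` {\<sigma>..1}"
  define C where "C = epath v c ` {0..s}"
  define C' where "C' = epath v c ` {s..1}"
  have gab: "epath a b 0 = pt a" "epath a b 1 = pt b" and gvc: "epath v c 0 = pt v" "epath v c 1 = pt c"
    using epath_simps vn d by auto
  have \<alpha>1: "arc \<alpha>1" "pathstart \<alpha>1 = pt a" "pathfinish \<alpha>1 = z" "path_image \<alpha>1 = A1"
    using sp gab \<sigma> by (auto simp: \<alpha>1_def A1_def)
  have \<alpha>2: "arc \<alpha>2" "pathstart \<alpha>2 = pt b" "pathfinish \<alpha>2 = z" "path_image \<alpha>2 = A2"
    using sp gab \<sigma> by (auto simp: \<alpha>2_def A2_def arc_reversepath)
  have \<gamma>: "arc \<gamma>" "pathstart \<gamma> = pt v" "pathfinish \<gamma> = z" "path_image \<gamma> = C"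
    using sq gvc z_def by (auto simp: \<gamma>_def C_def)
  have \<delta>: "arc \<delta>" "pathstart \<delta> = z" "pathfinish \<delta> = pt c" "path_image \<delta> = C'"
    using sq gvc z_def by (auto simp: \<delta>_def C'_def)
  have A12: "A1 \<union> A2 = E a b" "A1 \<inter> A2 = {z}"
    using sp(5,6) epath(2)[OF vn(2,3) d(4)] \<sigma> by (auto simp: A1_def A2_def)
  have CC: "C \<union> C' = E v c" "C \<inter> C' = {z}"
    using sq(5,6) epath(2)[OF vn(1,4) d(3)] z_def by (auto simp: C_def C'_def)
  have inA: "pt a \<in> A1" "pt b \<in> A2" "z \<in> A1" "z \<in> A2" "pt v \<in> C" "z \<in> C" "pt c \<in> C'" "z \<in> C'"
    using \<alpha>1 \<alpha>2 \<gamma> \<delta> by (metis pathstart_in_path_image pathfinish_in_path_image)+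
  have notA: "pt b \<notin> A1" "pt a \<notin> A2" "pt c \<notin> C" "pt v \<notin> C'"
    using A12(2) CC(2) inA znp[OF vn(1)] znp[OF vn(2)] znp[OF vn(3)] znp[OF vn(4)] by auto
  have A1': "A1 \<subseteq> E a b" and A2': "A2 \<subseteq> E a b" and C': "C \<subseteq> E v c" "C' \<subseteq> E v c" using A12 CC by auto
  have adj: "E v a \<inter> E v b = {pt v}" "E v a \<inter> E v c = {pt v}" "E v b \<inter> E v c = {pt v}"
    "E v a \<inter> E a b = {pt a}" "E v b \<inter> E a b = {pt b}" "E v c \<inter> E c a = {pt c}" "E v c \<inter> E c b = {pt c}"
    "E v a \<inter> E c a = {pt a}" "E v b \<inter> E c b = {pt b}"
    using edge_adjacent[of v a b] edge_adjacent[of v a c] edge_adjacent[of v b c] edge_adjacent[of a v b]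
      edge_adjacent[of b v a] edge_adjacent[of c v a] edge_adjacent[of c v b] edge_adjacent[of a v c]
      edge_adjacent[of b v c] vn d by (simp_all add: insert_commute)
  have Eab: "pt v \<notin> E a b" "pt v \<notin> E c a" "pt v \<notin> E c b" using edge(3) vn d by auto
  have Epts: "pt v \<in> E v a" "pt a \<in> E v a" "pt v \<in> E v b" "pt b \<in> E v b" using edge(3) vn d by auto
  have i: "E v a \<inter> A1 = {pt a}" "E v b \<inter> A2 = {pt b}" "E v a \<inter> A2 = {}" "E v b \<inter> A1 = {}"
    "E v a \<inter> C = {pt v}" "E v b \<inter> C = {pt v}" "C \<inter> A1 = {z}" "C \<inter> A2 = {z}"
  proof -
    note I = Int_eq_singleton_mono
    show "E v a \<inter> A1 = {pt a}" by (rule I(1)[OF adj(4) A1' inA(1)])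
    show "E v a \<inter> A2 = {}" by (rule I(2)[OF adj(4) A2' notA(2)])
    show "E v b \<inter> A2 = {pt b}" by (rule I(1)[OF adj(5) A2' inA(2)])
    show "E v b \<inter> A1 = {}" by (rule I(2)[OF adj(5) A1' notA(1)])
    show "E v a \<inter> C = {pt v}" by (rule I(1)[OF adj(2) C'(1) inA(5)])
    show "E v b \<inter> C = {pt v}" by (rule I(1)[OF adj(3) C'(1) inA(5)])
    show "C \<inter> A1 = {z}" "C \<inter> A2 = {z}" using uniq C'(1) A1' A2' inA(3,4,6) by blast+
  qed
  have subS: "E v a \<subseteq> S2" "E v b \<subseteq> S2" "E v c \<subseteq> S2" "E a b \<subseteq> S2" "E c a \<subseteq> S2" "E c b \<subseteq> S2"
    using edge(2) vn d by simp_all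
  define c1 where "c1 = epath v a +++ \<alpha>1"
  define c2 where "c2 = epath v b +++ \<alpha>2"
  note gva = epath[OF vn(1,2) d(1)] and gvb = epath[OF vn(1,3) d(2)]
  have gca: "arc (epath c a)" "path_image (epath c a) = E c a" "pathstart (epath c a) = pt c" "pathfinish (epath c a) = pt a"
    and gcb: "arc (epath c b)" "path_image (epath c b) = E c b" "pathstart (epath c b) = pt c" "pathfinish (epath c b) = pt b"
    using epath[of c a] epath[of c b] vn d by auto
  have c1: "arc c1" "pathstart c1 = pt v" "pathfinish c1 = z" "path_image c1 = E v a \<union> A1"
    unfolding c1_def using gva \<alpha>1 i by (auto intro!: arc_join simp: path_image_join)
  have c2: "arc c2" "pathstart c2 = pt v" "pathfinish c2 = z" "path_image c2 = E v b \<union> A2"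
    unfolding c2_def using gvb \<alpha>2 i by (auto intro!: arc_join simp: path_image_join)
  have int: "path_image c1 \<inter> path_image c2 = {pt v, z}" "path_image c1 \<inter> path_image \<gamma> = {pt v, z}"
    "path_image c2 \<inter> path_image \<gamma> = {pt v, z}"
  proof -
    have i': "A1 \<inter> E v b = {}" "A1 \<inter> C = {z}" "A2 \<inter> C = {z}"
      using i(4,7,8) by (simp_all only: Int_commute)
    show "path_image c1 \<inter> path_image c2 = {pt v, z}" "path_image c1 \<inter> path_image \<gamma> = {pt v, z}"
      "path_image c2 \<inter> path_image \<gamma> = {pt v, z}"
      unfolding c1(4) c2(4) \<gamma>(4) Int_Un_distrib Int_Un_distrib2 i i' adj(1) A12(2) by (simp_all add: insert_commute)
  qed
  have sub: "path_image c1 \<subseteq> S2" "path_image c2 \<subseteq> S2" "path_image \<gamma> \<subseteq> S2"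
    unfolding c1(4) c2(4) \<gamma>(4) using subS A1' A2' C' by blast+
  have J12: "path_image c1 \<union> path_image c2 = tri v a b"
    unfolding c1(4) c2(4) using tri_eq[of v a b] vn d A12(1) by auto
  have theta: "exactly_one (\<not> same_side (E v b \<union> A2 \<union> C) y w1) (\<not> same_side (E v a \<union> A1 \<union> C) y w2)
      (\<not> same_side (tri v a b) y w3)"
    if y: "y \<in> S2 - (E v a \<union> E v b \<union> E a b \<union> C)" and
      w: "w1 \<in> E v a \<union> A1 - {pt v, z}" "w2 \<in> E v b \<union> A2 - {pt v, z}" "w3 \<in> C - {pt v, z}" for y w1 w2 w3
  proof -
    have y': "y \<in> S2" "y \<notin> path_image c1" "y \<notin> path_image c2" "y \<notin> path_image \<gamma>"
      unfolding c1(4) c2(4) \<gamma>(4) using y A1' A2' by blast+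
    note th = theta_faces[OF c1(1) c2(1) \<gamma>(1) c1(2,3) c2(2,3) \<gamma>(2,3) int sub y'
        w[folded c1(4) c2(4) \<gamma>(4)], unfolded J12, unfolded c1(4) c2(4) \<gamma>(4)]
    show ?thesis using th unfolding exactly_one_def by blast
  qed
  \<comment> \<open>The cycle made of \<open>vx\<close>, a part of \<open>ab\<close> and a part of
    \<open>vc\<close> is not a triangle. It shares with the triangle \<open>vxc\<close> the arc from
    \<open>x\<close> over \<open>v\<close> to the crossing point, so both sort the germs at
    \<open>v\<close> alike.\<close>
  have local: "same_side (E v x \<union> Ax \<union> C) (germ v d) (germ v f) \<longleftrightarrow> same_side (tri v x c) (germ v d) (germ v f)"
    if x: "x = a \<and> \<alpha>x = \<alpha>1 \<and> Ax = A1 \<or> x = b \<and> \<alpha>x = \<alpha>2 \<and> Ax = A2"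
      and df: "d < n" "f < n" "d \<notin> {v, x, c}" "f \<notin> {v, x, c}" for x \<alpha>x Ax d f
  proof -
    have xn: "x < n" "x \<noteq> v" "x \<noteq> c" using x vn d by auto
    have \<alpha>x: "arc \<alpha>x" "pathstart \<alpha>x = pt x" "pathfinish \<alpha>x = z" "path_image \<alpha>x = Ax" using x \<alpha>1 \<alpha>2 by auto
    have gvx: "arc (epath v x)" "path_image (epath v x) = E v x" "pathstart (epath v x) = pt v" "pathfinish (epath v x) = pt x"
      and gcx: "arc (epath c x)" "path_image (epath c x) = E c x" "pathstart (epath c x) = pt c" "pathfinish (epath c x) = pt x"
      using epath[of v x] epath[of c x] vn xn by auto
    have ix: "E v x \<inter> C = {pt v}" "E v x \<inter> Ax = {pt x}" "C \<inter> Ax = {z}" "E v c \<inter> E c x = {pt c}"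
      "E v x \<inter> E c x = {pt x}" "E v x \<inter> E v c = {pt v}" "pt v \<notin> Ax" "pt v \<notin> E c x" "Ax \<subseteq> E a b" "E c x \<subseteq> S2" "E v x \<subseteq> S2"
      using x i adj Eab A1' A2' subS by auto
    define A where "A = reversepath (epath v x) +++ \<gamma>"
    define \<beta> where "\<beta> = \<delta> +++ epath c x"
    define \<beta>' where "\<beta>' = reversepath \<alpha>x"
    have A: "arc A" "pathstart A = pt x" "pathfinish A = z" "path_image A = E v x \<union> C"
      unfolding A_def using gvx \<gamma> ix by (auto intro!: arc_join arc_reversepath simp: path_image_join)
    have i\<delta>: "C' \<inter> E c x \<subseteq> {pt c}" using ix(4) C' by blast
    have \<beta>: "arc \<beta>" "pathstart \<beta> = z" "pathfinish \<beta> = pt x" "path_image \<beta> = C' \<union> E c x"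
      unfolding \<beta>_def using gcx \<delta> i\<delta> by (auto intro!: arc_join simp: path_image_join)
    have \<beta>': "arc \<beta>'" "pathstart \<beta>' = z" "pathfinish \<beta>' = pt x" "path_image \<beta>' = Ax"
      unfolding \<beta>'_def using \<alpha>x by (auto intro!: arc_reversepath)
    have "E v x \<inter> C' = {}" by (rule Int_eq_singleton_mono(2)[OF ix(6) C'(2) notA(4)])
    moreover have "E c x \<inter> C = {}"
      using Int_eq_singleton_mono(2)[OF _ C'(1) notA(3), of "E c x"] ix(4) by (simp add: Int_commute)
    then have "C \<inter> E c x = {}" by (simp add: Int_commute)
    ultimately have "path_image A \<inter> path_image \<beta> \<subseteq> {pt x, z}" "path_image A \<inter> path_image \<beta>' \<subseteq> {pt x, z}"
      unfolding A(4) \<beta>(4) \<beta>'(4) Int_Un_distrib Int_Un_distrib2 using ix(2,3,5) CC(2) by simp_all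
    then have simple: "simple_path (A +++ \<beta>)" "simple_path (A +++ \<beta>')"
      by (intro simple_path_join_loop A(1) \<beta>(1) \<beta>'(1); simp add: A \<beta> \<beta>')+
    have im: "path_image A \<union> path_image \<beta> = tri v x c" "path_image A \<union> path_image \<beta>' = E v x \<union> Ax \<union> C"
    proof -
      have "tri v x c = E v x \<union> E x c \<union> E v c" by (rule tri_eq) (use vn xn d in auto)
      then show "path_image A \<union> path_image \<beta> = tri v x c"
        unfolding A(4) \<beta>(4) CC(1)[symmetric] insert_commute[of x c] by blast
      show "path_image A \<union> path_image \<beta>' = E v x \<union> Ax \<union> C" unfolding A(4) \<beta>'(4) by blast
    qed
    have "same_side (path_image A \<union> path_image \<beta>) (germ v d) (germ v f) \<longleftrightarrow>
      same_side (path_image A \<union> path_image \<beta>') (germ v d) (germ v f)"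
    proof (rule same_side_germs_local[OF simple])
      show "path_image A \<subseteq> S2" "path_image \<beta> \<subseteq> S2" "path_image \<beta>' \<subseteq> S2"
        unfolding A(4) \<beta>(4) \<beta>'(4)
        using ix(10,11) order_trans[OF C'(1) subS(3)] order_trans[OF C'(2) subS(3)] order_trans[OF ix(9) subS(4)]
        by - (intro Un_least; assumption)+
      show "pt v \<in> path_image A" "pt v \<notin> path_image \<beta>" "pt v \<notin> path_image \<beta>'"
        unfolding A(4) \<beta>(4) \<beta>'(4) using inA(5) ix(7,8) notA(4) by simp_all
      fix k t assume k: "k = d \<or> k = f" and t: "0 < t" "t \<le> rad v k"
      have kn: "k < n" "v \<noteq> k" "k \<noteq> x" "k \<noteq> c" using k df by auto
      have "epath v k t \<notin> E v x" "epath v k t \<notin> E v c" "epath v k t \<notin> E c x" "epath v k t \<notin> E a b"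
        using germ_notin_edge[OF vn(1) kn(1,2) t] vn d xn kn by auto
      then show "epath v k t \<notin> path_image A \<union> path_image \<beta> \<union> path_image \<beta>'"
        unfolding A(4) \<beta>(4) \<beta>'(4) using subsetD[OF ix(9)] subsetD[OF C'(1)] subsetD[OF C'(2)] by auto
    qed (use A \<beta> \<beta>' vn df in auto)
    then show ?thesis unfolding im by simp
  qed
  have locA: "same_side (E v a \<union> A1 \<union> C) (germ v d) (germ v f) \<longleftrightarrow> same_side (tri v a c) (germ v d) (germ v f)"
    if "d < n" "f < n" "d \<notin> {v, a, c}" "f \<notin> {v, a, c}" for d f
    using local[of a \<alpha>1 A1 d f] that by blast
  have locB: "same_side (E v b \<union> A2 \<union> C) (germ v d) (germ v f) \<longleftrightarrow> same_side (tri v b c) (germ v d) (germ v f)"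
    if "d < n" "f < n" "d \<notin> {v, b, c}" "f \<notin> {v, b, c}" for d f
    using local[of b \<alpha>2 A2 d f] that by blast
  show thesis
    by (rule that[OF s(1-3) z_def zab _ A12(1) notA(1,2)])
       (intro allI impI; rule znp theta[unfolded C_def] locA[unfolded C_def] locB[unfolded C_def]; assumption)+
qed

lemma germ_in_edge: "v < n \<Longrightarrow> k < n \<Longrightarrow> v \<noteq> k \<Longrightarrow> germ v k \<in> E v k"
  unfolding germ_def using rad[of v k] epath_in[of v k "rad v k"] by simp

lemma convex_side_edge:
  assumes "convex_side a b c z" "u < n" "w < n" "u \<noteq> w"
    "u \<in> {a, b, c} \<or> same_side (tri a b c) z (pt u)" "w \<in> {a, b, c} \<or> same_side (tri a b c) z (pt w)"
    "y \<in> E u w" "y \<notin> tri a b c"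
  shows "same_side (tri a b c) z y"
  using assms unfolding convex_side_def by blast

text \<open>A good drawing of the complete graph on four vertices has at most one crossing. In the
  theta curve of the crossing of \<open>vc\<close> and \<open>ab\<close>, take for \<open>y\<close>
  the germ of \<open>bc\<close> at \<open>b\<close>, and on the arcs the crossing of
  \<open>bc\<close> with \<open>va\<close>, the vertex \<open>b\<close>, and the germ of
  \<open>vc\<close>. No cycle separates \<open>y\<close> from its point: following \<open>bc\<close>
  settles the first two, and the triangle \<open>vab\<close> separates both germs from
  \<open>c\<close>. But one of the three has to be separated.\<close>

lemma K4_one_crossing:
  assumes vn: "v < n" "a < n" "b < n" "c < n" and dist: "distinct [v, a, b, c]"
    and X: "X v c a b" "X v a b c"
  shows False
proof -
  have d: "v \<noteq> a" "v \<noteq> b" "v \<noteq> c" "a \<noteq> b" "a \<noteq> c" "b \<noteq> c" using dist by auto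
  have dd: "distinct [b, c, v, a]" "distinct [v, c, a, b]" "distinct [v, a, b]" using dist by auto
  have X': "X b c v a" using X(2) X_commute(1) by blast
  have tri: "tri b v a = tri v a b" by (simp add: insert_commute)
  obtain z s A1 A2 where z: "0 < s" "s < 1" "rad v c < s" "z = epath v c s" "z \<in> E a b" "\<forall>k<n. z \<noteq> pt k"
    "A1 \<union> A2 = E a b" "pt b \<notin> A1" "pt a \<notin> A2"
    and theta: "\<forall>y w1 w2 w3. y \<in> S2 - (E v a \<union> E v b \<union> E a b \<union> epath v c ` {0..s}) \<longrightarrow>
      w1 \<in> E v a \<union> A1 - {pt v, z} \<longrightarrow> w2 \<in> E v b \<union> A2 - {pt v, z} \<longrightarrow> w3 \<in> epath v c ` {0..s} - {pt v, z} \<longrightarrow>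
      exactly_one (\<not> same_side (E v b \<union> A2 \<union> epath v c ` {0..s}) y w1)
        (\<not> same_side (E v a \<union> A1 \<union> epath v c ` {0..s}) y w2) (\<not> same_side (tri v a b) y w3)"
    and loc: "\<forall>d f. d < n \<longrightarrow> f < n \<longrightarrow> d \<notin> {v, a, c} \<longrightarrow> f \<notin> {v, a, c} \<longrightarrow>
      same_side (E v a \<union> A1 \<union> epath v c ` {0..s}) (germ v d) (germ v f) = same_side (tri v a c) (germ v d) (germ v f)"
    "\<forall>d f. d < n \<longrightarrow> f < n \<longrightarrow> d \<notin> {v, b, c} \<longrightarrow> f \<notin> {v, b, c} \<longrightarrow>
      same_side (E v b \<union> A2 \<union> epath v c ` {0..s}) (germ v d) (germ v f) = same_side (tri v b c) (germ v d) (germ v f)"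
    by (rule crossing_theta[OF vn dist X(1)])
  obtain s' where s': "0 < s'" "s' < 1" "rad b c < s'" "epath b c s' \<in> E v a"
    by (rule edge_side_crossed[OF vn(3,4,1,2) dd(1) X']) blast
  let ?C = "epath v c ` {0..s}"
  have C: "?C \<subseteq> E v c" using epath_simps(1)[OF vn(1,4) d(3)] z(1,2) by auto
  have A: "A1 \<subseteq> E a b" "A2 \<subseteq> E a b" using z(7) by auto
  note T = tri_eq[OF vn(1-3) dd(3)]
  have gv: "germ v c \<in> S2 - tri v a b" by (rule germ_in) (use vn dist in auto)
  have gb: "germ b c \<in> S2 - tri v a b" unfolding tri[symmetric] by (rule germ_in) (use vn dist in auto)
  have c: "pt c \<in> S2 - tri v a b" by (rule pt_notin_tri) (use vn dist in auto)
  have far: "\<not> same_side (tri v a b) (germ v c) (pt c)" "\<not> same_side (tri v a b) (germ b c) (pt c)"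
    using convex_side_germ(2)[OF vn(1,4,2,3) dd(2) X(1)] convex_side_germ(2)[OF vn(3,4,1,2) dd(1) X'] unfolding tri by auto
  obtain f :: "real^3 \<Rightarrow> bool" where f: "\<And>x y. x \<in> S2 - tri v a b \<Longrightarrow> y \<in> S2 - tri v a b \<Longrightarrow>
    same_side (tri v a b) x y \<longleftrightarrow> f x = f y"
    using same_side_bool[OF tri_jordan[OF vn(1-3) dd(3)]] by blast
  have s3: "same_side (tri v a b) (germ b c) (germ v c)"
    using far f[OF gv c] f[OF gb c] f[OF gb gv] by blast
  have rb: "0 < rad b c" "rad b c < 1" using rad[OF vn(3,4) d(6)] by auto
  have av: "epath b c r \<notin> E v a" "epath b c r \<notin> E a b" "epath b c r \<notin> E v c" if "0 < r" "r \<le> rad b c" for r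
    using germ_notin_edge[OF vn(3,4) d(6) that] vn d by auto
  have gbE: "germ b c \<notin> ?C" unfolding germ_def using av(3)[of "rad b c"] rb C by auto
  have y: "germ b c \<in> S2 - (E v a \<union> E v b \<union> E a b \<union> ?C)" using gb gbE T by blast
  have w1E: "epath b c s' \<in> E b c" by (rule epath_in) (use vn d s' in auto)
  have w1p: "epath b c s' \<noteq> pt k" if "k < n" for k
    by (rule edge_disjoint(3)[OF vn(3,4,1,2) dd(1) w1E s'(4) that])
  have "E a v \<inter> E a b = {pt a}" by (rule edge_adjacent) (use vn d in auto)
  then have w1z: "epath b c s' \<noteq> z" using w1p[OF vn(2)] s'(4) z(5) by (metis IntI insert_commute singletonD)
  have w1: "epath b c s' \<in> E v a \<union> A1 - {pt v, z}" using s'(4) w1z w1p[OF vn(1)] by blast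
  have "pt b \<in> E v b" using edge(3)[OF vn(1,3) d(2) vn(3)] by simp
  then have w2: "pt b \<in> E v b \<union> A2 - {pt v, z}" using z(6)[rule_format, OF vn(3)] pt_eq_iff[OF vn(3,1)] d by auto
  have "germ v c \<in> ?C" unfolding germ_def using rad[OF vn(1,4) d(3)] z(3) by auto
  moreover have "pt v \<in> tri v a b" "z \<in> tri v a b"
    using T z(5) edge(3)[OF vn(1,2) d(1) vn(1)] by auto
  ultimately have w3: "germ v c \<in> ?C - {pt v, z}" using gv by auto
  have "same_side (E v a \<union> A1 \<union> ?C) (pt b) (germ b c)"
  proof -
    have "same_side (E v a \<union> A1 \<union> ?C) (epath b c 0) (epath b c (rad b c))"
    proof (rule arc_part_same_side[OF vn(3,4) d(6)])
      fix r assume r: "0 \<le> r" "r \<le> rad b c"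
      show "epath b c r \<notin> E v a \<union> A1 \<union> ?C"
      proof (cases "r = 0")
        case True
        have "pt b \<notin> E v a" "pt b \<notin> E v c"
          using edge(3)[OF vn(1,2) d(1) vn(3)] edge(3)[OF vn(1,4) d(3) vn(3)] d by auto
        then show ?thesis using True epath_simps(2)[OF vn(3,4) d(6)] z(8) C by auto
      next
        case False
        then show ?thesis using av[of r] r A C by auto
      qed
    qed (use rb in auto)
    then show ?thesis using epath_simps(2)[OF vn(3,4) d(6)] by (simp add: germ_def)
  qed
  then have s2: "same_side (E v a \<union> A1 \<union> ?C) (germ b c) (pt b)" by (rule side_sym)
  have s1: "same_side (E v b \<union> A2 \<union> ?C) (germ b c) (epath b c s')"
    unfolding germ_def
  proof (rule arc_part_same_side[OF vn(3,4) d(6)])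
    fix r assume r: "rad b c \<le> r" "r \<le> s'"
    have r01: "0 < r" "r < 1" using r rb s' by auto
    have E: "epath b c r \<in> E b c" by (rule epath_in) (use vn d r01 in auto)
    have "epath b c r \<noteq> pt b" "epath b c r \<noteq> pt c"
      using epath_eq_iff[OF vn(3,4) d(6), of r 0] epath_eq_iff[OF vn(3,4) d(6), of r 1] r01
        epath_simps(2,3)[OF vn(3,4) d(6)] by auto
    note np = this
    have I: "E b c \<inter> E b v = {pt b}" "E b c \<inter> E b a = {pt b}" "E c b \<inter> E c v = {pt c}"
      by (rule edge_adjacent; use vn d in auto)+
    have "epath b c r \<in> E c b" using E by (simp add: insert_commute)
    then have "epath b c r \<notin> E b v" "epath b c r \<notin> E b a" "epath b c r \<notin> E c v"
      using Int_eq_singletonD[OF I(1) E np(1)] Int_eq_singletonD[OF I(2) E np(1)]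
        Int_eq_singletonD[OF I(3) _ np(2)] by blast+
    then have "epath b c r \<notin> E v b" "epath b c r \<notin> E a b" "epath b c r \<notin> E v c"
      by (simp_all add: insert_commute)
    then show "epath b c r \<notin> E v b \<union> A2 \<union> ?C" using A C by auto
  qed (use rb s' in auto)
  show False using theta[rule_format, OF y w1 w2 w3] s1 s2 s3 unfolding exactly_one_def by blast
qed

text \<open>The pairs \<open>{a,b}\<close> and \<open>{c,d}\<close> alternate in the rotation at \<open>v\<close>.\<close>

definition S :: "nat \<Rightarrow> nat \<Rightarrow> nat \<Rightarrow> nat \<Rightarrow> nat \<Rightarrow> bool" where
  "S v a b c d \<longleftrightarrow> \<not> same_side (tri v a b) (germ v c) (germ v d)"

lemma S_commute: "S v a b c d \<longleftrightarrow> S v b a c d" "S v a b c d \<longleftrightarrow> S v a b d c"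
  unfolding S_def using side_sym by (auto simp: insert_commute)

text \<open>The germ of \<open>vd\<close> lies in exactly one face of the theta curve, tested
  against the germs of \<open>va\<close>, \<open>vb\<close>, \<open>vc\<close> on its three arcs.
  The two cycles that are not triangles are then traded for \<open>vac\<close> and
  \<open>vbc\<close>.\<close>

lemma S_exactly_one_crossing:
  assumes vn: "v < n" "a < n" "b < n" "c < n" "d < n" and dist: "distinct [v, a, b, c, d]"
    and X: "X v c a b"
  shows "exactly_one (S v a b c d) (S v a c b d) (S v b c a d)"
proof -
  have d4: "distinct [v, a, b, c]" using dist by auto
  obtain z s A1 A2 where z: "0 < s" "s < 1" "rad v c < s" "z = epath v c s" "z \<in> E a b" "\<forall>k<n. z \<noteq> pt k"
    "A1 \<union> A2 = E a b" "pt b \<notin> A1" "pt a \<notin> A2"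
    and theta: "\<forall>y w1 w2 w3. y \<in> S2 - (E v a \<union> E v b \<union> E a b \<union> epath v c ` {0..s}) \<longrightarrow>
      w1 \<in> E v a \<union> A1 - {pt v, z} \<longrightarrow> w2 \<in> E v b \<union> A2 - {pt v, z} \<longrightarrow> w3 \<in> epath v c ` {0..s} - {pt v, z} \<longrightarrow>
      exactly_one (\<not> same_side (E v b \<union> A2 \<union> epath v c ` {0..s}) y w1)
        (\<not> same_side (E v a \<union> A1 \<union> epath v c ` {0..s}) y w2) (\<not> same_side (tri v a b) y w3)"
    and loc: "\<forall>d f. d < n \<longrightarrow> f < n \<longrightarrow> d \<notin> {v, a, c} \<longrightarrow> f \<notin> {v, a, c} \<longrightarrow>
      same_side (E v a \<union> A1 \<union> epath v c ` {0..s}) (germ v d) (germ v f) = same_side (tri v a c) (germ v d) (germ v f)"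
    "\<forall>d f. d < n \<longrightarrow> f < n \<longrightarrow> d \<notin> {v, b, c} \<longrightarrow> f \<notin> {v, b, c} \<longrightarrow>
      same_side (E v b \<union> A2 \<union> epath v c ` {0..s}) (germ v d) (germ v f) = same_side (tri v b c) (germ v d) (germ v f)"
    by (rule crossing_theta[OF vn(1-4) d4 X])
  let ?C = "epath v c ` {0..s}"
  have C: "?C \<subseteq> E v c" using epath_simps(1)[of v c] vn d4 z(1,2) by auto
  have E: "germ v k \<notin> E i j" if "k < n" "k \<noteq> v" "i < n" "j < n" "i \<noteq> j" "k \<notin> {i, j} \<or> v \<notin> {i, j}" for k i j
    unfolding germ_def by (rule germ_notin_edge) (use that vn rad[of v k] in auto)
  have gS: "germ v k \<in> S2" "germ v k \<in> E v k" if "k < n" "k \<noteq> v" for k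
    using germ_in_edge[of v k] edge(2)[of v k] that vn by auto
  have y: "germ v d \<in> S2 - (E v a \<union> E v b \<union> E a b \<union> ?C)"
    using E[of d v a] E[of d v b] E[of d a b] E[of d v c] gS[of d] C vn dist by auto
  have np: "germ v k \<notin> {pt v, z}" if "k < n" "k \<notin> {v, a, b}" for k
    using E[of k v a] E[of k a b] that vn d4 z(5) edge(3)[of v a v] by auto
  have np': "germ v k \<notin> {pt v, z}" if "k = a \<or> k = b" for k
    using E[of k v c] E[of k a b] that vn d4 z(5) edge(3)[of v c v] by auto
  have w1: "germ v a \<in> E v a \<union> A1 - {pt v, z}" using gS[of a] np'[of a] vn d4 by auto
  have w2: "germ v b \<in> E v b \<union> A2 - {pt v, z}" using gS[of b] np'[of b] vn d4 by auto
  have "germ v c \<in> ?C" unfolding germ_def using rad[of v c] vn d4 z(3) by auto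
  then have w3: "germ v c \<in> ?C - {pt v, z}" using np[of c] vn d4 by auto
  have l: "same_side (E v a \<union> A1 \<union> ?C) (germ v d) (germ v b) \<longleftrightarrow> same_side (tri v a c) (germ v d) (germ v b)"
    "same_side (E v b \<union> A2 \<union> ?C) (germ v d) (germ v a) \<longleftrightarrow> same_side (tri v b c) (germ v d) (germ v a)"
    by (rule loc[rule_format]; use vn dist in auto)+
  show ?thesis
    using theta[rule_format, OF y w1 w2 w3] unfolding l exactly_one_def S_def
    by (metis side_sym)
qed

text \<open>Here the theta curve has branch points \<open>v\<close> and \<open>b\<close> and the
  arcs \<open>v-a-b\<close>, \<open>vb\<close> and \<open>v-c-b\<close>. Its cycles are
  \<open>vab\<close>, \<open>vbc\<close> and the quadrilateral \<open>v-a-b-c\<close>, which is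
  compared with the triangle \<open>vac\<close> near \<open>v\<close>. The edge \<open>ac\<close> is
  not part of the theta curve, so \<open>vb\<close> may cross it.\<close>

lemma S_exactly_one_uncrossed:
  assumes vn: "v < n" "a < n" "b < n" "c < n" "d < n" and dist: "distinct [v, a, b, c, d]"
    and X: "\<not> X v c a b" "\<not> X v a b c"
  shows "exactly_one (S v a b c d) (S v a c b d) (S v b c a d)"
proof -
  have ne: "v \<noteq> a" "v \<noteq> b" "v \<noteq> c" "a \<noteq> b" "a \<noteq> c" "b \<noteq> c" "a \<noteq> v" "b \<noteq> v" "c \<noteq> v" "b \<noteq> a" "c \<noteq> a" "c \<noteq> b"
    using dist by auto
  note gva = epath[OF vn(1,2) ne(1)] and gvb = epath[OF vn(1,3) ne(2)] and gvc = epath[OF vn(1,4) ne(3)]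
    and gab = epath[OF vn(2,3) ne(4)] and gcb = epath[OF vn(4,3) ne(12)] and gca = epath[OF vn(4,2) ne(11)]
    and gba = epath[OF vn(3,2) ne(10)]
  have adj: "E v a \<inter> E v b = {pt v}" "E v a \<inter> E v c = {pt v}" "E v b \<inter> E v c = {pt v}"
    "E a v \<inter> E a b = {pt a}" "E b v \<inter> E b a = {pt b}" "E c v \<inter> E c a = {pt c}" "E c v \<inter> E c b = {pt c}"
    "E a v \<inter> E a c = {pt a}" "E b v \<inter> E b c = {pt b}" "E b a \<inter> E b c = {pt b}"
    by (rule edge_adjacent; use vn ne in simp)+
  have sw: "E a v = E v a" "E b v = E v b" "E c v = E v c" "E b a = E a b" "E a c = E c a" "E b c = E c b"
    by (simp_all add: insert_commute)
  have dis: "E v c \<inter> E a b = {}" "E v a \<inter> E c b = {}" using X sw by (auto simp: X_def)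
  define c1 where "c1 = epath v a +++ epath a b"
  define c3 where "c3 = epath v c +++ epath c b"
  have c1: "arc c1" "pathstart c1 = pt v" "pathfinish c1 = pt b" "path_image c1 = E v a \<union> E a b"
    unfolding c1_def using gva gab adj(4) sw by (auto intro!: arc_join simp: path_image_join)
  have c3: "arc c3" "pathstart c3 = pt v" "pathfinish c3 = pt b" "path_image c3 = E v c \<union> E c b"
    unfolding c3_def using gvc gcb adj(7) sw by (auto intro!: arc_join simp: path_image_join)
  have com: "E a b \<inter> E v b = {pt b}" "E c b \<inter> E v b = {pt b}" "E a b \<inter> E v c = {}" "E v b \<inter> E c b = {pt b}"
    using adj(5,9) dis sw by (simp_all add: Int_commute)
  have com': "E a b \<inter> E c b = {pt b}" using adj(10) unfolding sw .
  have int: "path_image c1 \<inter> path_image (epath v b) = {pt v, pt b}"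
    "path_image c1 \<inter> path_image c3 = {pt v, pt b}" "path_image (epath v b) \<inter> path_image c3 = {pt v, pt b}"
    unfolding c1(4) c3(4) gvb(2) Int_Un_distrib Int_Un_distrib2 adj(1-3) dis com com' by auto
  have ES: "E v a \<subseteq> S2" "E v b \<subseteq> S2" "E v c \<subseteq> S2" "E a b \<subseteq> S2" "E c b \<subseteq> S2" "E c a \<subseteq> S2"
    by (intro edge(2) vn ne)+
  have sub: "path_image c1 \<subseteq> S2" "path_image (epath v b) \<subseteq> S2" "path_image c3 \<subseteq> S2"
    unfolding c1(4) c3(4) gvb(2) by (intro Un_least ES)+
  have T: "tri v a b = E v a \<union> E a b \<union> E v b" "tri v b c = E v b \<union> E b c \<union> E v c" "tri v a c = E v a \<union> E a c \<union> E v c"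
    using tri_eq[OF vn(1,2,3)] tri_eq[OF vn(1,3,4)] tri_eq[OF vn(1,2,4)] ne by auto
  have J12: "path_image c1 \<union> path_image (epath v b) = tri v a b"
    and J23: "path_image (epath v b) \<union> path_image c3 = tri v b c"
    unfolding c1(4) c3(4) gvb(2) T sw by auto
  have G: "epath v k t \<notin> E i j" if "0 < t" "t \<le> rad v k" "k < n" "k \<noteq> v" "i < n" "j < n" "i \<noteq> j"
      "k \<notin> {i, j} \<or> v \<notin> {i, j}" for k i j t
    by (rule germ_notin_edge) (use that vn in auto)
  have E: "germ v k \<notin> E i j" if "k < n" "k \<noteq> v" "i < n" "j < n" "i \<noteq> j" "k \<notin> {i, j} \<or> v \<notin> {i, j}" for k i j
    unfolding germ_def by (rule G) (use that vn rad[of v k] in auto)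
  have gS: "germ v k \<in> S2" "germ v k \<in> E v k" if "k < n" "k \<noteq> v" for k
    using germ_in_edge[of v k] edge(2)[of v k] that vn by auto
  have y: "germ v d \<in> S2" "germ v d \<notin> path_image c1" "germ v d \<notin> path_image (epath v b)" "germ v d \<notin> path_image c3"
    unfolding c1(4) c3(4) gvb(2)
    using E[of d v a] E[of d v b] E[of d a b] E[of d v c] E[of d c b] gS[of d] vn dist by auto
  have np: "germ v k \<notin> {pt v, pt b}" if "k = a \<or> k = b \<or> k = c" for k
  proof -
    have "germ v k \<notin> E a b \<union> E c b" using that E[of k a b] E[of k c b] vn ne by auto
    moreover have "germ v k \<notin> E v a \<inter> E v c" using that E[of k v a] E[of k v c] vn ne by auto
    moreover have "pt b \<in> E a b" "pt v \<in> E v a" "pt v \<in> E v c" using edge(3) vn ne by auto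
    ultimately show ?thesis by auto
  qed
  have w: "germ v a \<in> path_image c1 - {pt v, pt b}" "germ v b \<in> path_image (epath v b) - {pt v, pt b}"
    "germ v c \<in> path_image c3 - {pt v, pt b}"
    unfolding c1(4) c3(4) gvb(2) using gS[of a] gS[of b] gS[of c] np vn ne by auto
  note theta = theta_faces[OF c1(1) gvb(1) c3(1) c1(2,3) gvb(3,4) c3(2,3) int sub y w]
  define A where "A = reversepath (epath v a) +++ epath v c"
  define \<beta>' where "\<beta>' = epath c b +++ epath b a"
  have A: "arc A" "pathstart A = pt a" "pathfinish A = pt c" "path_image A = E v a \<union> E v c"
    unfolding A_def using gva gvc adj(2) by (auto intro!: arc_join arc_reversepath simp: path_image_join)
  have \<beta>': "arc \<beta>'" "pathstart \<beta>' = pt c" "pathfinish \<beta>' = pt a" "path_image \<beta>' = E c b \<union> E a b"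
    unfolding \<beta>'_def using gcb gba adj(10) sw by (auto intro!: arc_join simp: path_image_join Int_commute)
  have ac: "E v a \<inter> E c a = {pt a}" "E v c \<inter> E c a = {pt c}" "E v c \<inter> E c b = {pt c}" "E v a \<inter> E a b = {pt a}"
    using adj(4,6,7,8) unfolding sw by blast+
  have "path_image A \<inter> path_image (epath c a) \<subseteq> {pt a, pt c}" "path_image A \<inter> path_image \<beta>' \<subseteq> {pt a, pt c}"
    unfolding A(4) \<beta>'(4) gca(2) Int_Un_distrib Int_Un_distrib2 ac dis by auto
  then have simple: "simple_path (A +++ epath c a)" "simple_path (A +++ \<beta>')"
    by (intro simple_path_join_loop A(1) \<beta>'(1) gca(1); simp add: A \<beta>' gca)+
  have im: "path_image A \<union> path_image (epath c a) = tri v a c" "path_image A \<union> path_image \<beta>' = path_image c1 \<union> path_image c3"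
    unfolding A(4) \<beta>'(4) gca(2) T sw c1(4) c3(4) by auto
  have "same_side (path_image A \<union> path_image (epath c a)) (germ v d) (germ v b) \<longleftrightarrow>
      same_side (path_image A \<union> path_image \<beta>') (germ v d) (germ v b)"
  proof (rule same_side_germs_local[OF simple])
    show "path_image A \<subseteq> S2" "path_image (epath c a) \<subseteq> S2" "path_image \<beta>' \<subseteq> S2"
      unfolding A(4) \<beta>'(4) gca(2) by (intro Un_least ES)+
    show "pt v \<in> path_image A" "pt v \<notin> path_image (epath c a)" "pt v \<notin> path_image \<beta>'"
      unfolding A(4) \<beta>'(4) gca(2) using edge(3)[of _ _ v] vn ne by auto
    fix k t assume k: "k = d \<or> k = b" and t: "0 < t" "t \<le> rad v k"
    have kn: "k < n" "k \<noteq> v" "k \<noteq> a" "k \<noteq> c" using k vn dist by auto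
    show "epath v k t \<notin> path_image A \<union> path_image (epath c a) \<union> path_image \<beta>'"
      unfolding A(4) \<beta>'(4) gca(2)
      using G[OF t kn(1,2), of v a] G[OF t kn(1,2), of v c] G[OF t kn(1,2), of c a] G[OF t kn(1,2), of c b]
        G[OF t kn(1,2), of a b] kn vn ne by auto
  qed (use A \<beta>' gca vn dist in auto)
  then have loc: "same_side (path_image c1 \<union> path_image c3) (germ v d) (germ v b) \<longleftrightarrow>
    same_side (tri v a c) (germ v d) (germ v b)" unfolding im by blast
  show ?thesis
    using theta unfolding J12 J23 loc exactly_one_def S_def
    by (metis side_sym)
qed

text \<open>The uncrossed construction tolerates a crossing of \<open>vb\<close> with
  \<open>ac\<close>, so these three cases are exhaustive.\<close>

lemma S_exactly_one:
  assumes vn: "v < n" "a < n" "b < n" "c < n" "d < n" and dist: "distinct [v, a, b, c, d]"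
  shows "exactly_one (S v a b c d) (S v a c b d) (S v b c a d)"
proof -
  consider "X v c a b" | "X v a b c" | "\<not> X v c a b" "\<not> X v a b c" by blast
  then show ?thesis
  proof cases
    case 1
    then show ?thesis by (rule S_exactly_one_crossing[OF assms])
  next
    case 2
    have "exactly_one (S v b c a d) (S v b a c d) (S v c a b d)"
      by (rule S_exactly_one_crossing) (use assms 2 in auto)
    then show ?thesis using S_commute(1) unfolding exactly_one_def by blast
  next
    case 3
    then show ?thesis by (rule S_exactly_one_uncrossed[OF assms])
  qed
qed

text \<open>In \<open>S\<close> one pair spans a triangle and the other supplies germs. The symmetry
  follows propositionally from \<open>S_exactly_one\<close> applied four times, with each of the
  four spokes once in the last position.\<close>

lemma S_swap:
  assumes vn: "v < n" "a < n" "b < n" "c < n" "d < n" and dist: "distinct [v, a, b, c, d]"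
  shows "S v a b c d \<longleftrightarrow> S v c d a b"
proof -
  have "exactly_one (S v a b c d) (S v a c b d) (S v b c a d)" "exactly_one (S v a b d c) (S v a d b c) (S v b d a c)"
    "exactly_one (S v b c d a) (S v b d c a) (S v c d b a)" "exactly_one (S v a c d b) (S v a d c b) (S v c d a b)"
    by (rule S_exactly_one; use assms in auto)+
  then show ?thesis using S_commute unfolding exactly_one_def by metis
qed

section \<open>Crossings of spokes\<close>

definition tri_side :: "nat \<Rightarrow> nat \<Rightarrow> nat \<Rightarrow> real^3 \<Rightarrow> bool" where
  "tri_side a b c = (SOME f. \<forall>x y. x \<in> S2 - tri a b c \<longrightarrow> y \<in> S2 - tri a b c \<longrightarrow>
     same_side (tri a b c) x y = (f x = f y))"

lemma tri_side:
  assumes "a < n" "b < n" "c < n" "distinct [a, b, c]" "x \<in> S2 - tri a b c" "y \<in> S2 - tri a b c"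
  shows "same_side (tri a b c) x y \<longleftrightarrow> tri_side a b c x = tri_side a b c y"
proof -
  have "\<exists>f :: real^3 \<Rightarrow> bool. \<forall>x y. x \<in> S2 - tri a b c \<longrightarrow> y \<in> S2 - tri a b c \<longrightarrow> same_side (tri a b c) x y = (f x = f y)"
  proof (rule same_side_bool[OF tri_jordan[OF assms(1-4)]])
    fix f :: "real^3 \<Rightarrow> bool"
    assume f: "\<And>x y. x \<in> S2 - tri a b c \<Longrightarrow> y \<in> S2 - tri a b c \<Longrightarrow> same_side (tri a b c) x y = (f x = f y)"
    show ?thesis by (intro exI[of _ f] allI impI) (rule f)
  qed
  from someI_ex[OF this] have "\<forall>x y. x \<in> S2 - tri a b c \<longrightarrow> y \<in> S2 - tri a b c \<longrightarrow>
      same_side (tri a b c) x y = (tri_side a b c x = tri_side a b c y)"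
    unfolding tri_side_def[symmetric] .
  then show ?thesis using assms(5,6) by simp
qed

lemma germ_side_iff_not_S:
  assumes "S v a c b d" "v < n" "a < n" "b < n" "c < n" "d < n" "distinct [v, a, b, c, d]"
  shows "same_side (tri v a b) (germ v c) (germ v d)" "same_side (tri v b c) (germ v a) (germ v d)"
    "same_side (tri v a d) (germ v b) (germ v c)"
proof -
  show "same_side (tri v a b) (germ v c) (germ v d)" "same_side (tri v b c) (germ v a) (germ v d)"
    using S_exactly_one[OF assms(2-7)] assms(1) unfolding exactly_one_def S_def by blast+
  have dd: "distinct [v, a, d, b, c]" "distinct [v, a, c, b, d]" using assms(7) by auto
  have "exactly_one (S v a d b c) (S v a b d c) (S v d b a c)" "S v a c b d = S v b d a c"
    by (rule S_exactly_one[OF assms(2,3,6,4,5) dd(1)]) (rule S_swap[OF assms(2,3,5,4,6) dd(2)])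
  then show "same_side (tri v a d) (germ v b) (germ v c)"
    using assms(1) S_commute unfolding exactly_one_def S_def by blast
qed

lemma no_edge_crosses_convex_side:
  assumes cv: "convex_side p q r z" and uw: "u < n" "w < n" "u \<noteq> w" "p < n" "q < n" "r < n"
    and sub: "u \<in> {p, q, r} \<or> same_side (tri p q r) z (pt u)" "w \<in> {p, q, r} \<or> same_side (tri p q r) z (pt w)"
    and y: "y \<in> E u w" "y \<in> S2 - tri p q r"
  shows "same_side (tri p q r) z y"
  using convex_side_edge[OF cv uw(1-3) sub y(1)] y(2) by blast

text \<open>Below, \<open>S v a c b d\<close> expresses that \<open>a, b, c, d\<close> appear in this cyclic order, or its reverse, in the
  rotation at \<open>v\<close>.\<close>

lemma spoke_cross_shrink:
  assumes S: "S v a c b d" and vn: "v < n" "a < n" "b < n" "c < n" "d < n" and dist: "distinct [v, a, b, c, d]"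
    and X: "X v b a d" "\<not> X v c a d"
  shows "X v b a c"
proof (rule ccontr)
  assume nX: "\<not> X v b a c"
  note ne = distinct5_neq[OF dist]
  define f where "f = tri_side v a d"
  have f: "same_side (tri v a d) x y \<longleftrightarrow> f x = f y" if "x \<in> S2 - tri v a d" "y \<in> S2 - tri v a d" for x y
    unfolding f_def by (rule tri_side[OF _ _ _ _ that]) (use vn ne in auto)
  define f' where "f' = tri_side v a c"
  have f': "same_side (tri v a c) x y \<longleftrightarrow> f' x = f' y" if "x \<in> S2 - tri v a c" "y \<in> S2 - tri v a c" for x y
    unfolding f'_def by (rule tri_side[OF _ _ _ _ that]) (use vn ne in auto)
  have cv: "convex_side v a d (germ v b)" using convex_side_germ(1)[of v b a d] vn dist X by auto
  have g: "germ v b \<in> S2 - tri v a d" "germ v c \<in> S2 - tri v a d" "germ v b \<in> S2 - tri v a c" "germ v d \<in> S2 - tri v a c"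
    by (rule germ_in; use vn dist in auto)+
  have p: "pt c \<in> S2 - tri v a d" "pt d \<in> S2 - tri v a c"
    by (rule pt_notin_tri; use vn dist in auto)+
  have "f (germ v c) = f (pt c)"
    using edge_side_uncrossed(2)[of v c a d] vn dist X f[OF g(2) p(1)] by auto
  moreover have "f (germ v b) = f (germ v c)"
    using germ_side_iff_not_S(3)[OF S vn dist] f[OF g(1,2)] by blast
  ultimately have bc: "same_side (tri v a d) (germ v b) (pt c)" using f[OF g(1) p(1)] by simp
  \<comment> \<open>By \<open>bc\<close> the vertex \<open>c\<close> lies on the convex side of
    \<open>vad\<close>, so \<open>ac\<close> stays in that closed disc. A crossing with
    \<open>vd\<close> would make \<open>ac\<close> start on the opposite side.\<close>
  have nac: "\<not> X a c v d"
  proof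
    assume Xac: "X a c v d"
    have tri: "tri a v d = tri v a d" by (simp add: insert_commute)
    have epath: "germ a c \<in> S2 - tri v a d" unfolding tri[symmetric] by (rule germ_in) (use vn dist in auto)
    have "same_side (tri v a d) (germ v b) (germ a c)"
      by (rule no_edge_crosses_convex_side[OF cv vn(2,4) ne(6) vn(1,2,5) _ _ _ epath])
         (use bc germ_in_edge[OF vn(2,4) ne(6)] in auto)
    moreover have "\<not> same_side (tri v a d) (germ a c) (pt c)"
      using convex_side_germ(2)[of a c v d] Xac vn dist unfolding tri by auto
    ultimately show False using bc f[OF g(1) epath] f[OF epath p(1)] f[OF g(1) p(1)] by simp
  qed
  \<comment> \<open>From the germ of \<open>vb\<close> along \<open>vb\<close> to \<open>x\<close>,
    along \<open>ad\<close> to \<open>d\<close>, and back along \<open>vd\<close> to its germ, the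
    triangle \<open>vac\<close> is never met. This contradicts that \<open>b\<close> and
    \<open>d\<close> are separated by \<open>a\<close> and \<open>c\<close>.\<close>
  obtain x where x: "x \<in> E v b" "x \<in> E a d" using X(1) by (auto simp: X_def)
  have "distinct [v, b, a, d]" using dist by auto
  then have xp: "x \<noteq> pt k" if "k < n" for k
    using edge_disjoint(3)[OF vn(1,3,2,5) _ x that] by blast
  have xb: "same_side (tri v a c) (germ v b) x"
    by (rule edge_side_uncrossed(1)[OF vn(1,3,2,4) _ nX x(1) xp[OF vn(1)]]) (use dist in auto)
  have tri': "tri a v c = tri v a c" by (simp add: insert_commute)
  have nad: "\<not> X a d v c" using X(2) X_commute by blast
  have dadvc: "distinct [a, d, v, c]" using dist by auto
  have xd: "same_side (tri v a c) (germ a d) x" "same_side (tri v a c) (germ a d) (pt d)"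
    using edge_side_uncrossed(1)[OF vn(2,5,1,4) dadvc nad x(2) xp[OF vn(2)]]
      edge_side_uncrossed(2)[OF vn(2,5,1,4) dadvc nad] unfolding tri' by auto
  have dvd: "same_side (tri v a c) (germ v d) (pt d)"
    using edge_side_uncrossed(2)[of v d a c] nac X_commute(1) vn dist by auto
  have xin: "x \<in> S2 - tri v a c" using xb side_in by blast
  have gad: "germ a d \<in> S2 - tri v a c" using xd(1) side_in by blast
  have "same_side (tri v a c) (germ v b) (germ v d)"
    using f'[OF g(3) xin] f'[OF gad xin] f'[OF gad p(2)] f'[OF g(4) p(2)] f'[OF g(3,4)] xb xd dvd by simp
  then show False using S unfolding S_def by blast
qed

text \<open>Relative to \<open>vad\<close>, the spokes \<open>vb\<close> and \<open>vc\<close> start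
  on the same side and \<open>vc\<close> ends on the other. If \<open>vb\<close> missed
  \<open>ad\<close>, its crossing with \<open>ac\<close> would be on the starting side; but
  \<open>ac\<close> cannot cross \<open>vd\<close> by \<open>K4_one_crossing\<close>, so that point
  is on the side of \<open>c\<close>.\<close>

lemma spoke_cross_extend:
  assumes S: "S v a c b d" and vn: "v < n" "a < n" "b < n" "c < n" "d < n" and dist: "distinct [v, a, b, c, d]"
    and X: "X v b a c" "X v c a d"
  shows "X v b a d"
proof (rule ccontr)
  assume nX: "\<not> X v b a d"
  note ne = distinct5_neq[OF dist]
  define f where "f = tri_side v a d"
  have f: "same_side (tri v a d) x y \<longleftrightarrow> f x = f y" if "x \<in> S2 - tri v a d" "y \<in> S2 - tri v a d" for x y
    unfolding f_def by (rule tri_side[OF _ _ _ _ that]) (use vn ne in auto)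
  have g: "germ v b \<in> S2 - tri v a d" "germ v c \<in> S2 - tri v a d"
    by (rule germ_in; use vn dist in auto)+
  have p: "pt c \<in> S2 - tri v a d" by (rule pt_notin_tri; use vn dist in auto)
  have s1: "same_side (tri v a d) (germ v b) (germ v c)" by (rule germ_side_iff_not_S(3)[OF S vn dist])
  have s2: "\<not> same_side (tri v a d) (germ v c) (pt c)"
    using convex_side_germ(2)[of v c a d] X(2) vn dist by auto
  obtain x where x: "x \<in> E v b" "x \<in> E a c" using X(1) by (auto simp: X_def)
  have "distinct [v, b, a, c]" using dist by auto
  then have xp: "x \<noteq> pt k" if "k < n" for k
    using edge_disjoint(3)[OF vn(1,3,2,4) _ x that] by blast
  have s3: "same_side (tri v a d) (germ v b) x"
    by (rule edge_side_uncrossed(1)[OF vn(1,3,2,5) _ nX x(1) xp[OF vn(1)]]) (use dist in auto)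
  have nac: "\<not> X a c v d"
  proof
    assume "X a c v d"
    then have "X v d a c" "X v c d a" using X(2) X_commute by blast+
    then show False using K4_one_crossing[of v d a c] vn dist by auto
  qed
  have tri: "tri a v d = tri v a d" by (simp add: insert_commute)
  have dd: "distinct [a, c, v, d]" using dist by auto
  have s4: "same_side (tri v a d) (germ a c) x" "same_side (tri v a d) (germ a c) (pt c)"
    using edge_side_uncrossed(1)[OF vn(2,4,1,5) dd nac x(2) xp[OF vn(2)]]
      edge_side_uncrossed(2)[OF vn(2,4,1,5) dd nac] unfolding tri by auto
  have xin: "x \<in> S2 - tri v a d" using s3 side_in by blast
  have gac: "germ a c \<in> S2 - tri v a d" using s4(1) side_in by blast
  show False
    using f[OF g] f[OF g(2) p] f[OF g(1) xin] f[OF gac xin] f[OF gac p] s1 s2 s3 s4 by simp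
qed

text \<open>The side of \<open>vac\<close> where \<open>vd\<close> starts is convex. The spoke
  \<open>vb\<close> starts on the other side and crosses over, so both of its ends are in the convex
  disc although its germ is not.\<close>

lemma opposite_spokes_not_both_cross:
  assumes S: "S v a c b d" and vn: "v < n" "a < n" "b < n" "c < n" "d < n" and dist: "distinct [v, a, b, c, d]"
    and X: "X v b a c" "X v d a c"
  shows False
proof -
  note ne = distinct5_neq[OF dist]
  define f where "f = tri_side v a c"
  have f: "same_side (tri v a c) x y \<longleftrightarrow> f x = f y" if "x \<in> S2 - tri v a c" "y \<in> S2 - tri v a c" for x y
    unfolding f_def by (rule tri_side[OF _ _ _ _ that]) (use vn ne in auto)
  have cv: "convex_side v a c (germ v d)" and n: "\<not> same_side (tri v a c) (germ v b) (pt b)"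
    using convex_side_germ[of v d a c] convex_side_germ[of v b a c] vn dist X by auto
  have g: "germ v b \<in> S2 - tri v a c" "germ v d \<in> S2 - tri v a c"
    by (rule germ_in; use vn dist in auto)+
  have p: "pt b \<in> S2 - tri v a c" by (rule pt_notin_tri) (use vn dist in auto)
  have sep: "\<not> same_side (tri v a c) (germ v b) (germ v d)" using S unfolding S_def .
  then have db: "same_side (tri v a c) (germ v d) (pt b)"
    using f[OF g(1) p] f[OF g(2) p] f[OF g] n by simp
  have "same_side (tri v a c) (germ v d) (germ v b)"
    by (rule no_edge_crosses_convex_side[OF cv vn(1,3) ne(2) vn(1,2,4) _ _ _ g(1)])
       (use db germ_in_edge[OF vn(1,3) ne(2)] in auto)
  then show False using sep f[OF g] f[OF g(2,1)] by simp
qed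

text \<open>The side of \<open>vbc\<close> where \<open>vd\<close> starts is convex and contains
  \<open>a\<close>, because \<open>va\<close> starts there too and misses \<open>bc\<close>. So
  \<open>ba\<close> must stay in the disc; but crossing \<open>vc\<close>, it starts at
  \<open>b\<close> on the other side.\<close>

lemma spoke_crosses_adjacent_edges_aux:
  assumes S: "S v a c b d" and vn: "v < n" "a < n" "b < n" "c < n" "d < n" and dist: "distinct [v, a, b, c, d]"
    and X: "X v d b c" "X v c a b"
  shows False
proof -
  note ne = distinct5_neq[OF dist]
  define f where "f = tri_side v b c"
  have f: "same_side (tri v b c) x y \<longleftrightarrow> f x = f y" if "x \<in> S2 - tri v b c" "y \<in> S2 - tri v b c" for x y
    unfolding f_def by (rule tri_side[OF _ _ _ _ that]) (use vn ne in auto)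
  have cv: "convex_side v b c (germ v d)" using convex_side_germ[of v d b c] vn dist X by auto
  have nX: "\<not> X v a b c" using K4_one_crossing[of v a b c] X(2) vn dist by auto
  have g: "germ v a \<in> S2 - tri v b c" "germ v d \<in> S2 - tri v b c"
    by (rule germ_in; use vn dist in auto)+
  have p: "pt a \<in> S2 - tri v b c" by (rule pt_notin_tri) (use vn dist in auto)
  have s1: "same_side (tri v b c) (germ v a) (germ v d)" by (rule germ_side_iff_not_S(2)[OF S vn dist])
  have s2: "same_side (tri v b c) (germ v a) (pt a)"
    using edge_side_uncrossed(2)[of v a b c] nX vn dist by auto
  have da: "same_side (tri v b c) (germ v d) (pt a)" using s1 s2 f[OF g] f[OF g(1) p] f[OF g(2) p] by simp
  have tri: "tri b v c = tri v b c" by (simp add: insert_commute)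
  have gb: "germ b a \<in> S2 - tri v b c" unfolding tri[symmetric] by (rule germ_in) (use vn dist in auto)
  have "same_side (tri v b c) (germ v d) (germ b a)"
    by (rule no_edge_crosses_convex_side[OF cv vn(3,2) ne(5)[symmetric] vn(1,3,4) _ _ _ gb])
       (use da germ_in_edge[OF vn(3,2) ne(5)[symmetric]] in auto)
  moreover have "\<not> same_side (tri v b c) (germ b a) (pt a)"
  proof -
    have "X b a v c" using X(2) X_commute by blast
    then show ?thesis using convex_side_germ(2)[of b a v c] vn dist unfolding tri by auto
  qed
  ultimately show False using da f[OF g(2) gb] f[OF gb p] f[OF g(2) p] by simp
qed

text \<open>The auxiliary lemma and its mirror image put \<open>c\<close> on the convex side of
  \<open>vab\<close> and \<open>a\<close> on the convex side of \<open>vbc\<close>. Whichever of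
  \<open>ab\<close>, \<open>bc\<close> is crossed first, \<open>vd\<close> has then left the
  corresponding convex disc, which contains the other edge. A simultaneous crossing would be at
  \<open>b\<close>.\<close>

lemma spoke_not_cross_adjacent_edges:
  assumes S: "S v a c b d" and vn: "v < n" "a < n" "b < n" "c < n" "d < n" and dist: "distinct [v, a, b, c, d]"
    and X: "X v d a b" "X v d b c"
  shows False
proof -
  note ne = distinct5_neq[OF dist]
  have n1: "\<not> X v c a b" using spoke_crosses_adjacent_edges_aux[OF S vn dist X(2)] by blast
  have n2: "\<not> X v a b c"
  proof
    assume "X v a b c"
    then have "X v a c b" "X v d b a" "S v c a b d" using X S X_commute S_commute by blast+
    then show False using spoke_crosses_adjacent_edges_aux[of v c a b d] vn dist by auto
  qed
  define f1 where "f1 = tri_side v a b"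
  have f1: "same_side (tri v a b) x y \<longleftrightarrow> f1 x = f1 y" if "x \<in> S2 - tri v a b" "y \<in> S2 - tri v a b" for x y
    unfolding f1_def by (rule tri_side[OF _ _ _ _ that]) (use vn ne in auto)
  define f2 where "f2 = tri_side v b c"
  have f2: "same_side (tri v b c) x y \<longleftrightarrow> f2 x = f2 y" if "x \<in> S2 - tri v b c" "y \<in> S2 - tri v b c" for x y
    unfolding f2_def by (rule tri_side[OF _ _ _ _ that]) (use vn ne in auto)
  have dd: "distinct [v, d, a, b]" "distinct [v, d, b, c]" using dist by auto
  have cv: "convex_side v a b (germ v d)" "convex_side v b c (germ v d)"
    using convex_side_germ(1)[OF vn(1,5,2,3) dd(1) X(1)] convex_side_germ(1)[OF vn(1,5,3,4) dd(2) X(2)] by auto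
  have g1: "germ v c \<in> S2 - tri v a b" "germ v d \<in> S2 - tri v a b"
    and g2: "germ v a \<in> S2 - tri v b c" "germ v d \<in> S2 - tri v b c"
    by (rule germ_in; use vn dist in auto)+
  have p: "pt c \<in> S2 - tri v a b" "pt a \<in> S2 - tri v b c" by (rule pt_notin_tri; use vn dist in auto)+
  have c: "same_side (tri v a b) (germ v d) (pt c)"
    using germ_side_iff_not_S(1)[OF S vn dist] edge_side_uncrossed(2)[of v c a b] n1 vn dist
      f1[OF g1] f1[OF g1(1) p(1)] f1[OF g1(2) p(1)] by auto
  have a: "same_side (tri v b c) (germ v d) (pt a)"
    using germ_side_iff_not_S(2)[OF S vn dist] edge_side_uncrossed(2)[of v a b c] n2 vn dist
      f2[OF g2] f2[OF g2(1) p(2)] f2[OF g2(2) p(2)] by auto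
  obtain s where s: "0 < s" "s < 1" "epath v d s \<in> E a b"
    "\<And>t. s < t \<Longrightarrow> t \<le> 1 \<Longrightarrow> epath v d t \<in> S2 - tri v a b \<and> \<not> same_side (tri v a b) (germ v d) (epath v d t)"
    by (rule edge_side_crossed[OF vn(1,5,2,3) dd(1) X(1)]) blast
  obtain t where t: "0 < t" "t < 1" "epath v d t \<in> E b c"
    "\<And>u. t < u \<Longrightarrow> u \<le> 1 \<Longrightarrow> epath v d u \<in> S2 - tri v b c \<and> \<not> same_side (tri v b c) (germ v d) (epath v d u)"
    by (rule edge_side_crossed[OF vn(1,5,3,4) dd(2) X(2)]) blast
  have "\<not> s < t"
  proof
    assume "s < t"
    then have *: "epath v d t \<in> S2 - tri v a b" "\<not> same_side (tri v a b) (germ v d) (epath v d t)" using s(4)[of t] t by auto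
    have "same_side (tri v a b) (germ v d) (epath v d t)"
      by (rule no_edge_crosses_convex_side[OF cv(1) vn(3,4) ne(8) vn(1,2,3) _ _ t(3) *(1)]) (use c in auto)
    then show False using * by blast
  qed
  moreover have "\<not> t < s"
  proof
    assume "t < s"
    then have *: "epath v d s \<in> S2 - tri v b c" "\<not> same_side (tri v b c) (germ v d) (epath v d s)" using t(4)[of s] s by auto
    have "same_side (tri v b c) (germ v d) (epath v d s)"
      by (rule no_edge_crosses_convex_side[OF cv(2) vn(2,3) ne(5) vn(1,3,4) _ _ s(3) *(1)]) (use a in auto)
    then show False using * by blast
  qed
  ultimately have "s = t" by simp
  moreover have "E b a \<inter> E b c = {pt b}" by (rule edge_adjacent) (use vn ne in auto)
  ultimately have "epath v d s = pt b" using s(3) t(3) by (metis IntI insert_commute singletonD)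
  moreover have "epath v d s \<in> E v d" by (rule epath_in) (use vn ne s in auto)
  ultimately show False using edge(3)[of v d b] vn ne by auto
qed

lemma single_crossing_separates:
  assumes vn: "x < n" "y < n" "p < n" "q < n" "r < n" and dist: "distinct [x, y, p, q, r]"
    and X: "X x y p q" "\<not> X x y q r" "\<not> X x y p r"
  shows "\<not> same_side (tri p q r) (pt x) (pt y)"
proof
  assume same: "same_side (tri p q r) (pt x) (pt y)"
  have ne: "x \<noteq> y" "p \<noteq> q" "q \<noteq> r" "p \<noteq> r" using dist by auto
  have T: "tri p q r = E p q \<union> E q r \<union> E p r" by (rule tri_eq) (use vn ne in auto)
  have dd: "distinct [x, y, p, q]" "distinct [p, q, r]" using dist by auto
  obtain z where z: "z \<in> E x y" "z \<in> E p q" using X by (auto simp: X_def)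
  obtain s where s: "z = epath x y s" "0 \<le> s" "s \<le> 1" using z(1) epath_simps(1)[OF vn(1,2) ne(1)] by auto
  have "z \<noteq> pt x" "z \<noteq> pt y"
    using edge_disjoint(3)[OF vn(1-4) dd(1) z vn(1)] edge_disjoint(3)[OF vn(1-4) dd(1) z vn(2)] by auto
  then have "s \<noteq> 0" "s \<noteq> 1" using s(1) epath_simps(2,3)[OF vn(1,2) ne(1)] by auto
  then have s01: "0 < s" "s < 1" using s by auto
  have only: "t = s" if t: "0 \<le> t" "t \<le> 1" "epath x y t \<in> tri p q r" for t
  proof -
    have E: "epath x y t \<in> E x y" using epath_in[OF vn(1,2) ne(1) t(1,2)] .
    then have "epath x y t \<in> E p q" using t(3) X(2,3) unfolding T X_def by blast
    then have "epath x y t = epath x y s" using edge_disjoint(2)[OF vn(1-4) dd(1) z E] s(1) by simp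
    then show ?thesis using epath_eq_iff[OF vn(1,2) ne(1) t(1,2) s(2,3)] by simp
  qed
  have far: "\<not> same_side (tri p q r) (epath x y (s / 2)) (epath x y ((s + 1) / 2))"
  proof (rule edge_switches[OF vn(1-5) dd s01])
    show "epath x y s \<in> E p q" using z s by simp
    show "t = s" if "0 < t" "t < 1" "epath x y t \<in> tri p q r" for t using only[of t] that by simp
  qed (use s01 in auto)
  have av: "epath x y r' \<notin> tri p q r" if "0 \<le> r'" "r' \<le> 1" "r' \<noteq> s" for r' using only that by blast
  have "same_side (tri p q r) (epath x y 0) (epath x y (s / 2))"
    by (rule arc_part_same_side[OF vn(1,2) ne(1)]) (use s01 av in auto)
  then have 1: "same_side (tri p q r) (epath x y (s / 2)) (pt x)"
    using epath_simps(2)[OF vn(1,2) ne(1)] side_sym by auto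
  have "same_side (tri p q r) (epath x y ((s + 1) / 2)) (epath x y 1)"
    by (rule arc_part_same_side[OF vn(1,2) ne(1)]) (use s01 av in auto)
  then have 2: "same_side (tri p q r) (pt y) (epath x y ((s + 1) / 2))"
    using epath_simps(3)[OF vn(1,2) ne(1)] side_sym by auto
  show False
    using far side_trans[OF side_trans[OF 1 same] 2] by blast
qed

text \<open>The side of \<open>acd\<close> where \<open>cv\<close> starts is convex, and
  \<open>v\<close> is on the other side. Since \<open>vb\<close> meets that triangle only in
  \<open>ad\<close>, \<open>b\<close> is on the convex side, and \<open>ab\<close>,
  \<open>db\<close> stay in its closed disc. Hence the side of \<open>acd\<close> containing
  \<open>v\<close> is a connected set that misses the triangle \<open>abd\<close>.\<close>

lemma two_spokes_cross_edge_aux: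
  assumes vn: "v < n" "a < n" "b < n" "c < n" "d < n" and dist: "distinct [v, a, b, c, d]"
    and X: "X v b a d" "X v c a d" and nX: "\<not> X v b a c" "\<not> X v b c d"
    and y: "same_side (tri a d c) (pt v) y"
  shows "same_side (tri a d b) (pt v) y"
proof -
  note ne = distinct5_neq[OF dist]
  have tri: "tri c a d = tri a d c" by (simp add: insert_commute)
  have T: "tri a d b = E a d \<union> E d b \<union> E a b" "tri a d c = E a d \<union> E d c \<union> E a c"
    using tri_eq[of a d b] tri_eq[of a d c] vn ne by auto
  define f where "f = tri_side a d c"
  have f: "same_side (tri a d c) x y \<longleftrightarrow> f x = f y" if "x \<in> S2 - tri a d c" "y \<in> S2 - tri a d c" for x y
    unfolding f_def by (rule tri_side[OF _ _ _ _ that]) (use vn ne in auto)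
  have X': "X c v a d" "\<not> X v b d c" using X nX X_commute by blast+
  have dd: "distinct [c, v, a, d]" "distinct [v, b, a, d, c]" using dist by auto
  have cv: "convex_side c a d (germ c v)" "\<not> same_side (tri a d c) (germ c v) (pt v)"
    using convex_side_germ[OF vn(4,1,2,5) dd(1) X'(1)] unfolding tri by auto
  have sep: "\<not> same_side (tri a d c) (pt v) (pt b)"
    by (rule single_crossing_separates[OF vn(1,3,2,5,4) dd(2) X(1) X'(2) nX(1)])
  have g: "germ c v \<in> S2 - tri a d c" unfolding tri[symmetric] by (rule germ_in) (use vn dist in auto)
  have p: "pt b \<in> S2 - tri a d c" "pt v \<in> S2 - tri a d c" by (rule pt_notin_tri; use vn dist in auto)+
  have gb: "same_side (tri a d c) (germ c v) (pt b)"
    using cv(2) sep f[OF g p(1)] f[OF g p(2)] f[OF p(2,1)] by auto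
  let ?R = "{y. same_side (tri a d c) (pt v) y}"
  have "?R \<inter> tri a d b = {}"
  proof (rule ccontr)
    assume "?R \<inter> tri a d b \<noteq> {}"
    then obtain u where u: "same_side (tri a d c) (pt v) u" "u \<in> tri a d b" by blast
    have uin: "u \<in> S2 - tri a d c" using u(1) side_in by blast
    then have "u \<in> E d b \<or> u \<in> E a b" using u(2) unfolding T by blast
    then have "same_side (tri c a d) (germ c v) u"
    proof
      assume "u \<in> E d b"
      then show ?thesis
        by (intro no_edge_crosses_convex_side[OF cv(1) vn(5,3) ne(9)[symmetric] vn(4,2,5)])
           (use gb uin tri in auto)
    next
      assume "u \<in> E a b"
      then show ?thesis
        by (intro no_edge_crosses_convex_side[OF cv(1) vn(2,3) ne(5) vn(4,2,5)]) (use gb uin tri in auto)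
    qed
    then show False using cv(2) u(1) f[OF g uin] f[OF g p(2)] f[OF p(2) uin] unfolding tri by auto
  qed
  moreover have "?R \<subseteq> S2" using side_in by blast
  ultimately have "?R \<subseteq> S2 - tri a d b" by blast
  moreover have "pt v \<in> ?R" using p(2) connected_component_refl_eq by blast
  ultimately show ?thesis
    using y by (intro connected_componentI[of ?R]) (auto simp: connected_connected_component)
qed

text \<open>Otherwise the sides of the triangles \<open>acd\<close> and \<open>abd\<close> containing \<open>v\<close> would coincide.\<close>

lemma two_spokes_cross_edge:
  assumes vn: "v < n" "a < n" "b < n" "c < n" "d < n" and dist: "distinct [v, a, b, c, d]"
    and X: "X v b a d" "X v c a d"
  shows "X v b a c \<or> X v b c d \<or> X v c a b \<or> X v c b d"
proof (rule ccontr)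
  assume "\<not> ?thesis"
  then have nX: "\<not> X v b a c" "\<not> X v b c d" "\<not> X v c a b" "\<not> X v c b d" by auto
  note ne = distinct5_neq[OF dist]
  have dd: "distinct [v, c, a, d, b]" "distinct [a, d, b]" "distinct [a, d, c]" using dist by auto
  have nX': "\<not> X v c d b" using nX X_commute by blast
  have sep: "\<not> same_side (tri a d b) (pt v) (pt c)"
    by (rule single_crossing_separates[OF vn(1,4,2,5,3) dd(1) X(2) nX' nX(3)])
  have p: "pt c \<in> S2 - tri a d b" "pt v \<in> S2 - tri a d b" "pt v \<in> S2 - tri a d c"
    by (rule pt_notin_tri; use vn dist in auto)+
  have J: "jordan (tri a d b)" "jordan (tri a d c)"
    using tri_jordan[OF vn(2,5,3) dd(2)] tri_jordan[OF vn(2,5,4) dd(3)] by auto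
  obtain W where W: "open W" "{y. same_side (tri a d b) (pt c) y} = S2 \<inter> W"
    using openin_same_side[OF J(1) p(1)] by (auto simp: openin_open)
  have "same_side (tri a d b) (pt c) (pt c)" using p(1) connected_component_refl_eq by blast
  then have cW: "pt c \<in> W" using W(2) by blast
  have cT: "pt c \<in> tri a d c" by (auto simp: subdrawing_def)
  \<comment> \<open>The corner \<open>c\<close> of \<open>acd\<close> lies off the triangle
    \<open>abd\<close>. So points close to \<open>c\<close> on the side of \<open>v\<close> for
    \<open>acd\<close> are on the side of \<open>c\<close> for \<open>abd\<close>.\<close>
  obtain y where y: "y \<in> W" "same_side (tri a d c) (pt v) y"
    by (rule same_side_near[OF J(2) p(3) cT W(1) cW]) blast
  have "y \<in> S2" using y(2) side_in by blast
  then have yc: "same_side (tri a d b) (pt c) y" using W(2) y(1) by blast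
  have "same_side (tri a d b) (pt v) y"
    by (rule two_spokes_cross_edge_aux[OF vn dist X nX(1,2) y(2)])
  then have "same_side (tri a d b) (pt v) (pt c)"
    using side_trans side_sym[OF yc] by blast
  then show False using sep by blast
qed

text \<open>If \<open>vb\<close> misses \<open>ad\<close>, this is the mirror image of
  \<open>spoke_cross_shrink\<close>. If both spokes cross \<open>ad\<close>, two of the four
  outcomes of \<open>two_spokes_cross_edge\<close> let a spoke cross two edges with a common end and
  are excluded.\<close>

lemma spoke_cross_shrink':
  assumes S: "S v a c b d" and vn: "v < n" "a < n" "b < n" "c < n" "d < n" and dist: "distinct [v, a, b, c, d]"
    and X: "X v c a d"
  shows "X v c b d \<or> X v b a c"
proof (cases "X v b a d")
  case False
  have "S v d b c a" using S S_swap[OF vn(1,2,4,3,5)] S_commute dist by auto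
  then have "X v c d b" using spoke_cross_shrink[of v d b c a] X False X_commute vn dist by auto
  then show ?thesis using X_commute by blast
next
  case True
  have sw: "S v b d a c" using S S_swap[OF vn(1,2,4,3,5)] dist by auto
  have "\<not> X v b c d"
  proof
    assume "X v b c d"
    then have "X v b a d" "X v b d c" using True X_commute by blast+
    moreover have "S v a c d b" using S S_commute by blast
    ultimately show False using spoke_not_cross_adjacent_edges[of v a c d b] vn dist by auto
  qed
  moreover have "\<not> X v c a b"
  proof
    assume "X v c a b"
    then have "X v c b a" using X_commute by blast
    then show False using spoke_not_cross_adjacent_edges[of v b d a c] sw X vn dist by auto
  qed
  ultimately show ?thesis using two_spokes_cross_edge[OF vn dist True X] by blast
qed

text \<open>The cyclic order is \<open>a, b, c, d, u\<close>. Shrinking both crossed edges makes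
  \<open>vu\<close> cross \<open>ca\<close> or \<open>bd\<close>, next to an edge it already
  crosses, or else leaves the two crossings \<open>vc\<close> with \<open>bu\<close> and
  \<open>vb\<close> with \<open>cu\<close> among the four vertices
  \<open>v, b, c, u\<close>.\<close>

lemma spoke_not_cross_disjoint_gaps:
  assumes vn: "v < n" "a < n" "b < n" "c < n" "d < n" "u < n" and dist: "distinct [v, a, b, c, d, u]"
    and S: "S v b u c a" "S v c u b d" "S v a d c u" "S v a d b u"
    and X: "X v u a b" "X v u c d"
  shows False
proof -
  have "X v u c a \<or> X v c b u"
    using spoke_cross_shrink'[of v b u c a] S(1) X(1) X_commute vn dist by auto
  moreover have "X v u b d \<or> X v b c u"
    using spoke_cross_shrink'[of v c u b d] S(2) X(2) X_commute vn dist by auto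
  moreover have "\<not> X v u c a"
    using spoke_not_cross_adjacent_edges[of v a d c u] S(3) X(2) X_commute(3) vn dist by auto
  moreover have "\<not> X v u b d"
    using spoke_not_cross_adjacent_edges[of v a d b u] S(4) X(1) vn dist by auto
  moreover have "\<not> (X v c b u \<and> X v b c u)"
    using K4_one_crossing[of v b u c] X_commute(3) vn dist by auto
  ultimately show False by blast
qed

end

section \<open>Counting in the rotation at a vertex\<close>

text \<open>The intended meaning of \<open>S a b c d\<close> is that the pairs \<open>{a,b}\<close> and \<open>{c,d}\<close> alternate in a cyclic order,
  and that of \<open>X u p q\<close> below that the spoke to \<open>u\<close> crosses the edge \<open>pq\<close>.\<close>

locale separation =
  fixes V :: "'a set" and S :: "'a \<Rightarrow> 'a \<Rightarrow> 'a \<Rightarrow> 'a \<Rightarrow> bool"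
  assumes finite_V: "finite V"
    and one: "a \<in> V \<Longrightarrow> b \<in> V \<Longrightarrow> c \<in> V \<Longrightarrow> d \<in> V \<Longrightarrow> distinct [a, b, c, d] \<Longrightarrow>
      exactly_one (S a b c d) (S a c b d) (S b c a d)"
    and com: "S a b c d \<longleftrightarrow> S b a c d" "S a b c d \<longleftrightarrow> S a b d c"
    and swap: "a \<in> V \<Longrightarrow> b \<in> V \<Longrightarrow> c \<in> V \<Longrightarrow> d \<in> V \<Longrightarrow> distinct [a, b, c, d] \<Longrightarrow> S a b c d \<longleftrightarrow> S c d a b"
    and two: "a \<in> V \<Longrightarrow> b \<in> V \<Longrightarrow> c \<in> V \<Longrightarrow> d \<in> V \<Longrightarrow> e \<in> V \<Longrightarrow> distinct [a, b, c, d, e] \<Longrightarrow>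
      S a b c e \<longleftrightarrow> S a b c d \<noteq> S a b d e"
begin

text \<open>Cutting the cycle at \<open>o'\<close> turns \<open>W\<close> into a line, and
  \<open>e\<close> is one of its two ends: nothing is separated by \<open>o'\<close> and
  \<open>e\<close>.\<close>

lemma endpoint_exists:
  assumes "finite W" "W \<noteq> {}" "W \<subseteq> V - {o'}" "o' \<in> V"
  shows "\<exists>e\<in>W. \<forall>q\<in>W. \<forall>r\<in>W. distinct [e, q, r] \<longrightarrow> \<not> S o' e q r"
  using assms
proof (induction W rule: finite_ne_induct)
  case (singleton x)
  then show ?case by auto
next
  case (insert x W)
  then obtain e where e: "e \<in> W" "\<forall>q\<in>W. \<forall>r\<in>W. distinct [e, q, r] \<longrightarrow> \<not> S o' e q r" by auto
  have xe: "x \<noteq> e" using e insert by auto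
  have in_V: "x \<in> V" "x \<noteq> o'" "o' \<in> V" "\<And>w. w \<in> W \<Longrightarrow> w \<in> V \<and> w \<noteq> o' \<and> w \<noteq> x" using insert by auto
  show ?case
  proof (cases "\<exists>q\<in>W. q \<noteq> e \<and> S o' e q x")
    case False
    have "\<not> S o' e q r" if "q \<in> insert x W" "r \<in> insert x W" "distinct [e, q, r]" for q r
      using that e(2) False com(2)[of o' e q r] by auto
    then show ?thesis using e(1) by blast
  next
    case True
    then obtain q0 where q0: "q0 \<in> W" "q0 \<noteq> e" "S o' e q0 x" by blast
    \<comment> \<open>If the new element lies beyond \<open>e\<close> for one element of
      \<open>W\<close>, additivity puts it beyond \<open>e\<close> for all of them, and it becomes
      the new end.\<close>
    have all: "S o' e q x" if "q \<in> W" "q \<noteq> e" for q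
    proof (cases "q = q0")
      case False
      have "\<not> S o' e q q0" using e(2) that q0 False by auto
      moreover have "S o' e q x \<longleftrightarrow> S o' e q q0 \<noteq> S o' e q0 x"
        using e(1) that q0 in_V False xe by (intro two) (auto simp: eq_commute)
      ultimately show ?thesis using q0 by simp
    qed (use q0 in simp)
    have n1: "\<not> S o' x e r" if "r \<in> W" "r \<noteq> e" for r
    proof -
      have "exactly_one (S o' x e r) (S o' e x r) (S x e o' r)"
        using e(1) that in_V xe by (intro one) (auto simp: eq_commute)
      then show ?thesis using all[OF that] com unfolding exactly_one_def by blast
    qed
    have "\<not> S o' x q r" if "q \<in> insert x W" "r \<in> insert x W" "distinct [x, q, r]" for q r
    proof -
      have qr: "q \<in> W" "r \<in> W" "q \<noteq> r" using that by auto
      consider "q = e" | "r = e" | "q \<noteq> e" "r \<noteq> e" by blast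
      then show ?thesis
      proof cases
        case 1
        then show ?thesis using n1 qr by auto
      next
        case 2
        then show ?thesis using n1[of q] qr com(2) by blast
      next
        case 3
        have "S o' x q r \<longleftrightarrow> S o' x q e \<noteq> S o' x e r"
          using e(1) qr in_V 3 xe by (intro two) (auto simp: eq_commute)
        then show ?thesis using n1[of q] n1[of r] qr 3 com(2) by blast
      qed
    qed
    then show ?thesis by blast
  qed
qed

text \<open>The cut point \<open>o'\<close> receives index 0, and the rest is enumerated by rank in
  the linear order that starts at the end \<open>e\<close>.\<close>

lemma linear_enumeration:
  obtains b :: "nat \<Rightarrow> 'a" where "bij_betw b {..<card V} V"
    "\<And>i j k l. i < j \<Longrightarrow> j < k \<Longrightarrow> k < l \<Longrightarrow> l < card V \<Longrightarrow> S (b i) (b k) (b j) (b l)"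
proof (cases "card V \<le> 1")
  case True
  obtain b where "bij_betw b {..<card V} V"
    using finite_V by (metis ex_bij_betw_nat_finite lessThan_atLeast0)
  then show ?thesis using that True by auto
next
  case False
  then obtain o' where o: "o' \<in> V" by fastforce
  define W where "W = V - {o'}"
  have W: "finite W" "W \<noteq> {}" "W \<subseteq> V - {o'}" "card V = Suc (card W)"
  proof -
    show 1: "card V = Suc (card W)" unfolding W_def using o finite_V by (metis card_Suc_Diff1)
    then show "W \<noteq> {}" using False by auto
  qed (use finite_V in \<open>auto simp: W_def\<close>)
  obtain e where e: "e \<in> W" "\<forall>q\<in>W. \<forall>r\<in>W. distinct [e, q, r] \<longrightarrow> \<not> S o' e q r"
    using endpoint_exists[OF W(1-3) o] by blast
  \<comment> \<open>Seen from the end \<open>e\<close>, \<open>p\<close> precedes \<open>q\<close>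
    if \<open>o'\<close> and \<open>p\<close> separate \<open>e\<close> from \<open>q\<close>;
    \<open>e\<close> itself comes before all others.\<close>
  define lt where "lt p q \<longleftrightarrow> p \<noteq> q \<and> (p = e \<or> (q \<noteq> e \<and> S o' p e q))" for p q
  have inV: "p \<in> V" "p \<noteq> o'" if "p \<in> W" for p using that W by auto
  have eo: "e \<in> V" "e \<noteq> o'" using inV e by auto
  have tri: "exactly_one (S o' e p q) (S o' p e q) (S e p o' q)" "S e p o' q = S o' q e p"
    if "p \<in> W" "q \<in> W" "distinct [e, p, q]" for p q
  proof -
    have V: "p \<in> V" "q \<in> V" and dd: "distinct [o', e, p, q]" "distinct [e, p, o', q]"
      using that inV[of p] inV[of q] eo by auto
    show "exactly_one (S o' e p q) (S o' p e q) (S e p o' q)" by (rule one[OF o eo(1) V dd(1)])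
    show "S e p o' q = S o' q e p" by (rule swap[OF eo(1) V(1) o V(2) dd(2)])
  qed
  have total: "lt p q \<or> lt q p" if "p \<in> W" "q \<in> W" "p \<noteq> q" for p q
    using that e tri[of p q] unfolding lt_def exactly_one_def by (metis distinct_length_2_or_more distinct_singleton)
  have asym: "\<not> lt q p" if "lt p q" "p \<in> W" "q \<in> W" for p q
    using that tri[of p q] unfolding lt_def exactly_one_def by (metis distinct_length_2_or_more distinct_singleton)
  have mid: "S o' q p r" if "lt p q" "lt q r" "p \<in> W" "q \<in> W" "r \<in> W" for p q r
  proof (cases "p = e")
    case True
    then show ?thesis using that unfolding lt_def by auto
  next
    case False
    have d: "p \<noteq> q" "q \<noteq> r" "q \<noteq> e" "r \<noteq> e" "S o' p e q" "S o' q e r" using that False unfolding lt_def by auto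
    have "\<not> S o' q e p" using asym[OF that(1,3,4)] d False unfolding lt_def by auto
    moreover have "p \<noteq> r" using asym[OF that(1,3,4)] that(2) by blast
    then have "S o' q e r \<longleftrightarrow> S o' q e p \<noteq> S o' q p r"
      using d False that inV eo o by (intro two) (auto simp: eq_commute)
    ultimately show ?thesis using d by simp
  qed
  have trans: "lt p r" if "lt p q" "lt q r" "p \<in> W" "q \<in> W" "r \<in> W" for p q r
  proof -
    have pr: "p \<noteq> r" using asym[OF that(1,3,4)] that(2) by blast
    show ?thesis
    proof (cases "p = e")
      case True
      then show ?thesis using pr unfolding lt_def by simp
    next
      case False
      have d: "p \<noteq> q" "q \<noteq> r" "q \<noteq> e" "r \<noteq> e" "S o' p e q" "S o' q e r" using that False unfolding lt_def by auto
      have "exactly_one (S o' q p r) (S o' p q r) (S q p o' r)"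
        using d that inV o pr by (intro one) (auto simp: eq_commute)
      then have "\<not> S o' p q r" using mid[OF that] unfolding exactly_one_def by blast
      moreover have "S o' p e r \<longleftrightarrow> S o' p e q \<noteq> S o' p q r"
        using d False that inV eo o pr by (intro two) (auto simp: eq_commute)
      ultimately show ?thesis using d pr unfolding lt_def by simp
    qed
  qed
  define rk where "rk p = card {q \<in> W. lt q p}" for p
  have mono: "rk p < rk q" if "lt p q" "p \<in> W" "q \<in> W" for p q
  proof -
    have "{x \<in> W. lt x p} \<subseteq> {x \<in> W. lt x q}" using that trans[OF _ that(1)] by blast
    moreover have "\<not> lt p p" by (simp add: lt_def)
    ultimately have "{x \<in> W. lt x p} \<subset> {x \<in> W. lt x q}" using that by blast
    then show ?thesis unfolding rk_def using W(1) by (intro psubset_card_mono) auto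
  qed
  have "inj_on rk W" using total mono by (intro inj_onI) (metis less_irrefl)
  moreover have "rk ` W \<subseteq> {..<card W}"
  proof (intro image_subsetI, simp)
    fix p assume "p \<in> W"
    moreover have "\<not> lt p p" by (simp add: lt_def)
    ultimately have "{x \<in> W. lt x p} \<subset> W" by blast
    then show "rk p < card W" unfolding rk_def using W(1) by (intro psubset_card_mono) auto
  qed
  ultimately have bij: "bij_betw rk W {..<card W}"
    by (simp add: bij_betw_def card_image card_subset_eq)
  define g where "g = inv_into W rk"
  have g: "bij_betw g {..<card W} W" unfolding g_def by (rule bij_betw_inv_into[OF bij])
  have gW: "g i \<in> W" if "i < card W" for i using g that by (auto simp: bij_betw_def)
  have rg: "rk (g i) = i" if "i < card W" for i
    unfolding g_def using bij that by (intro f_inv_into_f) (auto simp: bij_betw_def)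
  have glt: "lt (g i) (g j)" if "i < j" "j < card W" for i j
  proof -
    have ij: "i < card W" "rk (g i) = i" "rk (g j) = j" "g i \<in> W" "g j \<in> W"
      using that rg[of i] rg[of j] gW[of i] gW[of j] by auto
    have gne: "g i \<noteq> g j"
    proof
      assume eq: "g i = g j"
      have "i = rk (g i)" using ij(2) by (rule sym)
      also have "\<dots> = rk (g j)" by (simp only: eq)
      also have "\<dots> = j" by (rule ij(3))
      finally show False using that(1) by simp
    qed
    have "\<not> lt (g j) (g i)"
    proof
      assume "lt (g j) (g i)"
      from mono[OF this ij(5,4)] show False unfolding ij(2,3) using that(1) by simp
    qed
    then show ?thesis using total[OF ij(4,5) gne] by blast
  qed
  define b where "b i = (case i of 0 \<Rightarrow> o' | Suc i \<Rightarrow> g i)" for i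
  have "bij_betw b {..<card V} V"
  proof -
    have "{..<card V} = insert 0 (Suc ` {..<card W})" unfolding W(4) by (rule lessThan_Suc_eq_insert_0)
    moreover have "b ` insert 0 (Suc ` {..<card W}) = V"
      using g o unfolding b_def W_def bij_betw_def by (auto simp: image_image)
    ultimately have "b ` {..<card V} = V" by simp
    moreover from this have "inj_on b {..<card V}" using finite_V by (intro eq_card_imp_inj_on) auto
    ultimately show ?thesis by (simp add: bij_betw_def)
  qed
  moreover have "S (b i) (b k) (b j) (b l)" if ij: "i < j" "j < k" "k < l" "l < card V" for i j k l
  proof -
    obtain j' k' l' where s: "j = Suc j'" "k = Suc k'" "l = Suc l'"
      using ij by (metis not0_implies_Suc not_less_zero)
    have l: "j' < k'" "k' < l'" "l' < card W" using ij s W(4) by auto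
    have w: "g j' \<in> W" "g k' \<in> W" "g l' \<in> W" using l gW by auto
    have lts: "lt (g j') (g k')" "lt (g k') (g l')" "lt (g j') (g l')" using glt l by auto
    show ?thesis
    proof (cases i)
      case 0
      then show ?thesis using mid[OF lts(1,2) w] s by (simp add: b_def)
    next
      \<comment> \<open>For four elements of \<open>W\<close>, the axiom \<open>two\<close> splits
        the claim at \<open>o'\<close>, and each half is decided by an instance of
        \<open>mid\<close>.\<close>
      case (Suc i')
      have i: "g i' \<in> W" "lt (g i') (g j')" "lt (g i') (g k')" using glt[of i'] gW[of i'] Suc ij s l by auto
      have ne: "g i' \<noteq> g j'" "g i' \<noteq> g k'" "g i' \<noteq> g l'" "g j' \<noteq> g k'" "g j' \<noteq> g l'" "g k' \<noteq> g l'"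
        using i lts trans[OF i(3) lts(2) i(1) w(2,3)] by (auto simp: lt_def)
      have V: "g i' \<in> V" "g j' \<in> V" "g k' \<in> V" "g l' \<in> V" "g i' \<noteq> o'" "g j' \<noteq> o'" "g k' \<noteq> o'" "g l' \<noteq> o'"
        using inV w i(1) by auto
      have "S o' (g j') (g i') (g k')" using mid[OF i(2) lts(1) i(1) w(1,2)] .
      then have 1: "S (g i') (g k') o' (g j')" using V ne o by (subst swap) auto
      have "S o' (g k') (g i') (g l')" using mid[OF i(3) lts(2) i(1) w(2,3)] .
      moreover have "exactly_one (S o' (g k') (g i') (g l')) (S o' (g i') (g k') (g l')) (S (g k') (g i') o' (g l'))"
        using V ne o by (intro one) auto
      ultimately have 2: "\<not> S (g i') (g k') o' (g l')" using com(1) unfolding exactly_one_def by blast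
      have "S (g i') (g k') (g j') (g l') \<longleftrightarrow> S (g i') (g k') (g j') o' \<noteq> S (g i') (g k') o' (g l')"
        using V ne o by (intro two) auto
      then show ?thesis using 1 2 com(2) Suc s by (simp add: b_def)
    qed
  qed
  ultimately show ?thesis using that by blast
qed

text \<open>The enumeration is continued periodically to all naturals, so that a window of
  \<open>m\<close> consecutive indices may start anywhere and neighbours need no modular
  arithmetic.\<close>

lemma cyclic_enumeration:
  assumes m: "m = card V" "m > 0"
  obtains c :: "nat \<Rightarrow> 'a" where "\<And>i. c i \<in> V" "\<And>i j. c i = c j \<longleftrightarrow> i mod m = j mod m"
    "\<And>x i. x \<in> V \<Longrightarrow> \<exists>k. i \<le> k \<and> k < i + m \<and> c k = x"
    "\<And>i j k l. i < j \<Longrightarrow> j < k \<Longrightarrow> k < l \<Longrightarrow> l < i + m \<Longrightarrow> S (c i) (c k) (c j) (c l)"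
proof -
  obtain b :: "nat \<Rightarrow> 'a" where b: "bij_betw b {..<m} V"
    "\<And>i j k l. i < j \<Longrightarrow> j < k \<Longrightarrow> k < l \<Longrightarrow> l < m \<Longrightarrow> S (b i) (b k) (b j) (b l)"
    using linear_enumeration m(1) by metis
  define c where "c i = b (i mod m)" for i
  have cV: "c i \<in> V" for i using b(1) m(2) by (auto simp: c_def bij_betw_def)
  have inj: "c i = c j \<longleftrightarrow> i mod m = j mod m" for i j
    using b(1) m(2) by (auto simp: c_def bij_betw_def dest: inj_onD)
  have ex: "\<exists>k. i \<le> k \<and> k < i + m \<and> c k = x" if x: "x \<in> V" for x i
  proof -
    obtain r where r: "r < m" "b r = x" using b(1) x by (auto simp: bij_betw_def)
    have "\<exists>k. i \<le> k \<and> k < i + m \<and> k mod m = r"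
    proof (cases "i mod m \<le> r")
      case True
      let ?k = "i - i mod m + r"
      have "i mod m \<le> i" by simp
      then have "i \<le> ?k" "?k < i + m" using True r(1) by linarith+
      moreover have "?k mod m = r" using r by (simp add: minus_mod_eq_mult_div)
      ultimately show ?thesis by blast
    next
      case False
      let ?k = "i - i mod m + m + r"
      have "i mod m < m" "i mod m \<le> i" using m(2) by auto
      then have "i \<le> ?k" "?k < i + m" using False by linarith+
      moreover have "?k = r + m * (i div m + 1)" by (simp add: minus_mod_eq_mult_div)
      then have "?k mod m = r" using r(1) by (metis mod_less mod_mult_self2)
      ultimately show ?thesis by blast
    qed
    then show ?thesis using r by (auto simp: c_def)
  qed
  have ne: "c i \<noteq> c j" if "i < j" "j < i + m" for i j
  proof
    assume "c i = c j"
    then have "m dvd j - i" using that mod_eq_dvd_iff_nat[of i j m] unfolding inj by simp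
    then show False using that nat_dvd_not_less[of "j - i" m] by simp
  qed
  \<comment> \<open>Advancing the window by one replaces index \<open>t\<close> by
    \<open>t + m\<close>, which names the same element; the first of four elements becomes the last,
    and alternation survives this by \<open>swap\<close>.\<close>
  have win: "t \<le> i \<longrightarrow> i < j \<longrightarrow> j < k \<longrightarrow> k < l \<longrightarrow> l < t + m \<longrightarrow> S (c i) (c k) (c j) (c l)" for t i j k l
  proof (induction t arbitrary: i j k l)
    case 0
    then show ?case using b(2) by (simp add: c_def)
  next
    case (Suc t)
    show ?case
    proof (intro impI)
      assume a: "Suc t \<le> i" "i < j" "j < k" "k < l" "l < Suc t + m"
      show "S (c i) (c k) (c j) (c l)"
      proof (cases "l < t + m")
        case True
        then show ?thesis using Suc.IH a by simp
      next
        case False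
        then have l: "l = t + m" using a by simp
        have ct: "c l = c t" unfolding inj l by simp
        have "S (c t) (c j) (c i) (c k)" using Suc.IH[of t i j k] a l by simp
        moreover have "distinct [c t, c j, c i, c k]"
          using a l ne[of t i] ne[of t j] ne[of t k] ne[of i j] ne[of i k] ne[of j k] by auto
        ultimately have "S (c i) (c k) (c t) (c j)" using swap cV by blast
        then show ?thesis using com(2) ct by simp
      qed
    qed
  qed
  show thesis by (rule that[OF cV inj ex]) (use win in blast)+
qed

end

section \<open>Combinatorial count of empty pairs\<close>

text \<open>The axioms are the crossing lemmas at a fixed vertex \<open>v\<close>, with
  \<open>v\<close> suppressed. From here on the count is independent of topology.\<close>

locale spoke_system = separation V S for V :: "'a set" and S +
  fixes X :: "'a \<Rightarrow> 'a \<Rightarrow> 'a \<Rightarrow> bool"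
  assumes Xcom: "X u p q \<longleftrightarrow> X u q p"
    and shrink: "a \<in> V \<Longrightarrow> b \<in> V \<Longrightarrow> c \<in> V \<Longrightarrow> d \<in> V \<Longrightarrow> distinct [a, b, c, d] \<Longrightarrow> S a c b d \<Longrightarrow>
      X b a d \<Longrightarrow> X b a c \<or> X c a d"
    and shrink': "a \<in> V \<Longrightarrow> b \<in> V \<Longrightarrow> c \<in> V \<Longrightarrow> d \<in> V \<Longrightarrow> distinct [a, b, c, d] \<Longrightarrow> S a c b d \<Longrightarrow>
      X c a d \<Longrightarrow> X c b d \<or> X b a c"
    and extend: "a \<in> V \<Longrightarrow> b \<in> V \<Longrightarrow> c \<in> V \<Longrightarrow> d \<in> V \<Longrightarrow> distinct [a, b, c, d] \<Longrightarrow> S a c b d \<Longrightarrow>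
      X b a c \<Longrightarrow> X c a d \<Longrightarrow> X b a d"
    and opposite: "a \<in> V \<Longrightarrow> b \<in> V \<Longrightarrow> c \<in> V \<Longrightarrow> d \<in> V \<Longrightarrow> distinct [a, b, c, d] \<Longrightarrow> S a c b d \<Longrightarrow>
      X b a c \<Longrightarrow> \<not> X d a c"
    and adjacent: "a \<in> V \<Longrightarrow> b \<in> V \<Longrightarrow> c \<in> V \<Longrightarrow> d \<in> V \<Longrightarrow> distinct [a, b, c, d] \<Longrightarrow> S a c b d \<Longrightarrow>
      X d a b \<Longrightarrow> \<not> X d b c"
    and disjoint_gaps: "a \<in> V \<Longrightarrow> b \<in> V \<Longrightarrow> c \<in> V \<Longrightarrow> d \<in> V \<Longrightarrow> u \<in> V \<Longrightarrow> distinct [a, b, c, d, u] \<Longrightarrow>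
      S b u c a \<Longrightarrow> S c u b d \<Longrightarrow> S a d c u \<Longrightarrow> S a d b u \<Longrightarrow> X u a b \<Longrightarrow> \<not> X u c d"
begin

text \<open>A spoke ends on the side of \<open>vpq\<close> where it starts unless it crosses
  \<open>pq\<close>. So the equivalence says that \<open>k\<close> and \<open>l\<close> lie on the
  same side of \<open>vpq\<close>, and altogether that all other vertices share one side.\<close>

definition empty_pair :: "'a \<Rightarrow> 'a \<Rightarrow> bool" where
  "empty_pair p q \<longleftrightarrow> p \<in> V \<and> q \<in> V \<and> p \<noteq> q \<and>
    (\<forall>k\<in>V - {p, q}. \<forall>l\<in>V - {p, q}. k \<noteq> l \<longrightarrow> (S p q k l \<longleftrightarrow> X k p q \<noteq> X l p q))"

text \<open>\<open>\<phi>\<close> charges each of the \<open>m\<close> gaps between consecutive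
  spokes to an empty pair: the gap itself if uncrossed, otherwise an ear, formed by the two
  neighbours of a tip spoke that crosses both the gap and the edge between its neighbours.\<close>

theorem card_empty_pairs:
  assumes m: "m = card V" "m \<ge> 5"
  shows "m \<le> card {{p, q} | p q. empty_pair p q}"
proof -
  obtain c :: "nat \<Rightarrow> 'a" where cV: "\<And>i. c i \<in> V" and ceq: "\<And>i j. c i = c j \<longleftrightarrow> i mod m = j mod m"
    and cex: "\<And>x i. x \<in> V \<Longrightarrow> \<exists>k. i \<le> k \<and> k < i + m \<and> c k = x"
    and cS: "\<And>i j k l. i < j \<Longrightarrow> j < k \<Longrightarrow> k < l \<Longrightarrow> l < i + m \<Longrightarrow> S (c i) (c k) (c j) (c l)"
    using cyclic_enumeration[OF m(1)] m(2) by auto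
  have per: "c (i + m) = c i" for i unfolding ceq by simp
  have ne: "c i \<noteq> c j" if "i < j" "j < i + m" for i j
  proof
    assume "c i = c j"
    then have "m dvd j - i" using that mod_eq_dvd_iff_nat[of i j m] unfolding ceq by simp
    then show False using that nat_dvd_not_less[of "j - i" m] by simp
  qed
  have dist4: "distinct [c i, c j, c k, c l]" if "i < j" "j < k" "k < l" "l < i + m" for i j k l
    using ne[of i j] ne[of i k] ne[of i l] ne[of j k] ne[of j l] ne[of k l] that by simp
  have cS': "\<not> S (c i) (c j) (c k) (c l)" "\<not> S (c j) (c k) (c i) (c l)"
    if "i < j" "j < k" "k < l" "l < i + m" for i j k l
  proof -
    have "exactly_one (S (c i) (c j) (c k) (c l)) (S (c i) (c k) (c j) (c l)) (S (c j) (c k) (c i) (c l))"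
      by (rule one[OF cV cV cV cV dist4[OF that]])
    then show "\<not> S (c i) (c j) (c k) (c l)" "\<not> S (c j) (c k) (c i) (c l)"
      using cS[OF that] unfolding exactly_one_def by blast+
  qed
  have cex': "\<exists>k. i < k \<and> k < i + m \<and> c k = x" if "x \<in> V" "x \<noteq> c i" for x i
    using cex[OF that(1), of i] that(2) by (metis le_neq_implies_less)
  define good where "good i \<longleftrightarrow> (\<forall>k\<in>V. k \<noteq> c i \<longrightarrow> k \<noteq> c (Suc i) \<longrightarrow> \<not> X k (c i) (c (Suc i)))" for i
  have good_empty: "empty_pair (c i) (c (Suc i))" if "good i" for i
    unfolding empty_pair_def
  proof (intro conjI ballI impI)
    show "c i \<noteq> c (Suc i)" using ne[of i "Suc i"] m by simp
    fix k l assume k: "k \<in> V - {c i, c (Suc i)}" and l: "l \<in> V - {c i, c (Suc i)}" and kl: "k \<noteq> l"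
    obtain k' where k': "i < k'" "k' < i + m" "c k' = k" using cex'[of k i] k by auto
    obtain l' where l': "i < l'" "l' < i + m" "c l' = l" using cex'[of l i] l by auto
    have "k' \<noteq> Suc i" "l' \<noteq> Suc i" "k' \<noteq> l'" using k l k' l' kl by auto
    then have "\<not> S (c i) (c (Suc i)) (c k') (c l')"
      using cS'(1)[of i "Suc i" k' l'] cS'(1)[of i "Suc i" l' k'] k' l' com(2) by (metis Suc_lessI lessI nat_neq_iff)
    moreover have "\<not> X k (c i) (c (Suc i))" "\<not> X l (c i) (c (Suc i))" using that k l unfolding good_def by auto
    ultimately show "S (c i) (c (Suc i)) k l \<longleftrightarrow> X k (c i) (c (Suc i)) \<noteq> X l (c i) (c (Suc i))"
      using k' l' by simp
  qed (rule cV)+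
  \<comment> \<open>The tip is alone between its neighbours in the rotation, and by
    \<open>opposite\<close> it alone crosses the edge between them. So the starting side and the
    crossing change together.\<close>
  have ear_empty: "empty_pair (c (u - 1)) (c (Suc u))" if u: "u > 0" "X (c u) (c (u - 1)) (c (Suc u))" for u
    unfolding empty_pair_def
  proof (intro conjI ballI impI)
    show ne1: "c (u - 1) \<noteq> c (Suc u)" using ne[of "u - 1" "Suc u"] m u by simp
    have Xo: "\<not> X k (c (u - 1)) (c (Suc u)) \<and> S (c (u - 1)) (c (Suc u)) (c u) k"
      if k: "k \<in> V - {c (u - 1), c (Suc u)}" "k \<noteq> c u" for k
    proof -
      obtain k' where k': "u - 1 < k'" "k' < u - 1 + m" "c k' = k" using cex'[of k "u - 1"] k by auto
      have "k' \<noteq> u" "k' \<noteq> Suc u" using k k' by auto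
      then have o: "u - 1 < u" "u < Suc u" "Suc u < k'" using k' u by auto
      note S = cS[OF o k'(2)]
      show ?thesis using opposite[OF cV cV cV cV dist4[OF o k'(2)] S u(2)] S k'(3) by simp
    qed
    fix k l assume k: "k \<in> V - {c (u - 1), c (Suc u)}" and l: "l \<in> V - {c (u - 1), c (Suc u)}" and kl: "k \<noteq> l"
    consider "k = c u" | "l = c u" | "k \<noteq> c u" "l \<noteq> c u" by blast
    then show "S (c (u - 1)) (c (Suc u)) k l \<longleftrightarrow> X k (c (u - 1)) (c (Suc u)) \<noteq> X l (c (u - 1)) (c (Suc u))"
    proof cases
      case 1
      then show ?thesis using Xo[OF l] kl u(2) by simp
    next
      case 2
      then show ?thesis using Xo[OF k] kl u(2) com(2) by simp
    next
      case 3
      have "u - 1 < u" "u < u - 1 + m" "Suc u < u + m" using m(2) u(1) by linarith+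
      then have "c u \<noteq> c (u - 1)" "c u \<noteq> c (Suc u)" using ne[of "u - 1" u] ne[of u "Suc u"] by auto
      then have "S (c (u - 1)) (c (Suc u)) k l \<longleftrightarrow>
          S (c (u - 1)) (c (Suc u)) k (c u) \<noteq> S (c (u - 1)) (c (Suc u)) (c u) l"
        using k l kl 3 cV ne1 by (intro two) auto
      then show ?thesis using Xo[OF k 3(1)] Xo[OF l 3(2)] com(2) by simp
    qed
  qed (rule cV)+
  have ear: "\<exists>u. Suc i < u \<and> u < i + m \<and> X (c u) (c i) (c (Suc i)) \<and> X (c u) (c (u - 1)) (c (Suc u))"
    if bad: "\<not> good i" for i
  proof -
    define q where "q = Suc i"
    define p where "p = i + m"
    have cp: "c p = c i" unfolding p_def by (rule per)
    \<comment> \<open>Gap \<open>i\<close> joins \<open>q\<close> to \<open>p\<close>, where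
      \<open>p\<close> is \<open>i\<close> moved up by \<open>m\<close> so that the search runs
      upwards from \<open>q\<close>. For the least \<open>j\<close>, and then the greatest
      \<open>u\<close>, \<open>shrink\<close> forces \<open>j = Suc u\<close>, and
      \<open>shrink'\<close> with \<open>extend\<close> moves the other end from \<open>q\<close> up
      to \<open>u - 1\<close>. Demanding also a crossing with \<open>qp\<close> keeps the tip tied
      to the gap.\<close>
    define P where "P u j \<longleftrightarrow> q < u \<and> u < j \<and> j \<le> p \<and> X (c u) (c q) (c p) \<and> X (c u) (c q) (c j)" for u j
    obtain k where k: "k \<in> V" "k \<noteq> c i" "k \<noteq> c q" "X k (c i) (c q)" using bad unfolding good_def q_def by blast
    obtain k' where k': "i < k'" "k' < i + m" "c k' = k" using cex'[OF k(1,2)] by auto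
    have "k' \<noteq> q" using k' k by auto
    then have "P k' p" unfolding P_def using k k' Xcom[of k] cp by (auto simp: q_def p_def)
    define j where "j = (LEAST j. \<exists>u. P u j)"
    have "\<exists>u. P u j" unfolding j_def using LeastI[of "\<lambda>j. \<exists>u. P u j" p] \<open>P k' p\<close> by blast
    have jmin: "\<not> P u j'" if "j' < j" for u j' using not_less_Least[of j' "\<lambda>j. \<exists>u. P u j"] that unfolding j_def by blast
    define u where "u = Max {u. P u j}"
    have fin: "finite {u. P u j}" by (rule finite_subset[of _ "{..<j}"]) (auto simp: P_def)
    have Pu: "P u j" unfolding u_def using Max_in[OF fin] \<open>\<exists>u. P u j\<close> by blast
    have umax: "u' \<le> u" if "P u' j" for u' unfolding u_def using fin that by (intro Max_ge) auto
    have uj: "q < u" "u < j" "j \<le> p" "X (c u) (c q) (c p)" "X (c u) (c q) (c j)" using Pu unfolding P_def by auto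
    have pq: "p < q + m" unfolding p_def q_def by simp
    have 1: "j = Suc u"
    proof (rule ccontr)
      assume "j \<noteq> Suc u"
      define j' where "j' = j - 1"
      have j': "u < j'" "j' < j" using uj(2) \<open>j \<noteq> Suc u\<close> unfolding j'_def by linarith+
      have n: "\<not> X (c u) (c q) (c j')" using jmin[OF j'(2), of u] uj j' unfolding P_def by auto
      have w: "j < q + m" using uj pq by simp
      have a: "X (c j') (c q) (c j)"
        using shrink[OF cV cV cV cV dist4[OF uj(1) j' w] cS[OF uj(1) j' w] uj(5)] n by blast
      have "X (c j') (c q) (c p)"
        using shrink[OF cV cV cV cV dist4[OF uj(1) j'(1) _ pq] cS[OF uj(1) j'(1) _ pq] uj(4)] n uj(3) j'(2) by auto
      then have "P j' j" using a uj j' unfolding P_def by auto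
      then show False using umax j'(1) by fastforce
    qed
    have "X (c u) (c (u - 1)) (c j)"
    proof (cases "u - 1 = q")
      case True
      then show ?thesis using uj(5) by simp
    next
      case False
      define i' where "i' = u - 1"
      have i': "q < i'" "i' < u" using uj(1) False unfolding i'_def by linarith+
      have w: "j < q + m" using uj pq by simp
      have up: "u < p" using uj by simp
      have "\<not> X (c i') (c q) (c u)"
      proof
        assume a: "X (c i') (c q) (c u)"
        have "X (c i') (c q) (c p)"
          by (rule extend[OF cV cV cV cV dist4[OF i' up pq] cS[OF i' up pq] a uj(4)])
        then have "P i' u" using a i' up unfolding P_def by auto
        then show False using jmin[OF uj(2)] by blast
      qed
      then show ?thesis
        using shrink'[OF cV cV cV cV dist4[OF i' uj(2) w] cS[OF i' uj(2) w] uj(5)] unfolding i'_def by blast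
    qed
    then have "X (c u) (c (u - 1)) (c (Suc u))" using 1 by simp
    moreover have "X (c u) (c i) (c (Suc i))" using uj(4) cp Xcom[of "c u"] unfolding q_def by simp
    ultimately show ?thesis using uj unfolding q_def p_def by auto
  qed
  define ea where "ea i = (SOME u. Suc i < u \<and> u < i + m \<and> X (c u) (c i) (c (Suc i)) \<and>
    X (c u) (c (u - 1)) (c (Suc u)))" for i
  have ea: "Suc i < ea i" "ea i < i + m" "X (c (ea i)) (c i) (c (Suc i))"
    "X (c (ea i)) (c (ea i - 1)) (c (Suc (ea i)))" if "\<not> good i" for i
    using someI_ex[OF ear[OF that]] unfolding ea_def[symmetric] by blast+
  \<comment> \<open>Two gaps with a common end, possibly only after wrapping around, contradict
    \<open>adjacent\<close>. Disjoint gaps contradict \<open>disjoint_gaps\<close>, with indices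
    shifted by \<open>m\<close> where necessary so that the tip comes last.\<close>
  have one_gap: False if ij: "i < j" "j < m" and u: "Suc i < u" "u < i + m" "c u \<noteq> c j" "c u \<noteq> c (Suc j)"
    and X: "X (c u) (c i) (c (Suc i))" "X (c u) (c j) (c (Suc j))" for i j u
  proof -
    have mod_m: "c 0 = c m" using per[of 0] by simp
    have S5: False if abcd: "a < b" "b < c'" "c' < d" "d < w" "w < a + m" and
        XX: "X (c w) (c a) (c b)" "X (c w) (c c') (c d)" for a b c' d w
    proof -
      have am: "a + m < b + m" "a + m < c' + m" using abcd by auto
      have "distinct [c a, c b, c c', c d, c w]"
        using dist4[of a b c' d] dist4[of a b c' w] ne[of d w] abcd by auto
      moreover have "S (c b) (c w) (c c') (c a)" using cS[of b c' w "a + m"] per abcd by simp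
      moreover have "S (c c') (c w) (c b) (c d)"
        using cS[of b c' d w] swap[OF cV cV cV cV dist4[of b c' d w]] abcd dist4[of b c' d w]
          swap[of "c b" "c d" "c c'" "c w"] cV by auto
      moreover have "S (c a) (c d) (c c') (c w)" "S (c a) (c d) (c b) (c w)"
        using cS[of a c' d w] cS[of a b d w] abcd by auto
      ultimately show False using disjoint_gaps[OF cV cV cV cV cV] XX by blast
    qed
    have uj: "u \<noteq> j" "u \<noteq> Suc j" using u by auto
    show False
    proof (cases "j = Suc i")
      case True
      have o: "i < j" "j < Suc j" "Suc j < u" using True u uj by auto
      show False
        using adjacent[OF cV cV cV cV dist4[OF o u(2)] cS[OF o u(2)]] X True by blast
    next
      case False
      show False
      proof (cases "Suc j = i + m")
        case True
        then have o: "j < Suc j" "Suc j < Suc (i + m)" "Suc (i + m) < u + m" "u + m < j + m"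
          using u uj m ij by auto
        have cc: "c (Suc j) = c i" "c (Suc (i + m)) = c (Suc i)" "c (u + m) = c u"
          using True per per[of "Suc i"] by simp_all
        show False
          using adjacent[OF cV cV cV cV dist4[OF o] cS[OF o]] X unfolding cc by blast
      next
        case False
        have sj: "Suc j < i + m" using False ij by linarith
        show False
        proof (cases "u < j")
          case True
          have "c (i + m) = c i" "c (Suc (i + m)) = c (Suc i)" "c (u + m) = c u"
            using per per[of "Suc i"] by simp_all
          then show False
            using S5[of j "Suc j" "i + m" "Suc (i + m)" "u + m"] True sj u X by auto
        next
          case False
          then show False
            using S5[of i "Suc i" j "Suc j" u] \<open>j \<noteq> Suc i\<close> uj u ij X by auto
        qed
      qed
    qed
  qed
  define \<phi> where "\<phi> i = (if good i then {c i, c (Suc i)} else {c (ea i - 1), c (Suc (ea i))})" for i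
  have modeq: "c a = c b \<Longrightarrow> a < b + m \<Longrightarrow> b \<le> a \<Longrightarrow> a = b" for a b
    using ne[of b a] by (metis add.commute le_neq_implies_less)
  have "inj_on \<phi> {..<m}"
  proof (rule linorder_inj_onI)
    fix i j assume ij: "i < j" "i \<in> {..<m}" "j \<in> {..<m}"
    then have im: "j < m" "i < m" by auto
    show "\<phi> i \<noteq> \<phi> j"
    proof
      assume eq: "\<phi> i = \<phi> j"
      have step: "c (Suc a) = c (Suc b)" if "c a = c b" for a b
        using that unfolding ceq by (metis mod_Suc_eq)
      \<comment> \<open>The last inequality is where \<open>m \<ge> 5\<close> matters: for
        \<open>m = 4\<close> two opposite tips have the same pair of neighbours.\<close>
      have no2: "c (Suc (Suc a)) \<noteq> c a" "c (Suc (Suc (Suc a))) \<noteq> c a" "c (Suc (Suc (Suc (Suc a)))) \<noteq> c a" for a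
        using ne[of a "Suc (Suc a)"] ne[of a "Suc (Suc (Suc a))"] ne[of a "Suc (Suc (Suc (Suc a)))"] m(2) by auto
      have no1: "c (Suc a) \<noteq> c a" for a using ne[of a "Suc a"] m(2) by auto
      have gap_ear: False if g: "{c a, c (Suc a)} = {c (b - 1), c (Suc b)}" "b > 0" for a b
      proof -
        obtain b' where b: "b = Suc b'" using g(2) by (metis Suc_pred)
        have "c a = c b' \<and> c (Suc a) = c (Suc (Suc b')) \<or> c a = c (Suc (Suc b')) \<and> c (Suc a) = c b'"
          using g(1) unfolding b by (auto simp: doubleton_eq_iff)
        then show False
        proof
          assume "c a = c b' \<and> c (Suc a) = c (Suc (Suc b'))"
          then show False using step[of a b'] no1[of "Suc b'"] by simp
        next
          assume "c a = c (Suc (Suc b')) \<and> c (Suc a) = c b'"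
          then show False using step[of a "Suc (Suc b')"] no2(2)[of b'] by simp
        qed
      qed
      consider "good i" "good j" | "good i" "\<not> good j" | "\<not> good i" "good j" | "\<not> good i" "\<not> good j" by blast
      then show False
      proof cases
        case 1
        then have "c i = c j \<and> c (Suc i) = c (Suc j) \<or> c i = c (Suc j) \<and> c (Suc i) = c j"
          using eq unfolding \<phi>_def by (auto simp: doubleton_eq_iff)
        then show False
        proof
          assume "c i = c j \<and> c (Suc i) = c (Suc j)"
          then show False using ne[of i j] ij im by simp
        next
          assume "c i = c (Suc j) \<and> c (Suc i) = c j"
          then show False using step[of i "Suc j"] no2(1)[of j] by simp
        qed
      next
        case 2
        then show False using gap_ear[of i "ea j"] eq ea(1)[of j] unfolding \<phi>_def by simp
      next
        case 3
        then show False using gap_ear[of j "ea i"] eq ea(1)[of i] unfolding \<phi>_def by simp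
      next
        case 4
        obtain a where a: "ea i = Suc a" using ea(1)[OF 4(1)] by (metis Suc_lessE)
        obtain b where b: "ea j = Suc b" using ea(1)[OF 4(2)] by (metis Suc_lessE)
        have "c a = c b \<and> c (Suc (Suc a)) = c (Suc (Suc b)) \<or> c a = c (Suc (Suc b)) \<and> c (Suc (Suc a)) = c b"
          using eq 4 a b unfolding \<phi>_def by (auto simp: doubleton_eq_iff)
        then have "c (Suc a) = c (Suc b)"
        proof
          assume "c a = c (Suc (Suc b)) \<and> c (Suc (Suc a)) = c b"
          then show ?thesis using step[of a "Suc (Suc b)"] step[of "Suc a" "Suc (Suc (Suc b))"] no2(3)[of b] by simp
        qed (use step in blast)
        then have same: "c (ea i) = c (ea j)" using a b by simp
        have "c (ea j) \<noteq> c j" "c (ea j) \<noteq> c (Suc j)"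
          using ne[of j "ea j"] ne[of "Suc j" "ea j"] ea(1,2)[OF 4(2)] by auto
        then show False
          using one_gap[OF ij(1) im(1) ea(1,2)[OF 4(1)]] ea(3)[OF 4(1)] ea(3)[OF 4(2)] same by simp
      qed
    qed
  qed auto
  moreover have "\<phi> i \<in> {{p, q} | p q. empty_pair p q}" for i
  proof (cases "good i")
    case True
    then show ?thesis using good_empty unfolding \<phi>_def by auto
  next
    case False
    then have "0 < ea i" using ea(1) by fastforce
    then show ?thesis using False ear_empty ea(4) unfolding \<phi>_def by auto
  qed
  then have "\<phi> ` {..<m} \<subseteq> {{p, q} | p q. empty_pair p q}" by blast
  moreover have "finite {{p, q} | p q. empty_pair p q}"
    by (rule finite_subset[of _ "Pow V"]) (auto simp: empty_pair_def finite_V)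
  ultimately show ?thesis using card_inj_on_le[of \<phi> "{..<m}"] by simp
qed

end

section \<open>Counting empty triangles\<close>

text \<open>The disc is connected, and being open with frontier \<open>J\<close> it is open and
  closed in the complement of \<open>J\<close>, hence a component.\<close>

lemma open_disc_is_side:
  assumes D: "open_disc_bounded_by \<Delta> J" and x: "x \<in> \<Delta>"
  shows "x \<in> S2 - J" "\<Delta> = {y. same_side J x y}"
proof -
  have op: "openin (top_of_set S2) \<Delta>" and h: "\<Delta> homeomorphic ball (0 :: real^2) 1"
    and fr: "top_of_set S2 frontier_of \<Delta> = J" using D by (auto simp: open_disc_bounded_by_def)
  have fr': "J = top_of_set S2 closure_of \<Delta> - \<Delta>" using frontier_of_openin[OF op] fr by simp
  have DS: "\<Delta> \<subseteq> S2" using openin_subset[OF op] by simp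
  have con: "connected \<Delta>" using homeomorphic_connectedness[OF h] by simp
  have cl: "closedin (top_of_set S2) (J \<union> \<Delta>)"
  proof -
    have "\<Delta> \<subseteq> top_of_set S2 closure_of \<Delta>" using DS by (intro closure_of_subset) simp
    then have "J \<union> \<Delta> = top_of_set S2 closure_of \<Delta>" using fr' by blast
    then show ?thesis by simp
  qed
  have DJ: "\<Delta> \<subseteq> S2 - J" using DS fr' by blast
  show xJ: "x \<in> S2 - J" using x DJ by blast
  obtain U where U: "open U" "\<Delta> = S2 \<inter> U" using op by (auto simp: openin_open)
  obtain F where F: "closed F" "J \<union> \<Delta> = S2 \<inter> F" using cl by (auto simp: closedin_closed)
  have "y \<in> \<Delta>" if xy: "same_side J x y" for y
  proof -
    obtain T where T: "connected T" "T \<subseteq> S2 - J" "x \<in> T" "y \<in> T"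
      using xy by (auto simp: connected_component_def)
    have "U \<inter> T = {} \<or> - F \<inter> T = {}"
      by (rule connectedD[OF T(1) U(1) open_Compl[OF F(1)]]) (use U F T in blast)+
    then show ?thesis using T U F x by blast
  qed
  moreover have "same_side J x y" if "y \<in> \<Delta>" for y
    by (rule connected_componentI[OF con DJ x that])
  ultimately show "\<Delta> = {y. same_side J x y}" by blast
qed

lemma finite_open_discs:
  assumes J: "jordan J"
  shows "finite {\<Delta>. open_disc_bounded_by \<Delta> J}"
proof -
  obtain A B where AB: "connected A" "connected B" "openin (top_of_set S2) A" "openin (top_of_set S2) B"
    "A \<inter> B = {}" "A \<union> B = S2 - J" using jordan_sides[OF J] by metis
  have BA: "B \<inter> A = {}" "B \<union> A = S2 - J" using AB by auto
  have "\<Delta> \<in> {A, B}" if D: "open_disc_bounded_by \<Delta> J" for \<Delta>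
  proof -
    have "\<Delta> homeomorphic ball (0 :: real^2) 1" using D by (simp add: open_disc_bounded_by_def)
    then have "\<Delta> \<noteq> {}" using homeomorphic_empty(2) by fastforce
    then obtain x where x: "x \<in> \<Delta>" by blast
    note xs = open_disc_is_side[OF D x]
    then consider "x \<in> A" | "x \<in> B" using AB(6) by blast
    then show ?thesis
    proof cases
      case 1
      then have "{y. same_side J x y} = A" using same_side_iff[OF AB(1,3,4,5,6) 1] by blast
      then show ?thesis using xs(2) by simp
    next
      case 2
      then have "{y. same_side J x y} = B" using same_side_iff[OF AB(2,4,3) BA 2] by blast
      then show ?thesis using xs(2) by simp
    qed
  qed
  then have "{\<Delta>. open_disc_bounded_by \<Delta> J} \<subseteq> {A, B}" by blast
  then show ?thesis using finite_subset by blast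
qed

section \<open>From empty pairs at a vertex to empty triangles of the drawing\<close>

context convex_complete_drawing
begin

lemma S_additive:
  assumes "v < n" "a < n" "b < n" "c < n" "d < n" "e < n" "distinct [v, a, b, c, d, e]"
  shows "S v a b c e \<longleftrightarrow> S v a b c d \<noteq> S v a b d e"
proof -
  have d: "v \<noteq> a" "v \<noteq> b" "a \<noteq> b" using assms by auto
  have g: "germ v c \<in> S2 - tri v a b" "germ v d \<in> S2 - tri v a b" "germ v e \<in> S2 - tri v a b"
    by (rule germ_in; use assms in auto)+
  have dd: "distinct [v, a, b]" using d by simp
  note side = tri_side[OF assms(1-3) dd]
  show ?thesis
    unfolding S_def side[OF g(1,2)] side[OF g(1,3)] side[OF g(2,3)] by blast
qed

lemma spoke_system_at_vertex:
  assumes v: "v < n"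
  shows "spoke_system ({..<n} - {v}) (S v) (X v)"
proof
  fix a b c d e
  assume abcd: "a \<in> {..<n} - {v}" "b \<in> {..<n} - {v}" "c \<in> {..<n} - {v}" "d \<in> {..<n} - {v}"
  then have lt: "a < n" "b < n" "c < n" "d < n" and ne: "v \<noteq> a" "v \<noteq> b" "v \<noteq> c" "v \<noteq> d" by auto
  {
    assume d: "distinct [a, b, c, d]"
    then have d5: "distinct [v, a, b, c, d]" using ne by auto
    show "exactly_one (S v a b c d) (S v a c b d) (S v b c a d)" by (rule S_exactly_one[OF v lt d5])
    show "S v a b c d = S v c d a b" by (rule S_swap[OF v lt d5])
    assume s: "S v a c b d"
    show "X v b a c \<or> X v c a d" if "X v b a d" using spoke_cross_shrink[OF s v lt d5 that] by blast
    show "X v c b d \<or> X v b a c" if "X v c a d" by (rule spoke_cross_shrink'[OF s v lt d5 that])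
    show "X v b a d" if "X v b a c" "X v c a d" by (rule spoke_cross_extend[OF s v lt d5 that])
    show "\<not> X v d a c" if "X v b a c" using opposite_spokes_not_both_cross[OF s v lt d5 that] by blast
    show "\<not> X v d b c" if "X v d a b" using spoke_not_cross_adjacent_edges[OF s v lt d5 that] by blast
  }
  assume e: "e \<in> {..<n} - {v}" and de: "distinct [a, b, c, d, e]"
  then have e': "e < n" "distinct [v, a, b, c, d, e]" using ne by auto
  show "S v a b c e = (S v a b c d \<noteq> S v a b d e)" by (rule S_additive[OF v lt e'])
  assume "S v b e c a" "S v c e b d" "S v a d c e" "S v a d b e" "X v e a b"
  then show "\<not> X v e c d" using spoke_not_cross_disjoint_gaps[OF v lt e'] by blast
qed (simp_all add: S_commute X_commute)

text \<open>Vertex triples are counted in place of discs, because double counting over vertices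
  needs incidence with vertices. If all other vertices share one side, the opposite side is
  empty.\<close>

definition empty_triples :: "nat set set" where
  "empty_triples = {T \<in> nsets {..<n} 3. \<forall>k<n. \<forall>l<n. k \<notin> T \<longrightarrow> l \<notin> T \<longrightarrow> same_side (subdrawing D T) (pt k) (pt l)}"

text \<open>\<open>flip\<close> records that a vertex is on the side of its germ exactly if its
  spoke misses \<open>pq\<close>; with it the condition on \<open>S\<close> and \<open>X\<close>
  becomes equality of sides.\<close>

lemma empty_pair_imp_triple:
  assumes v: "v < n" and pq: "spoke_system.empty_pair ({..<n} - {v}) (S v) (X v) p q"
  shows "{v, p, q} \<in> empty_triples"
proof -
  interpret spoke_system "{..<n} - {v}" "S v" "X v" by (rule spoke_system_at_vertex[OF v])
  have pqn: "p < n" "q < n" "p \<noteq> q" "v \<noteq> p" "v \<noteq> q" and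
    e: "\<And>k l. k \<in> {..<n} - {v} - {p, q} \<Longrightarrow> l \<in> {..<n} - {v} - {p, q} \<Longrightarrow> k \<noteq> l \<Longrightarrow>
      S v p q k l \<longleftrightarrow> X v k p q \<noteq> X v l p q"
    using pq unfolding empty_pair_def by auto
  have d3: "distinct [v, p, q]" using pqn by auto
  have "same_side (tri v p q) (pt k) (pt l)" if kl: "k < n" "l < n" "k \<notin> {v, p, q}" "l \<notin> {v, p, q}" for k l
  proof (cases "k = l")
    case True
    then show ?thesis using pt_notin_tri[OF v pqn(1,2) d3 kl(1,3)] connected_component_refl_eq by blast
  next
    case False
    have d4: "distinct [v, k, p, q]" "distinct [v, l, p, q]" using d3 kl by auto
    note g = germ_in[OF v kl(1) pqn(1,2) d4(1)] germ_in[OF v kl(2) pqn(1,2) d4(2)]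
    note p = pt_notin_tri[OF v pqn(1,2) d3 kl(1,3)] pt_notin_tri[OF v pqn(1,2) d3 kl(2,4)]
    note side = tri_side[OF v pqn(1,2) d3]
    have flip: "tri_side v p q (germ v m) = tri_side v p q (pt m) \<longleftrightarrow> \<not> X v m p q"
      if m: "m = k \<or> m = l" for m
    proof -
      have "m < n" "distinct [v, m, p, q]" "germ v m \<in> S2 - tri v p q" "pt m \<in> S2 - tri v p q"
        using m kl d4 g p by auto
      then show ?thesis
        using edge_side_uncrossed(2)[OF v _ pqn(1,2), of m] convex_side_germ(2)[OF v _ pqn(1,2), of m]
          side[of "germ v m" "pt m"] by blast
    qed
    have "k \<in> {..<n} - {v} - {p, q}" "l \<in> {..<n} - {v} - {p, q}" using kl by auto
    then have "S v p q k l \<longleftrightarrow> X v k p q \<noteq> X v l p q" using e False by blast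
    then show ?thesis
      unfolding S_def side[OF g] side[OF p] using flip[of k] flip[of l] by blast
  qed
  moreover have "{v, p, q} \<in> nsets {..<n} 3" using v pqn by (auto simp: nsets_def)
  ultimately show ?thesis unfolding empty_triples_def by blast
qed

lemma finite_empty_triples: "finite empty_triples"
  unfolding empty_triples_def by (rule finite_subset[of _ "nsets {..<n} 3"]) (auto intro: finite_imp_finite_nsets)

lemma card_empty_triples_at_vertex:
  assumes v: "v < n" and n: "n \<ge> 6"
  shows "n - 1 \<le> card {T \<in> empty_triples. v \<in> T}"
proof -
  interpret spoke_system "{..<n} - {v}" "S v" "X v" by (rule spoke_system_at_vertex[OF v])
  let ?P = "{{p, q} | p q. empty_pair p q}"
  have "n - 1 = card ({..<n} - {v})" using v by simp
  then have "n - 1 \<le> card ?P" using n by (intro card_empty_pairs) auto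
  also have "card ?P \<le> card {T \<in> empty_triples. v \<in> T}"
  proof (rule card_inj_on_le[of "insert v"])
    have nv: "v \<notin> e" if "e \<in> ?P" for e using that unfolding empty_pair_def by auto
    show "inj_on (insert v) ?P"
    proof (rule inj_onI)
      fix e e' assume "e \<in> ?P" "e' \<in> ?P" "insert v e = insert v e'"
      then show "e = e'" using insert_ident[OF nv[of e] nv[of e']] by blast
    qed
    show "insert v ` ?P \<subseteq> {T \<in> empty_triples. v \<in> T}" using empty_pair_imp_triple[OF v] by auto
  qed (simp add: finite_empty_triples)
  finally show ?thesis .
qed

text \<open>Double counting of incident pairs of a vertex and an empty triple.\<close>

lemma card_empty_triples:
  assumes n: "n \<ge> 6"
  shows "n * (n - 1) \<le> 3 * card empty_triples"
proof -
  have "n * (n - 1) = (\<Sum>v<n. n - 1)" by simp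
  also have "\<dots> \<le> (\<Sum>v<n. card {T \<in> empty_triples. v \<in> T})"
    by (intro sum_mono card_empty_triples_at_vertex n) auto
  also have "\<dots> = (\<Sum>v<n. \<Sum>T\<in>empty_triples. if v \<in> T then 1 else 0)"
    by (simp add: sum.If_cases[OF finite_empty_triples] Int_def)
  also have "\<dots> = (\<Sum>T\<in>empty_triples. \<Sum>v<n. if v \<in> T then 1 else 0)" by (rule sum.swap)
  also have "\<dots> = (\<Sum>T\<in>empty_triples. 3)"
  proof (rule sum.cong[OF refl])
    fix T assume "T \<in> empty_triples"
    then have "T \<subseteq> {..<n}" "card T = 3" by (auto simp: empty_triples_def nsets_def)
    then show "(\<Sum>v<n. if v \<in> T then 1 else 0) = (3::nat)" by (simp add: sum.If_cases Int_absorb1)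
  qed
  finally show ?thesis by simp
qed

lemma triple_cases:
  assumes "T \<in> nsets {..<n} 3"
  obtains a b c where "T = {a, b, c}" "a < n" "b < n" "c < n" "distinct [a, b, c]"
  using assms unfolding nsets_def by (auto simp: card_3_iff)

text \<open>An infinite set has \<open>card\<close> 0, so the lower bound depends on finiteness;
  each triangle bounds at most two open discs.\<close>

lemma finite_empty_triangles: "finite (empty_triangles n D)"
proof (rule finite_subset)
  show "empty_triangles n D \<subseteq> (\<Union>T\<in>nsets {..<n} 3. {\<Delta>. open_disc_bounded_by \<Delta> (subdrawing D T)})"
    by (auto simp: empty_triangles_def)
  have "finite {\<Delta>. open_disc_bounded_by \<Delta> (subdrawing D T)}" if Tn: "T \<in> nsets {..<n} 3" for T
  proof -
    obtain a b c where "T = {a, b, c}" "a < n" "b < n" "c < n" "distinct [a, b, c]" using triple_cases[OF Tn] .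
    then show ?thesis using finite_open_discs[OF tri_jordan[of a b c]] by simp
  qed
  then show "finite (\<Union>T\<in>nsets {..<n} 3. {\<Delta>. open_disc_bounded_by \<Delta> (subdrawing D T)})"
    by (intro finite_UN_I) (auto intro: finite_imp_finite_nsets)
qed

text \<open>\<open>n \<ge> 4\<close> supplies a vertex \<open>k\<close> outside \<open>T\<close>.
  All vertices outside \<open>T\<close> are on its side, so the opposite side is the required
  disc.\<close>

lemma empty_triple_disc:
  assumes n: "n \<ge> 4" and T: "T \<in> empty_triples"
  shows "\<exists>\<Delta>. open_disc_bounded_by \<Delta> (subdrawing D T) \<and> \<Delta> \<in> empty_triangles n D"
proof -
  have Tn: "T \<in> nsets {..<n} 3" using T by (simp add: empty_triples_def)
  obtain a b c where abc: "T = {a, b, c}" "a < n" "b < n" "c < n" "distinct [a, b, c]" using triple_cases[OF Tn] .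
  have J: "jordan (subdrawing D T)" unfolding abc(1) by (rule tri_jordan[OF abc(2-)])
  have "card T < card {..<n}" using Tn n by (auto simp: nsets_def)
  moreover have "finite T" using abc(1) by simp
  ultimately obtain k where k: "k < n" "k \<notin> T" by (metis card_mono lessThan_iff not_le subsetI)
  have kS: "pt k \<in> S2 - subdrawing D T" using pt_notin_tri[OF abc(2-) k(1)] k(2) abc(1) by simp
  have aJ: "pt a \<in> subdrawing D T" unfolding subdrawing_def abc(1) by blast
  obtain z where z: "z \<in> S2 - subdrawing D T" "\<not> same_side (subdrawing D T) (pt k) z"
    by (rule same_side_near[OF J kS aJ open_UNIV UNIV_I]) blast
  let ?\<Delta> = "{y. same_side (subdrawing D T) z y}"
  have disc: "open_disc_bounded_by ?\<Delta> (subdrawing D T)" by (rule jordan_side_open_disc[OF J z(1)])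
  have "pt u \<notin> ?\<Delta>" if "u < n" for u
  proof
    assume "pt u \<in> ?\<Delta>"
    then have zu: "same_side (subdrawing D T) z (pt u)" by simp
    then have "pt u \<notin> subdrawing D T" using side_in by blast
    then have "u \<notin> T" unfolding subdrawing_def by blast
    then have "same_side (subdrawing D T) (pt k) (pt u)" using T k that unfolding empty_triples_def by blast
    then have "same_side (subdrawing D T) (pt k) z"
      using side_trans side_sym[OF zu] by blast
    then show False using z(2) by blast
  qed
  then have "?\<Delta> \<in> empty_triangles n D" unfolding empty_triangles_def using disc Tn by blast
  then show ?thesis using disc by blast
qed

text \<open>The frontier of the chosen disc is the triangle, and the only vertices on a triangle are
  its corners, so the disc determines the triple.\<close>

lemma card_empty_triples_le:
  assumes n: "n \<ge> 4"
  shows "card empty_triples \<le> card (empty_triangles n D)"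
proof -
  obtain \<Delta> where \<Delta>: "\<And>T. T \<in> empty_triples \<Longrightarrow> open_disc_bounded_by (\<Delta> T) (subdrawing D T)"
    "\<And>T. T \<in> empty_triples \<Longrightarrow> \<Delta> T \<in> empty_triangles n D"
    using empty_triple_disc[OF n] by metis
  have verts: "T = {u. u < n \<and> pt u \<in> subdrawing D T}" if T: "T \<in> empty_triples" for T
  proof -
    have Tn: "T \<in> nsets {..<n} 3" using T by (simp add: empty_triples_def)
    obtain a b c where abc: "T = {a, b, c}" "a < n" "b < n" "c < n" "distinct [a, b, c]" using triple_cases[OF Tn] .
    have "u \<in> T" if "u < n" "pt u \<in> subdrawing D T" for u
      using pt_notin_tri[OF abc(2-) that(1)] that(2) abc(1) by blast
    moreover have "u < n \<and> pt u \<in> subdrawing D T" if "u \<in> T" for u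
      using that abc unfolding subdrawing_def by auto
    ultimately show ?thesis by blast
  qed
  have "inj_on \<Delta> empty_triples"
  proof (rule inj_onI)
    fix T T' assume T: "T \<in> empty_triples" "T' \<in> empty_triples" and eq: "\<Delta> T = \<Delta> T'"
    have "subdrawing D T = subdrawing D T'"
      using \<Delta>(1)[OF T(1)] \<Delta>(1)[OF T(2)] eq by (simp add: open_disc_bounded_by_def)
    then show "T = T'" using verts[OF T(1)] verts[OF T(2)] by simp
  qed
  then show ?thesis
    using \<Delta>(2) finite_empty_triangles by (intro card_inj_on_le[of \<Delta>]) auto
qed

end

theorem theorem4p7:
  "\<exists>C::real. \<forall>n::nat. \<forall>D::drawing. n \<ge> 3 \<longrightarrow> convex_drawing n D \<longrightarrow>
     real (card (empty_triangles n D)) \<ge> (real n)\<^sup>2 / 3 - C * real n"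
\<comment> \<open>The constant 2 serves both ranges: for \<open>n \<ge> 6\<close> the count n(n-1)/3
  exceeds n^2/3 - 2n, and for smaller \<open>n\<close> that bound is not positive because n^2 \<le>
  6n.\<close>
proof (intro exI[of _ 2] allI impI)
  fix n :: nat and D :: drawing
  assume "n \<ge> 3" and "convex_drawing n D"
  then interpret convex_complete_drawing n D by unfold_locales
  show "real (card (empty_triangles n D)) \<ge> (real n)\<^sup>2 / 3 - 2 * real n"
  proof (cases "n \<ge> 6")
    case True
    have "n * (n - 1) \<le> 3 * card (empty_triangles n D)"
      using card_empty_triples[OF True] card_empty_triples_le True by fastforce
    then have "real (n * (n - 1)) \<le> real (3 * card (empty_triangles n D))" by (rule of_nat_mono)
    then show ?thesis using True by (simp add: of_nat_diff power2_eq_square algebra_simps)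
  next
    case False
    then have "(real n)\<^sup>2 \<le> 6 * real n" by (simp add: power2_eq_square mult_right_mono)
    then have "(real n)\<^sup>2 / 3 - 2 * real n \<le> 0" by simp
    also have "0 \<le> real (card (empty_triangles n D))" by simp
    finally show ?thesis .
  qed
qed

end
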